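(* Let $d\ge 1$, $H\in(\tfrac12,1)$, $T>0$, and assume $\beta\in\big(2H-1,\ d\wedge(2H+1)\big)$. Let $u$ be the mild solution of the linear stochastic wave equation with zero initial conditions driven by the fractional-colored noise $W$ with Hurst index $H$ and Riesz spatial covariance of parameter $\beta$ (as defined in the context). Let $t_0,M>0$ (with $t_0<T$) and fix $x\in[-M,M]^d$. Then there exist positive constants $c_1,c_2$ such that for every $s,t\in[t_0,T]$ $$c_1|t-s|^{2H+1-\beta}\ \le\ \mathbf{E}\,|u(t,x)-u(s,x)|^2\ \le\ c_2|t-s|^{2H+1-\beta}.$$
   Context: Fourier transform convention: $\mathcal F\varphi(\xi)=\int_{\mathbb R^d}e^{-i\xi\cdot x}\varphi(x)\,dx$. Let $\mu(d\xi)=|\xi|^{-d+\beta}d\xi$ on $\mathbb R^d$, $0<\beta<d$, and let $f$ be the Fourier transform of $\mu$ in $\mathcal S'(\mathbb R^d)$, i.e. $\int f\varphi\,dx=\int\mathcal F\varphi\,d\mu$ for $\varphi\in\mathcal S(\mathbb R^d)$ (the Riesz kernel, a constant multiple of $|x|^{-\beta}$). Let $R_H(t,s)=\frac12(t^{2H}+s^{2H}-|t-s|^{2H})$ and $\alpha_H=H(2H-1)$. The noise $W=\{W_t(A):t\ge0,\ A\subset\mathbb R^d \text{ bounded Borel}\}$ is a centered Gaussian family with covariance $\mathbf E(W_t(A)W_s(B))=R_H(t,s)\int_A\int_B f(x-y)\,dx\,dy$. The Hilbert space $\mathcal{HP}$ is the completion of the linear span of the functions $1_{[0,t]\times A}$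 for the inner product $\langle\varphi,\psi\rangle_{\mathcal{HP}}=\alpha_H\int_{\mathbb R^d}\int_0^\infty\int_0^\infty\mathcal F\varphi(r,\cdot)(\xi)\overline{\mathcal F\psi(v,\cdot)(\xi)}|r-v|^{2H-2}\,dr\,dv\,\mu(d\xi)$, and $1_{[0,t]\times A}\mapsto W_t(A)$ extends to an isometry $\varphi\mapsto W(\varphi)=\int_0^\infty\int_{\mathbb R^d}\varphi\,dW$ from $\mathcal{HP}$ into $L^2(\Omega)$. The stochastic wave equation is $\partial_t^2u=\Delta u+\dot W$ on $(0,\infty)\times\mathbb R^d$, $u(0,\cdot)=0$, $\partial_tu(0,\cdot)=0$. Let $G_1$ be the fundamental solution of $u_{tt}-\Delta u=0$, with $\mathcal FG_1(t,\cdot)(\xi)=\sin(t|\xi|)/|\xi|$. The (mild) solution is the centered Gaussian process $u(t,x)=\int_0^t\int_{\mathbb R^d}G_1(t-s,x-y)\,W(ds,dy)$, i.e. $u(t,x)=W(g_{t,x})$ with $g_{t,x}=G_1(t-\cdot,x-\cdot)1_{[0,t]}$; it is well defined for $\beta\in(0,d\wedge(2H+1))$. Equivalently, $u$ is centered Gaussian with $$\mathbf E[u(t,x)u(s,y)]=\alpha_H\int_{\mathbb R^d}\mu(d\xi)\,e^{-i\xi\cdot(x-y)}\int_0^t\int_0^s\frac{\sin((t-r)|\xi|)\,\sin((s-v)|\xi|)}{|\xi|^2}\,|r-v|^{2H-2}\,dv\,dr .$$ *)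

theory Defs
  imports "HOL-Probability.Probability"
begin

definition fourier :: "('a::euclidean_space \<Rightarrow> complex) \<Rightarrow> 'a \<Rightarrow> complex" where
  "fourier \<phi> \<xi> = (LINT x|lborel. exp (- \<i> * complex_of_real (\<xi> \<bullet> x)) * \<phi> x)"

text \<open>In \<open>schwartz\<close>, the function \<open>D [b\<^sub>1, \<dots>, b\<^sub>k]\<close> is the iterated partial derivative of \<open>\<phi>\<close>
  along the basis vectors \<open>b\<^sub>k, \<dots>, b\<^sub>1\<close>. All of them exist, are differentiable and decay faster
  than any power.\<close>

definition schwartz :: "('a::euclidean_space \<Rightarrow> complex) \<Rightarrow> bool" where
  "schwartz \<phi> \<longleftrightarrow> (\<exists>D :: 'a list \<Rightarrow> 'a \<Rightarrow> complex.
     D [] = \<phi> \<and>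
     (\<forall>bs\<in>lists Basis. \<forall>y.
        (D bs has_derivative (\<lambda>h. \<Sum>b\<in>Basis. (h \<bullet> b) *\<^sub>R D (b # bs) y)) (at y)) \<and>
     (\<forall>bs\<in>lists Basis. \<forall>k::nat. bounded (range (\<lambda>y. norm y ^ k *\<^sub>R D bs y))))"

definition spectral_measure :: "real \<Rightarrow> 'a::euclidean_space measure" where
  "spectral_measure \<beta> =
     density lborel (\<lambda>\<xi>. ennreal (norm \<xi> powr (\<beta> - real DIM('a))))"

text \<open>\<open>riesz_kernel \<beta> f\<close>: the function \<open>f\<close> is the Fourier transform of \<open>spectral_measure \<beta>\<close> as a
  tempered distribution. This determines \<open>f\<close> up to null sets.\<close>

definition riesz_kernel :: "real \<Rightarrow> ('a::euclidean_space \<Rightarrow> real) \<Rightarrow> bool" where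
  "riesz_kernel \<beta> f \<longleftrightarrow> f \<in> borel_measurable borel \<and>
     (\<forall>\<phi>. schwartz \<phi> \<longrightarrow>
        integrable lborel (\<lambda>x. complex_of_real (f x) * \<phi> x) \<and>
        (LINT x|lborel. complex_of_real (f x) * \<phi> x) =
          (LINT \<xi>|spectral_measure \<beta>. fourier \<phi> \<xi>))"

text \<open>Gaussian variables may be degenerate, whereas \<open>normal_density\<close> is only a density for
  positive standard deviation.\<close>

definition centered_gaussian :: "'w measure \<Rightarrow> ('w \<Rightarrow> real) \<Rightarrow> bool" where
  "centered_gaussian P X \<longleftrightarrow> X \<in> borel_measurable P \<and>
     ((AE \<omega> in P. X \<omega> = 0) \<or>
      (\<exists>\<sigma>>0. distributed P lborel X (\<lambda>x. ennreal (normal_density 0 \<sigma> x))))"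

definition centered_gaussian_family ::
    "'w measure \<Rightarrow> 'i set \<Rightarrow> ('i \<Rightarrow> 'w \<Rightarrow> real) \<Rightarrow> bool" where
  "centered_gaussian_family P I X \<longleftrightarrow>
     (\<forall>J c. finite J \<and> J \<subseteq> I \<longrightarrow> centered_gaussian P (\<lambda>\<omega>. \<Sum>j\<in>J. c j * X j \<omega>))"

definition R_fbm :: "real \<Rightarrow> real \<Rightarrow> real \<Rightarrow> real" where
  "R_fbm H t s = (t powr (2 * H) + s powr (2 * H) - \<bar>t - s\<bar> powr (2 * H)) / 2"

definition bounded_borel :: "'a::euclidean_space set \<Rightarrow> bool" where
  "bounded_borel A \<longleftrightarrow> bounded A \<and> A \<in> sets borel"

definition fractional_colored_noise ::
    "'w measure \<Rightarrow> real \<Rightarrow> ('a::euclidean_space \<Rightarrow> real) \<Rightarrow> (real \<Rightarrow> 'a set \<Rightarrow> 'w \<Rightarrow> real) \<Rightarrow> bool"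
  where
  "fractional_colored_noise P H f W \<longleftrightarrow>
     centered_gaussian_family P {(t, A). 0 \<le> t \<and> bounded_borel A} (\<lambda>(t, A). W t A) \<and>
     (\<forall>t s A B. 0 \<le> t \<and> 0 \<le> s \<and> bounded_borel A \<and> bounded_borel B \<longrightarrow>
        (LINT \<omega>|P. W t A \<omega> * W s B \<omega>) =
          R_fbm H t s * (LINT x:A|lborel. LINT y:B|lborel. f (x - y)))"

text \<open>The inner product of the space of integrands depends on an integrand \<open>\<phi>\<close> only through its
  Fourier transform in the space variable, \<open>\<Phi> r \<xi> = fourier (\<phi> r) \<xi>\<close>, and the completion contains
  integrands that are merely distributions in space. Integrands are therefore represented by
  \<open>\<Phi>\<close>.\<close>

definition alpha_H :: "real \<Rightarrow> real" where
  "alpha_H H = H * (2 * H - 1)"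

definition hp_time_form ::
    "real \<Rightarrow> (real \<Rightarrow> 'a \<Rightarrow> complex) \<Rightarrow> (real \<Rightarrow> 'a \<Rightarrow> complex) \<Rightarrow> 'a::euclidean_space \<Rightarrow> complex" where
  "hp_time_form H \<Phi> \<Psi> \<xi> =
     (LINT v:{0..}|lborel. LINT r:{0..}|lborel.
        \<Phi> r \<xi> * cnj (\<Psi> v \<xi>) * complex_of_real (\<bar>r - v\<bar> powr (2 * H - 2)))"

definition hp_inner ::
    "real \<Rightarrow> real \<Rightarrow> (real \<Rightarrow> 'a \<Rightarrow> complex) \<Rightarrow> (real \<Rightarrow> 'a::euclidean_space \<Rightarrow> complex) \<Rightarrow> complex"
  where
  "hp_inner H \<beta> \<Phi> \<Psi> =
     complex_of_real (alpha_H H) * (LINT \<xi>|spectral_measure \<beta>. hp_time_form H \<Phi> \<Psi> \<xi>)"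

text \<open>Convergence in the norm induced by \<open>hp_inner\<close>. Integrability is required explicitly because
  the Bochner integral of a non-integrable function is \<open>0\<close>.\<close>

definition hp_tendsto ::
    "real \<Rightarrow> real \<Rightarrow> (nat \<Rightarrow> real \<Rightarrow> 'a \<Rightarrow> complex) \<Rightarrow> (real \<Rightarrow> 'a::euclidean_space \<Rightarrow> complex) \<Rightarrow> bool"
  where
  "hp_tendsto H \<beta> \<Phi>s \<Phi> \<longleftrightarrow>
     (let \<Delta> = (\<lambda>n r \<xi>. \<Phi>s n r \<xi> - \<Phi> r \<xi>) in
       (\<forall>n. integrable (spectral_measure \<beta>) (hp_time_form H (\<Delta> n) (\<Delta> n))) \<and>
       (\<lambda>n. hp_inner H \<beta> (\<Delta> n) (\<Delta> n)) \<longlonglongrightarrow> 0)"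

text \<open>A list of triples \<open>(c, t, A)\<close> stands for the linear combination of the functions
  \<open>1\<^bsub>[0,t] \<times> A\<^esub>\<close> with coefficients \<open>c\<close>.\<close>

type_synonym 'a step = "(real \<times> real \<times> 'a set) list"

definition step :: "'a::euclidean_space step \<Rightarrow> bool" where
  "step p \<longleftrightarrow> (\<forall>(c, t, A)\<in>set p. 0 \<le> t \<and> bounded_borel A)"

definition step_fun :: "'a step \<Rightarrow> real \<Rightarrow> 'a \<Rightarrow> real" where
  "step_fun p r x = (\<Sum>(c, t, A)\<leftarrow>p. c * indicator ({0..t} \<times> A) (r, x))"

definition step_noise :: "(real \<Rightarrow> 'a set \<Rightarrow> 'w \<Rightarrow> real) \<Rightarrow> 'a step \<Rightarrow> 'w \<Rightarrow> real" where
  "step_noise W p \<omega> = (\<Sum>(c, t, A)\<leftarrow>p. c * W t A \<omega>)"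

definition step_hat :: "'a::euclidean_space step \<Rightarrow> real \<Rightarrow> 'a \<Rightarrow> complex" where
  "step_hat p r = fourier (\<lambda>x. complex_of_real (step_fun p r x))"

text \<open>\<open>wiener_integral P H \<beta> W \<Phi> X\<close>: the integrand with spatial Fourier transform \<open>\<Phi>\<close> lies in the
  completion of the linear span of the indicators, and \<open>X\<close> is its integral with respect to \<open>W\<close>,
  i.e. \<open>X\<close> is the value at \<open>\<Phi>\<close> of the continuous extension to the completion, with values in
  \<open>L\<^sup>2(P)\<close>, of the linear map \<open>1\<^bsub>[0,t] \<times> A\<^esub> \<mapsto> W t A\<close>.\<close>

definition wiener_integral ::
    "'w measure \<Rightarrow> real \<Rightarrow> real \<Rightarrow> (real \<Rightarrow> 'a set \<Rightarrow> 'w \<Rightarrow> real) \<Rightarrow>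
     (real \<Rightarrow> 'a::euclidean_space \<Rightarrow> complex) \<Rightarrow> ('w \<Rightarrow> real) \<Rightarrow> bool" where
  "wiener_integral P H \<beta> W \<Phi> X \<longleftrightarrow>
     X \<in> borel_measurable P \<and> integrable P (\<lambda>\<omega>. (X \<omega>)\<^sup>2) \<and>
     (\<exists>p. (\<forall>n. step (p n)) \<and>
        hp_tendsto H \<beta> (\<lambda>n. step_hat (p n)) \<Phi> \<and>
        (\<lambda>n. LINT \<omega>|P. (step_noise W (p n) \<omega> - X \<omega>)\<^sup>2) \<longlonglongrightarrow> 0)"

text \<open>The fundamental solution \<open>G\<^sub>1(t, \<cdot>)\<close> of the wave equation is in general not a function but a
  distribution, given by its spatial Fourier transform \<open>wave_kernel_hat t\<close>. The value at \<open>\<xi> = 0\<close>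
  is irrelevant.\<close>

definition wave_kernel_hat :: "real \<Rightarrow> 'a::euclidean_space \<Rightarrow> real" where
  "wave_kernel_hat t \<xi> = sin (t * norm \<xi>) / norm \<xi>"

text \<open>Spatial Fourier transform of \<open>(r, y) \<mapsto> G\<^sub>1(t - r, x - y) 1\<^bsub>[0,t]\<^esub>(r)\<close>: the transform of
  \<open>y \<mapsto> G(x - y)\<close> at \<open>\<xi>\<close> is \<open>exp (- \<i> \<xi> \<bullet> x)\<close> times the transform of \<open>G\<close> at \<open>- \<xi>\<close>.\<close>

definition wave_integrand_hat :: "real \<Rightarrow> 'a::euclidean_space \<Rightarrow> real \<Rightarrow> 'a \<Rightarrow> complex" where
  "wave_integrand_hat t x r \<xi> =
     indicator {0..t} r * exp (- \<i> * complex_of_real (\<xi> \<bullet> x)) *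
       complex_of_real (wave_kernel_hat (t - r) (- \<xi>))"

definition mild_solution ::
    "'w measure \<Rightarrow> real \<Rightarrow> real \<Rightarrow> (real \<Rightarrow> 'a::euclidean_space set \<Rightarrow> 'w \<Rightarrow> real) \<Rightarrow>
     (real \<Rightarrow> 'a \<Rightarrow> 'w \<Rightarrow> real) \<Rightarrow> bool" where
  "mild_solution P H \<beta> W u \<longleftrightarrow>
     (\<forall>t\<ge>0. \<forall>x. wiener_integral P H \<beta> W (wave_integrand_hat t x) (u t x))"

end

theory Submission
  imports Defs
begin

text \<open>
  Put \<open>a = 2 H - 1\<close> and let \<open>Q(\<phi>)\<close> (\<open>riesz_energy\<close>) be the double integral of
  \<open>\<phi>(r) \<phi>(v)\<^sup>* |r - v|\<^bsup>a - 1\<^esup>\<close>. The increment \<open>u(t,x) - u(s,x)\<close> is the stochastic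
  integral of the difference of two wave kernels, so its second moment is \<open>alpha_H H\<close> times the
  integral of \<open>Q\<close> of the Fourier transform of this difference against the spectral measure. The
  point \<open>x\<close> enters through a phase of modulus one only, hence the integrand depends on \<open>\<xi>\<close> through
  \<open>k = |\<xi>|\<close> alone, and up to a constant the second moment is the integral of
  \<open>k\<^bsup>\<beta> - 3\<^esup> Q(w\<^sub>k)\<close> over \<open>k > 0\<close>, where \<open>w\<^sub>k(r) = sin((t - r) k) - sin((s - r) k)\<close> up to time
  \<open>s\<close> and \<open>w\<^sub>k(r) = sin((t - r) k)\<close> between \<open>s\<close> and \<open>t\<close>.

  Size of \<open>Q(w\<^sub>k)\<close>. Let \<open>h = t - s\<close>. Up to time \<open>s\<close> the function \<open>w\<^sub>k\<close> is
  \<open>2 sin(h k / 2)\<close> times a cosine of frequency \<open>k\<close>, afterwards it is a cosine on an interval of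
  length \<open>h\<close>. On an interval of length \<open>l\<close>, a cosine of frequency \<open>k\<close> has energy at most of order
  \<open>l k\<^bsup>-a\<^esup>\<close>, and for fixed \<open>l\<close> also at least of this order once \<open>k\<close> is large, because the
  integral of \<open>u\<^bsup>a - 1\<^esup> cos u\<close> over \<open>[0,X]\<close> is bounded in \<open>X\<close> and eventually bounded away from
  zero (\<open>trig_energy_le\<close>, \<open>trig_energy_ge\<close>). This gives
  \<open>Q(w\<^sub>k) \<le> C k\<^bsup>-a\<^esup> min(1, h\<^sup>2 k\<^sup>2)\<close>, and integrating against \<open>k\<^bsup>\<beta> - 3\<^esup>\<close> yields the upper
  bound of order \<open>h\<^bsup>a + 2 - \<beta>\<^esup> = h\<^bsup>2 H + 1 - \<beta>\<^esup>\<close>; the integral converges at \<open>0\<close> since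
  \<open>\<beta> > a\<close> and at infinity since \<open>\<beta> < a + 2\<close>.

  For the lower bound and small \<open>h\<close> only the frequencies in \<open>[1/h, 2/h]\<close> are kept: there
  \<open>sin(h k / 2)\<close> is bounded below, and the contribution of \<open>[s,t]\<close> is smaller by a factor \<open>h\<close>
  (\<open>wave_diff_energy_ge_resonant\<close>). When \<open>h\<close> is not small, only the low frequencies
  \<open>k \<le> 1/T\<close> are kept: there \<open>w\<^sub>k\<close> is nonnegative and its energy is at least a constant times the
  square of its integral (\<open>wave_diff_energy_ge_low_frequency\<close>).

  Two facts connect this computation with the noise. The kernel \<open>|r - v|\<^bsup>a - 1\<^esup>\<close> is positive
  definite, being a convolution square (\<open>riesz_form_nonneg\<close>), so \<open>Q\<close> is nonnegative and obeys the
  parallelogram law. And the defining property of the Riesz kernel \<open>f\<close>, which speaks of Schwartz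
  functions, extends to indicators of bounded Borel sets (\<open>riesz_kernel_parseval\<close>), so that the
  noise is an isometry on step functions. Passing to the limit along step functions with the
  inequality \<open>(p + q)\<^sup>2 \<le> 2 p\<^sup>2 + 2 q\<^sup>2\<close> and its analogue for \<open>Q\<close> costs constant factors, which a
  two-sided estimate can afford (\<open>mild_solution_increment_comparable\<close>).
\<close>

section \<open>The energy form of a power kernel in time\<close>

text \<open>With \<open>a = 2 H - 1\<close> this is, up to a constant, the density of the time covariance. On the diagonal it takes the
  value \<open>0\<close> instead of infinity, which affects a null set only.\<close>

abbreviation time_kernel :: "real \<Rightarrow> real \<Rightarrow> real \<Rightarrow> real" where
  "time_kernel a r v \<equiv> \<bar>r - v\<bar> powr (a - 1)"

lemma nn_integral_powr_from_0:
  fixes a c :: real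
  assumes "0 < a" "0 \<le> c"
  shows "(\<integral>\<^sup>+x. ennreal (x powr (a - 1)) * indicator {0..c} x \<partial>lborel) = ennreal (c powr a / a)"
  using has_integral_powr_from_0[of "a - 1" c] assms
  by (intro nn_integral_has_integral_lebesgue') auto

lemma nn_integral_powr_to_inf:
  fixes q c :: real
  assumes "q < -1" "0 < c"
  shows "(\<integral>\<^sup>+x. ennreal (x powr q) * indicator {c..} x \<partial>lborel) = ennreal (- (c powr (q + 1)) / (q + 1))"
  using has_integral_powr_to_inf[of q c] assms
  by (intro nn_integral_has_integral_lebesgue') auto

lemma nn_integral_even:
  fixes f :: "real \<Rightarrow> ennreal"
  assumes [measurable]: "f \<in> borel_measurable borel" and "\<And>x. f (- x) = f x"
    and "f 0 = 0"
  shows "(\<integral>\<^sup>+x. f x \<partial>lborel) = 2 * (\<integral>\<^sup>+x. f x * indicator {0..} x \<partial>lborel)"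
proof -
  have "(\<integral>\<^sup>+x. f x * indicator {..0} x \<partial>lborel) = (\<integral>\<^sup>+x. f x * indicator {0..} x \<partial>lborel)"
    using nn_integral_real_affine[of "\<lambda>x. f x * indicator {..0} x" "-1" 0] assms(2)
    by (simp add: indicator_def)
  moreover have "(\<integral>\<^sup>+x. f x \<partial>lborel) =
    (\<integral>\<^sup>+x. f x * indicator {0..} x + f x * indicator {..0} x \<partial>lborel)"
    using assms(3) by (intro nn_integral_cong) (auto simp: indicator_def not_le)
  ultimately show ?thesis
    by (simp add: nn_integral_add mult_2)
qed

lemma nn_integral_abs_powr:
  fixes a c :: real
  assumes "0 < a" "0 \<le> c"
  shows "(\<integral>\<^sup>+x. ennreal (\<bar>x\<bar> powr (a - 1)) * indicator {-c..c} x \<partial>lborel) = ennreal (2 * c powr a / a)"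
proof -
  have "(\<integral>\<^sup>+x. ennreal (\<bar>x\<bar> powr (a - 1)) * indicator {-c..c} x \<partial>lborel) =
     2 * (\<integral>\<^sup>+x. ennreal (\<bar>x\<bar> powr (a - 1)) * indicator {-c..c} x * indicator {0..} x \<partial>lborel)"
    by (intro nn_integral_even) (auto simp: indicator_def)
  also have "(\<integral>\<^sup>+x. ennreal (\<bar>x\<bar> powr (a - 1)) * indicator {-c..c} x * indicator {0..} x \<partial>lborel)
     = (\<integral>\<^sup>+x. ennreal (x powr (a - 1)) * indicator {0..c} x \<partial>lborel)"
    by (intro nn_integral_cong) (auto simp: indicator_def)
  finally show ?thesis
    using assms by (simp add: nn_integral_powr_from_0 ennreal_mult'[symmetric] flip: ennreal_numeral)
qed

text \<open>Seen from \<open>v\<close>, the interval is contained in the symmetric one of radius \<open>c - b\<close>.\<close>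

lemma nn_integral_abs_powr_shift:
  fixes a b c v :: real
  assumes "0 < a" "v \<in> {b..c}"
  shows "(\<integral>\<^sup>+r. ennreal (time_kernel a r v) * indicator {b..c} r \<partial>lborel)
    \<le> ennreal (2 * (c - b) powr a / a)"
proof -
  have "(\<integral>\<^sup>+r. ennreal (time_kernel a r v) * indicator {b..c} r \<partial>lborel)
     = (\<integral>\<^sup>+x. ennreal (\<bar>x\<bar> powr (a - 1)) * indicator {b..c} (v + x) \<partial>lborel)"
    using nn_integral_real_affine[of "\<lambda>r. ennreal (time_kernel a r v) * indicator {b..c} r" 1 v]
    by simp
  also have "\<dots> \<le> (\<integral>\<^sup>+x. ennreal (\<bar>x\<bar> powr (a - 1)) * indicator {-(c-b)..(c-b)} x \<partial>lborel)"
    using assms(2) by (intro nn_integral_mono) (auto simp: indicator_def)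
  finally show ?thesis
    using assms by (subst (asm) nn_integral_abs_powr) auto
qed

lemma borel_measurable_cnj [measurable]: "cnj \<in> borel_measurable borel"
  by (intro borel_measurable_continuous_onI continuous_on_cnj continuous_on_id)

lemma borel_measurable_complex_of_real [measurable]: "complex_of_real \<in> borel_measurable borel"
  by (intro borel_measurable_continuous_onI continuous_on_of_real continuous_on_id)

definition riesz_form :: "real \<Rightarrow> (real \<Rightarrow> complex) \<Rightarrow> (real \<Rightarrow> complex) \<Rightarrow> complex" where
  "riesz_form a \<phi> \<psi> =
     (LINT v|lborel. LINT r|lborel. \<phi> r * cnj (\<psi> v) * complex_of_real (time_kernel a r v))"

text \<open>Integrands whose form is absolutely convergent: bounded with bounded support. A single number
  \<open>R\<close> serves for both bounds, which makes the class visibly closed under sums.\<close>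

definition tame :: "(real \<Rightarrow> complex) \<Rightarrow> bool" where
  "tame \<phi> \<longleftrightarrow> \<phi> \<in> borel_measurable borel \<and> (\<exists>R\<ge>0. \<forall>r. norm (\<phi> r) \<le> R * indicator {-R..R} r)"

lemma tame_measurable[measurable_dest]: "tame \<phi> \<Longrightarrow> \<phi> \<in> borel_measurable borel"
  by (simp add: tame_def)

lemma tame_add: "tame \<phi> \<Longrightarrow> tame \<psi> \<Longrightarrow> tame (\<lambda>r. \<phi> r + \<psi> r)"
proof -
  assume *: "tame \<phi>" "tame \<psi>"
  then obtain R S where RS: "R \<ge> 0" "S \<ge> 0" "\<And>r. norm (\<phi> r) \<le> R * indicator {-R..R} r"
      "\<And>r. norm (\<psi> r) \<le> S * indicator {-S..S} r"
    unfolding tame_def by blast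
  have "norm (\<phi> r + \<psi> r) \<le> (R + S) * indicator {-(R+S)..(R+S)} r" for r
  proof -
    have "norm (\<phi> r + \<psi> r) \<le> norm (\<phi> r) + norm (\<psi> r)" by (rule norm_triangle_ineq)
    also have "\<dots> \<le> R * indicator {-R..R} r + S * indicator {-S..S} r"
      by (intro add_mono RS)
    also have "\<dots> \<le> (R + S) * indicator {-(R+S)..(R+S)} r"
      using RS(1,2) by (auto simp: indicator_def)
    finally show ?thesis .
  qed
  moreover from * have "(\<lambda>r. \<phi> r + \<psi> r) \<in> borel_measurable borel" by measurable
  ultimately show ?thesis
    unfolding tame_def using RS(1,2) by (metis add_nonneg_nonneg)
qed

lemma tame_cmult: "tame \<phi> \<Longrightarrow> tame (\<lambda>r. c * \<phi> r)"
proof -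
  assume *: "tame \<phi>"
  then obtain R where R: "R \<ge> 0" "\<And>r. norm (\<phi> r) \<le> R * indicator {-R..R} r"
    unfolding tame_def by blast
  define S where "S = max R (norm c * R)"
  have "norm (c * \<phi> r) \<le> S * indicator {-S..S} r" for r
  proof -
    have "norm (c * \<phi> r) \<le> norm c * (R * indicator {-R..R} r)"
      unfolding norm_mult by (intro mult_left_mono R) auto
    also have "\<dots> \<le> S * indicator {-S..S} r"
      using R(1) by (auto simp: indicator_def S_def)
    finally show ?thesis .
  qed
  moreover from * have "(\<lambda>r. c * \<phi> r) \<in> borel_measurable borel" by measurable
  moreover have "S \<ge> 0" using R(1) by (auto simp: S_def)
  ultimately show ?thesis unfolding tame_def by blast
qed

lemma tame_diff: "tame \<phi> \<Longrightarrow> tame \<psi> \<Longrightarrow> tame (\<lambda>r. \<phi> r - \<psi> r)"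
  using tame_add[OF _ tame_cmult[of \<psi> "-1"], of \<phi>] by simp

lemma tame_zero: "tame (\<lambda>r. 0)"
  unfolding tame_def by (auto intro!: exI[of _ 0])

lemma tame_indicator_mult:
  assumes [measurable]: "\<phi> \<in> borel_measurable borel" and B: "\<And>r. r \<in> {b..c} \<Longrightarrow> norm (\<phi> r) \<le> B"
  shows "tame (\<lambda>r. indicator {b..c} r * \<phi> r)"
proof -
  define R where "R = max (max \<bar>B\<bar> \<bar>b\<bar>) \<bar>c\<bar>"
  have "norm (indicator {b..c} r * \<phi> r) \<le> R * indicator {-R..R} r" for r
  proof (cases "r \<in> {b..c}")
    case True
    then have "r \<in> {-R..R}" "norm (\<phi> r) \<le> R" using B[OF True] unfolding R_def by auto
    then show ?thesis using True by simp
  qed (auto simp: R_def indicator_def)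
  moreover have "R \<ge> 0" by (auto simp: R_def)
  moreover have "(\<lambda>r. indicator {b..c} r * \<phi> r) \<in> borel_measurable borel" by measurable
  ultimately show ?thesis unfolding tame_def by blast
qed

lemma nn_integral_tame_kernel:
  assumes "0 < a" "tame \<phi>" "tame \<psi>"
  shows "(\<integral>\<^sup>+v. \<integral>\<^sup>+r. ennreal (norm (\<phi> r) * norm (\<psi> v) * time_kernel a r v) \<partial>lborel \<partial>lborel) < \<infinity>"
proof -
  obtain R S where RS: "R \<ge> 0" "S \<ge> 0" "\<And>r. norm (\<phi> r) \<le> R * indicator {-R..R} r"
      "\<And>r. norm (\<psi> r) \<le> S * indicator {-S..S} r"
    using assms(2,3) unfolding tame_def by blast
  define U where "U = R + S"
  have U: "U \<ge> 0" "\<And>r. norm (\<phi> r) \<le> U * indicator {-U..U} r" "\<And>r. norm (\<psi> r) \<le> U * indicator {-U..U} r"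
  proof -
    show "U \<ge> 0" using RS by (simp add: U_def)
    show "norm (\<phi> r) \<le> U * indicator {-U..U} r" for r
      by (rule order_trans[OF RS(3)]) (use RS(1,2) in \<open>auto simp: U_def indicator_def\<close>)
    show "norm (\<psi> r) \<le> U * indicator {-U..U} r" for r
      by (rule order_trans[OF RS(4)]) (use RS(1,2) in \<open>auto simp: U_def indicator_def\<close>)
  qed
  define D where "D = 2 * (U - (-U)) powr a / a"
  have "(\<integral>\<^sup>+v. \<integral>\<^sup>+r. ennreal (norm (\<phi> r) * norm (\<psi> v) * time_kernel a r v) \<partial>lborel \<partial>lborel)
    \<le> (\<integral>\<^sup>+v. \<integral>\<^sup>+r. ennreal (U * U) * indicator {-U..U} v * (ennreal (time_kernel a r v) * indicator {-U..U} r) \<partial>lborel \<partial>lborel)"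
  proof (intro nn_integral_mono)
    fix v r :: real
    have "norm (\<phi> r) * norm (\<psi> v) * time_kernel a r v
        \<le> (U * indicator {-U..U} r) * (U * indicator {-U..U} v) * time_kernel a r v"
      using U by (intro mult_right_mono mult_mono) auto
    also have "\<dots> = (U * U) * indicator {-U..U} v * (time_kernel a r v * indicator {-U..U} r)"
      by (simp add: ac_simps)
    finally have "ennreal (norm (\<phi> r) * norm (\<psi> v) * time_kernel a r v)
      \<le> ennreal ((U * U) * indicator {-U..U} v * (time_kernel a r v * indicator {-U..U} r))"
      by (rule ennreal_leI)
    also have "\<dots> = ennreal (U * U) * indicator {-U..U} v * (ennreal (time_kernel a r v) * indicator {-U..U} r)"
      using U(1) by (auto simp: indicator_def ennreal_mult'')
    finally show "ennreal (norm (\<phi> r) * norm (\<psi> v) * time_kernel a r v) \<le> \<dots>" .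
  qed
  also have "\<dots> = (\<integral>\<^sup>+v. ennreal (U * U) * indicator {-U..U} v * (\<integral>\<^sup>+r. (ennreal (time_kernel a r v) * indicator {-U..U} r) \<partial>lborel) \<partial>lborel)"
    by (intro nn_integral_cong nn_integral_cmult) auto
  also have "\<dots> \<le> (\<integral>\<^sup>+v. ennreal (U * U) * indicator {-U..U} v * ennreal D \<partial>lborel)"
  proof (rule nn_integral_mono)
    fix v :: real
    show "ennreal (U * U) * indicator {-U..U} v * (\<integral>\<^sup>+r. (ennreal (time_kernel a r v) * indicator {-U..U} r) \<partial>lborel)
       \<le> ennreal (U * U) * indicator {-U..U} v * ennreal D"
      using nn_integral_abs_powr_shift[of a v "-U" U] assms(1) unfolding D_def
      by (cases "v \<in> {-U..U}") (auto intro!: mult_left_mono)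
  qed
  also have "\<dots> = ennreal (U * U) * ennreal D * emeasure lborel {-U..U}"
    by (simp add: mult.assoc mult.commute[of "indicator _ _"] nn_integral_cmult nn_integral_cmult_indicator)
  also have "\<dots> < \<infinity>"
    using U(1) by (simp add: ennreal_mult_less_top)
  finally show ?thesis .
qed

lemma integrable_tame_kernel:
  assumes "0 < a" "tame \<phi>" "tame \<psi>"
  shows "integrable (lborel \<Otimes>\<^sub>M lborel)
    (\<lambda>(v, r). \<phi> r * cnj (\<psi> v) * complex_of_real (time_kernel a r v))"
proof (rule integrableI_bounded)
  note [measurable] = assms(2,3)[THEN tame_measurable]
  show "(\<lambda>(v, r). \<phi> r * cnj (\<psi> v) * complex_of_real (time_kernel a r v))
    \<in> borel_measurable (lborel \<Otimes>\<^sub>M lborel)"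
    by measurable
  have "(\<integral>\<^sup>+x. ennreal (norm (case x of (v, r) \<Rightarrow> \<phi> r * cnj (\<psi> v) * complex_of_real (time_kernel a r v)))
      \<partial>(lborel \<Otimes>\<^sub>M lborel))
    = (\<integral>\<^sup>+v. \<integral>\<^sup>+r. ennreal (norm (\<phi> r) * norm (\<psi> v) * time_kernel a r v) \<partial>lborel \<partial>lborel)"
    by (subst lborel.nn_integral_fst[symmetric]) (auto simp: norm_mult)
  then show "(\<integral>\<^sup>+x. ennreal (norm (case x of (v, r) \<Rightarrow> \<phi> r * cnj (\<psi> v) * complex_of_real (time_kernel a r v)))
      \<partial>(lborel \<Otimes>\<^sub>M lborel)) < \<infinity>"
    using nn_integral_tame_kernel[OF assms] by simp
qed

lemma riesz_form_eq_pair_integral: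
  assumes "0 < a" "tame \<phi>" "tame \<psi>"
  shows "riesz_form a \<phi> \<psi> = (LINT (v, r)|(lborel \<Otimes>\<^sub>M lborel).
     \<phi> r * cnj (\<psi> v) * complex_of_real (time_kernel a r v))"
  unfolding riesz_form_def
  by (rule lborel_pair.integral_fst[OF integrable_tame_kernel[OF assms]])

lemma riesz_form_add_left:
  assumes "0 < a" "tame \<phi>" "tame \<phi>'" "tame \<psi>"
  shows "riesz_form a (\<lambda>r. \<phi> r + \<phi>' r) \<psi> = riesz_form a \<phi> \<psi> + riesz_form a \<phi>' \<psi>"
  using Bochner_Integration.integral_add[OF integrable_tame_kernel[OF assms(1,2,4)]
      integrable_tame_kernel[OF assms(1,3,4)]] assms
  by (simp add: riesz_form_eq_pair_integral tame_add case_prod_beta' distrib_right)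

lemma riesz_form_add_right:
  assumes "0 < a" "tame \<phi>" "tame \<psi>'" "tame \<psi>"
  shows "riesz_form a \<phi> (\<lambda>r. \<psi> r + \<psi>' r) = riesz_form a \<phi> \<psi> + riesz_form a \<phi> \<psi>'"
  using Bochner_Integration.integral_add[OF integrable_tame_kernel[OF assms(1,2,4)]
      integrable_tame_kernel[OF assms(1,2,3)]] assms
  by (simp add: riesz_form_eq_pair_integral tame_add case_prod_beta' distrib_right distrib_left)

lemma riesz_form_cmult_left: "riesz_form a (\<lambda>r. c * \<phi> r) \<psi> = c * riesz_form a \<phi> \<psi>"
  unfolding riesz_form_def by (simp add: mult.assoc)

lemma riesz_form_cmult_right: "riesz_form a \<phi> (\<lambda>r. c * \<psi> r) = cnj c * riesz_form a \<phi> \<psi>"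
proof -
  have *: "x * cnj (c * y) * z = cnj c * (x * cnj y * z)" for x y z by simp
  show ?thesis unfolding riesz_form_def * by simp
qed

text \<open>This is the value of the convolution of \<open>|w|\<^bsup>q\<^esup>\<close> with itself at \<open>1\<close>. By the
  symmetry \<open>w \<mapsto> 1 - w\<close> it suffices to treat the half line on which \<open>w\<close> is closer to \<open>0\<close> than to
  \<open>1\<close>; there the factor in \<open>1 - w\<close> is bounded near \<open>0\<close> and dominated by the factor in \<open>w\<close>
  elsewhere.\<close>

lemma beta_type_integral:
  fixes q :: real
  assumes "-1 < q" "q < -1/2"
  shows "(\<integral>\<^sup>+w. ennreal (\<bar>w\<bar> powr q * \<bar>1 - w\<bar> powr q) \<partial>lborel) < \<infinity>"
proof -
  define B where "B = (1/2::real) powr q"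
  define g where "g w = ennreal B * (ennreal (\<bar>w\<bar> powr q) * indicator {-1..1} w) +
     ennreal (\<bar>w\<bar> powr (2 * q)) * indicator (- {-(1/2)<..<1/2}) w" for w :: real
  have [measurable]: "g \<in> borel_measurable borel" unfolding g_def by measurable
  have le: "ennreal (\<bar>w\<bar> powr q * \<bar>1 - w\<bar> powr q) \<le> g w" if "1/2 \<le> \<bar>1 - w\<bar>" "\<bar>w\<bar> \<le> \<bar>1 - w\<bar>" for w :: real
  proof (cases "\<bar>w\<bar> \<le> 1/2")
    case True
    have "\<bar>1 - w\<bar> powr q \<le> B" unfolding B_def using that assms by (intro powr_mono2') auto
    then have "ennreal (\<bar>w\<bar> powr q * \<bar>1 - w\<bar> powr q) \<le> ennreal (\<bar>w\<bar> powr q * B)"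
      by (intro ennreal_leI mult_left_mono) auto
    also have "\<dots> = ennreal B * (ennreal (\<bar>w\<bar> powr q) * indicator {-1..1} w)"
      using True by (auto simp: ennreal_mult'' B_def ac_simps indicator_def)
    also have "\<dots> \<le> g w" by (simp add: g_def)
    finally show ?thesis .
  next
    case False
    have "\<bar>1 - w\<bar> powr q \<le> \<bar>w\<bar> powr q" using that False assms by (intro powr_mono2') auto
    then have "ennreal (\<bar>w\<bar> powr q * \<bar>1 - w\<bar> powr q) \<le> ennreal (\<bar>w\<bar> powr q * \<bar>w\<bar> powr q)"
      by (intro ennreal_leI mult_left_mono) auto
    also have "\<dots> = ennreal (\<bar>w\<bar> powr (2 * q)) * indicator (- {-(1/2)<..<1/2}) w"
      using False by (auto simp: powr_add[symmetric] indicator_def)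
    also have "\<dots> \<le> g w" by (simp add: g_def)
    finally show ?thesis .
  qed
  have "(\<integral>\<^sup>+w. ennreal (\<bar>w\<bar> powr q * \<bar>1 - w\<bar> powr q) \<partial>lborel) \<le> (\<integral>\<^sup>+w. g w + g (1 - w) \<partial>lborel)"
  proof (rule nn_integral_mono)
    fix w :: real
    consider "1/2 \<le> \<bar>1 - w\<bar>" "\<bar>w\<bar> \<le> \<bar>1 - w\<bar>" | "1/2 \<le> \<bar>w\<bar>" "\<bar>1 - w\<bar> \<le> \<bar>w\<bar>"
      by linarith
    then show "ennreal (\<bar>w\<bar> powr q * \<bar>1 - w\<bar> powr q) \<le> g w + g (1 - w)"
    proof cases
      case 1
      from le[OF this] show ?thesis by (rule order_trans) simp
    next
      case 2
      have "ennreal (\<bar>1 - w\<bar> powr q * \<bar>w\<bar> powr q) \<le> g (1 - w)" using le[of "1 - w"] 2 by simp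
      then show ?thesis by (simp add: mult.commute add_increasing)
    qed
  qed
  also have "\<dots> = (\<integral>\<^sup>+w. g w \<partial>lborel) + (\<integral>\<^sup>+w. g (1 - w) \<partial>lborel)"
    by (intro nn_integral_add) auto
  also have "(\<integral>\<^sup>+w. g (1 - w) \<partial>lborel) = (\<integral>\<^sup>+w. g w \<partial>lborel)"
    using nn_integral_real_affine[of g "-1" 1] by simp
  finally have le2: "(\<integral>\<^sup>+w. ennreal (\<bar>w\<bar> powr q * \<bar>1 - w\<bar> powr q) \<partial>lborel)
      \<le> (\<integral>\<^sup>+w. g w \<partial>lborel) + (\<integral>\<^sup>+w. g w \<partial>lborel)" .
  have "(\<integral>\<^sup>+w. g w \<partial>lborel) < \<infinity>"
  proof -
    have "(\<integral>\<^sup>+w. ennreal (\<bar>w\<bar> powr q) * indicator {-1..1} w \<partial>lborel) < \<infinity>"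
      using nn_integral_abs_powr[of "q + 1" 1] assms by simp
    moreover have "(\<integral>\<^sup>+w. ennreal (\<bar>w\<bar> powr (2 * q)) * indicator (- {-(1/2)<..<1/2::real}) w \<partial>lborel)
      = 2 * (\<integral>\<^sup>+w. ennreal (w powr (2 * q)) * indicator {1/2..} w \<partial>lborel)"
      by (subst nn_integral_even)
         (auto simp: indicator_def intro!: nn_integral_cong arg_cong[where f="\<lambda>x. 2 * x"])
    moreover have "\<dots> < \<infinity>"
      using nn_integral_powr_to_inf[of "2 * q" "1/2"] assms by (simp add: ennreal_mult_less_top)
    ultimately show ?thesis
      unfolding g_def by (subst nn_integral_add)
        (auto simp: nn_integral_cmult ennreal_mult_less_top less_top)
  qed
  then show ?thesis by (intro order_le_less_trans[OF le2]) simp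
qed

text \<open>Translation invariance and scaling determine the convolution up to a constant. With
  \<open>q = a/2 - 1\<close> the exponent \<open>2 q + 1\<close> is \<open>a - 1\<close>, so this exhibits the power kernel as a
  convolution square.\<close>

lemma beta_type_integral_scaled:
  fixes q r v :: real
  assumes "r \<noteq> v"
  shows "(\<integral>\<^sup>+w. ennreal (\<bar>r - w\<bar> powr q * \<bar>v - w\<bar> powr q) \<partial>lborel) =
    ennreal (\<bar>r - v\<bar> powr (2 * q + 1)) * (\<integral>\<^sup>+w. ennreal (\<bar>w\<bar> powr q * \<bar>1 - w\<bar> powr q) \<partial>lborel)"
proof -
  have "(\<integral>\<^sup>+w. ennreal (\<bar>r - w\<bar> powr q * \<bar>v - w\<bar> powr q) \<partial>lborel) =
     ennreal \<bar>v - r\<bar> * (\<integral>\<^sup>+w. ennreal (\<bar>r - (r + (v - r) * w)\<bar> powr q * \<bar>v - (r + (v - r) * w)\<bar> powr q) \<partial>lborel)"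
    using assms by (intro nn_integral_real_affine) auto
  also have "(\<lambda>w. ennreal (\<bar>r - (r + (v - r) * w)\<bar> powr q * \<bar>v - (r + (v - r) * w)\<bar> powr q)) =
     (\<lambda>w. ennreal (\<bar>v - r\<bar> powr (2 * q)) * ennreal (\<bar>w\<bar> powr q * \<bar>1 - w\<bar> powr q))"
  proof
    fix w
    have "r - (r + (v - r) * w) = - ((v - r) * w)" "v - (r + (v - r) * w) = (v - r) * (1 - w)"
      by (simp_all add: algebra_simps)
    then have "\<bar>r - (r + (v - r) * w)\<bar> powr q * \<bar>v - (r + (v - r) * w)\<bar> powr q =
      (\<bar>v - r\<bar> powr q * \<bar>v - r\<bar> powr q) * (\<bar>w\<bar> powr q * \<bar>1 - w\<bar> powr q)"
      by (simp add: abs_mult powr_mult ac_simps)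
    also have "\<bar>v - r\<bar> powr q * \<bar>v - r\<bar> powr q = \<bar>v - r\<bar> powr (2 * q)"
      by (simp flip: powr_add)
    finally show "ennreal (\<bar>r - (r + (v - r) * w)\<bar> powr q * \<bar>v - (r + (v - r) * w)\<bar> powr q) =
      ennreal (\<bar>v - r\<bar> powr (2 * q)) * ennreal (\<bar>w\<bar> powr q * \<bar>1 - w\<bar> powr q)"
      by (simp add: ennreal_mult')
  qed
  also have "(\<integral>\<^sup>+w. ennreal (\<bar>v - r\<bar> powr (2 * q)) * ennreal (\<bar>w\<bar> powr q * \<bar>1 - w\<bar> powr q) \<partial>lborel)
     = ennreal (\<bar>v - r\<bar> powr (2 * q)) * (\<integral>\<^sup>+w. ennreal (\<bar>w\<bar> powr q * \<bar>1 - w\<bar> powr q) \<partial>lborel)"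
    by (intro nn_integral_cmult) auto
  finally show ?thesis
    using assms by (simp add: mult.assoc[symmetric] ennreal_mult'[symmetric] abs_minus_commute[of v r]
        powr_add mult.commute)
qed

text \<open>Positive definiteness: writing the kernel as the integral over \<open>w\<close> of
  \<open>e(r,w) e(v,w)\<close> and exchanging the integrals turns the form into the integral over \<open>w\<close> of the
  squared modulus of \<open>\<integral> \<phi>(r) e(r,w) dr\<close>.\<close>

lemma riesz_form_nonneg:
  assumes a: "0 < a" "a < 1" and "tame \<phi>"
  shows "\<exists>c\<ge>0. riesz_form a \<phi> \<phi> = complex_of_real c"
proof -
  note [measurable] = \<open>tame \<phi>\<close>[THEN tame_measurable]
  define q where "q = a / 2 - 1"
  have q: "-1 < q" "q < -1/2" "2 * q + 1 = a - 1" using a by (auto simp: q_def field_simps)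
  define e where "e r w = \<bar>r - w\<bar> powr q" for r w :: real
  have [measurable]: "(\<lambda>x. e (f x) (g x)) \<in> borel_measurable M"
    if [measurable]: "f \<in> borel_measurable M" "g \<in> borel_measurable M" for f g and M :: "'z measure"
    unfolding e_def by measurable
  define C where "C = enn2real (\<integral>\<^sup>+w. ennreal (\<bar>w\<bar> powr q * \<bar>1 - w\<bar> powr q) \<partial>lborel)"
  have C: "(\<integral>\<^sup>+w. ennreal (\<bar>w\<bar> powr q * \<bar>1 - w\<bar> powr q) \<partial>lborel) = ennreal C" "C \<ge> 0"
    using beta_type_integral[OF q(1,2)] by (auto simp: C_def less_top)
  (* C is the integral of a function that is positive off {0, 1}; the division by C below needs
     this. *)
  have "C \<noteq> 0"
  proof
    assume "C = 0"
    then have "AE w in lborel. ennreal (\<bar>w\<bar> powr q * \<bar>1 - w\<bar> powr q) = 0"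
      using C by (subst nn_integral_0_iff_AE[symmetric]) auto
    then have "AE w in lborel. (w::real) = 0 \<or> w = 1"
      by eventually_elim (auto simp: ennreal_eq_0_iff mult_le_0_iff)
    moreover have "AE w in lborel. (w::real) \<noteq> 0" "AE w in lborel. (w::real) \<noteq> 1"
      by (rule AE_lborel_singleton)+
    ultimately have "AE w in lborel. (w::real) \<in> {}"
      by eventually_elim auto
    then have "emeasure lborel (UNIV :: real set) = 0"
      by (subst (asm) AE_iff_measurable[of UNIV]) auto
    then show False by simp
  qed
  with C have "C > 0" by simp
  have e_int: "(\<integral>\<^sup>+w. ennreal (e r w * e v w) \<partial>lborel) = ennreal (time_kernel a r v * C)" if "r \<noteq> v" for r v
    using beta_type_integral_scaled[OF that, of q] unfolding e_def q(3) C(1) using C(2) by (simp add: ennreal_mult'')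
  have e_int': "integrable lborel (\<lambda>w. e r w * e v w)" "(LINT w|lborel. e r w * e v w) = time_kernel a r v * C"
    if "r \<noteq> v" for r v
    using e_int[OF that] C(2)
    by (auto intro!: integrableI_bounded simp: e_def integral_eq_nn_integral)
  define F where "F x w = \<phi> (snd x) * cnj (\<phi> (fst x)) * complex_of_real (e (snd x) w * e (fst x) w)" for x w
  interpret L2: sigma_finite_measure "lborel \<Otimes>\<^sub>M lborel :: (real \<times> real) measure"
    unfolding lborel_prod by (rule lborel.sigma_finite_measure_axioms)
  interpret P3: pair_sigma_finite "lborel \<Otimes>\<^sub>M lborel :: (real \<times> real) measure" "lborel :: real measure" ..
  have [measurable]: "case_prod F \<in> borel_measurable ((lborel \<Otimes>\<^sub>M lborel) \<Otimes>\<^sub>M lborel)"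
    unfolding F_def by measurable
  have intF: "integrable ((lborel \<Otimes>\<^sub>M lborel) \<Otimes>\<^sub>M lborel) (case_prod F)"
  proof (rule integrableI_bounded)
    have "(\<integral>\<^sup>+x. ennreal (norm (case_prod F x)) \<partial>((lborel \<Otimes>\<^sub>M lborel) \<Otimes>\<^sub>M lborel))
      = (\<integral>\<^sup>+v. \<integral>\<^sup>+r. (\<integral>\<^sup>+w. ennreal (norm (F (v, r) w)) \<partial>lborel) \<partial>lborel \<partial>lborel)"
      by (subst lborel.nn_integral_fst[symmetric], simp, subst lborel.nn_integral_fst[symmetric]) auto
    also have "\<dots> = (\<integral>\<^sup>+v. \<integral>\<^sup>+r. ennreal C * ennreal (norm (\<phi> r) * norm (\<phi> v) * time_kernel a r v) \<partial>lborel \<partial>lborel)"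
    proof (rule nn_integral_cong, rule nn_integral_cong_AE)
      fix v :: real
      show "AE r in lborel. (\<integral>\<^sup>+w. ennreal (norm (F (v, r) w)) \<partial>lborel) =
         ennreal C * ennreal (norm (\<phi> r) * norm (\<phi> v) * time_kernel a r v)"
        using AE_lborel_singleton[of v]
      proof eventually_elim
        case (elim r)
        have "(\<integral>\<^sup>+w. ennreal (norm (F (v, r) w)) \<partial>lborel) =
          (\<integral>\<^sup>+w. ennreal (norm (\<phi> r) * norm (\<phi> v)) * ennreal (e r w * e v w) \<partial>lborel)"
          by (intro nn_integral_cong) (simp add: F_def norm_mult e_def ennreal_mult' abs_mult)
        also have "\<dots> = ennreal (norm (\<phi> r) * norm (\<phi> v)) * (\<integral>\<^sup>+w. ennreal (e r w * e v w) \<partial>lborel)"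
          by (intro nn_integral_cmult) auto
        finally show ?case
          using elim C(2) by (simp add: e_int ennreal_mult'[symmetric] ac_simps)
      qed
    qed
    also have "\<dots> = ennreal C * (\<integral>\<^sup>+v. \<integral>\<^sup>+r. ennreal (norm (\<phi> r) * norm (\<phi> v) * time_kernel a r v) \<partial>lborel \<partial>lborel)"
      by (simp add: nn_integral_cmult)
    also have "\<dots> < \<infinity>"
      using nn_integral_tame_kernel[OF a(1) assms(3) assms(3)] by (simp add: ennreal_mult_less_top)
    finally show "(\<integral>\<^sup>+x. ennreal (norm (case_prod F x)) \<partial>((lborel \<Otimes>\<^sub>M lborel) \<Otimes>\<^sub>M lborel)) < \<infinity>" .
  qed simp
  have "C * riesz_form a \<phi> \<phi> = (LINT v|lborel. LINT r|lborel. LINT w|lborel. F (v, r) w)"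
  proof -
    have "(LINT r|lborel. C * (\<phi> r * cnj (\<phi> v) * complex_of_real (time_kernel a r v))) =
        (LINT r|lborel. LINT w|lborel. F (v, r) w)" for v
    proof (rule integral_cong_AE)
      show "AE r in lborel. C * (\<phi> r * cnj (\<phi> v) * complex_of_real (time_kernel a r v)) = (LINT w|lborel. F (v, r) w)"
        using AE_lborel_singleton[of v]
      proof eventually_elim
        case (elim r)
        have "(LINT w|lborel. F (v, r) w) = \<phi> r * cnj (\<phi> v) * (LINT w|lborel. complex_of_real (e r w * e v w))"
          unfolding F_def by simp
        also have "\<dots> = \<phi> r * cnj (\<phi> v) * complex_of_real (time_kernel a r v * C)"
          by (simp only: integral_complex_of_real e_int'(2)[OF elim])
        finally show ?case by simp
      qed
    qed measurable
    then show ?thesis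
      unfolding riesz_form_def integral_mult_right_zero[symmetric] by simp
  qed
  also have "\<dots> = (LINT x|(lborel \<Otimes>\<^sub>M lborel). LINT w|lborel. F x w)"
    using lborel_pair.integral_fst'[OF P3.integrable_fst[OF intF]] by simp
  also have "\<dots> = (LINT w|lborel. LINT x|(lborel \<Otimes>\<^sub>M lborel). F x w)"
    by (rule P3.Fubini_integral[OF intF, symmetric])
  also have "\<dots> = (LINT w|lborel. complex_of_real ((norm (LINT r|lborel. \<phi> r * e r w))\<^sup>2))"
  proof (rule integral_cong_AE)
    have "AE w in lborel. integrable (lborel \<Otimes>\<^sub>M lborel) (\<lambda>x. F x w)"
      by (rule P3.AE_integrable_snd[OF intF])
    then show "AE w in lborel. (LINT x|(lborel \<Otimes>\<^sub>M lborel). F x w) = complex_of_real ((norm (LINT r|lborel. \<phi> r * e r w))\<^sup>2)"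
    proof eventually_elim
      case (elim w)
      define J where "J = (LINT r|lborel. \<phi> r * e r w)"
      have "(LINT x|(lborel \<Otimes>\<^sub>M lborel). F x w) = (LINT v|lborel. LINT r|lborel. F (v, r) w)"
        using lborel_pair.integral_fst'[OF elim] by simp
      also have "\<dots> = (LINT v|lborel. cnj (\<phi> v * e v w) * (LINT r|lborel. \<phi> r * e r w))"
        unfolding F_def by (simp add: ac_simps flip: integral_mult_right_zero)
      also have "\<dots> = (LINT v|lborel. cnj (\<phi> v * e v w)) * J"
        unfolding J_def by simp
      also have "(LINT v|lborel. cnj (\<phi> v * e v w)) = cnj J"
        unfolding J_def
            by (rule integral_bounded_linear'[OF bounded_linear_cnj bounded_linear_cnj]) simp
      finally show ?case unfolding complex_norm_square J_def by (simp add: mult.commute)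
    qed
  qed measurable
  also have "\<dots> = complex_of_real (LINT w|lborel. (norm (LINT r|lborel. \<phi> r * e r w))\<^sup>2)"
    by (rule integral_complex_of_real)
  finally have *: "C * riesz_form a \<phi> \<phi> = complex_of_real (LINT w|lborel. (norm (LINT r|lborel. \<phi> r * e r w))\<^sup>2)" .
  show ?thesis
  proof (intro exI conjI)
    show "0 \<le> (LINT w|lborel. (norm (LINT r|lborel. \<phi> r * e r w))\<^sup>2) / C"
      using C(2) by simp
    show "riesz_form a \<phi> \<phi> = complex_of_real ((LINT w|lborel. (norm (LINT r|lborel. \<phi> r * e r w))\<^sup>2) / C)"
      using * \<open>C > 0\<close> by (simp add: field_simps)
  qed
qed

definition riesz_energy :: "real \<Rightarrow> (real \<Rightarrow> complex) \<Rightarrow> real" where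
  "riesz_energy a \<phi> = Re (riesz_form a \<phi> \<phi>)"

lemma riesz_energy_nonneg: "0 < a \<Longrightarrow> a < 1 \<Longrightarrow> tame \<phi> \<Longrightarrow> 0 \<le> riesz_energy a \<phi>"
  using riesz_form_nonneg[of a \<phi>] unfolding riesz_energy_def by auto

lemma riesz_form_self: "0 < a \<Longrightarrow> a < 1 \<Longrightarrow> tame \<phi> \<Longrightarrow> riesz_form a \<phi> \<phi> = complex_of_real (riesz_energy a \<phi>)"
  using riesz_form_nonneg[of a \<phi>] unfolding riesz_energy_def by auto

text \<open>Parallelogram law, with the energy of the difference dropped because it is nonnegative.\<close>

lemma riesz_energy_add_le:
  assumes a: "0 < a" "a < 1" and t: "tame \<phi>" "tame \<psi>"
  shows "riesz_energy a (\<lambda>r. \<phi> r + \<psi> r) \<le> 2 * riesz_energy a \<phi> + 2 * riesz_energy a \<psi>"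
proof -
  define \<psi>' where "\<psi>' = (\<lambda>r. (-1) * \<psi> r)"
  have t': "tame \<psi>'" unfolding \<psi>'_def using t(2) by (rule tame_cmult)
  have [simp]: "riesz_form a f \<psi>' = - riesz_form a f \<psi>" "riesz_form a \<psi>' f = - riesz_form a \<psi> f" for f
    unfolding \<psi>'_def riesz_form_cmult_left riesz_form_cmult_right by simp_all
  have "riesz_energy a (\<lambda>r. \<phi> r + \<psi> r) + riesz_energy a (\<lambda>r. \<phi> r + \<psi>' r) =
     2 * riesz_energy a \<phi> + 2 * riesz_energy a \<psi>"
    unfolding riesz_energy_def using a t t'
    by (simp add: riesz_form_add_left riesz_form_add_right tame_add)
  moreover have "0 \<le> riesz_energy a (\<lambda>r. \<phi> r + \<psi>' r)"
    using a t t' by (intro riesz_energy_nonneg tame_add)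
  ultimately show ?thesis by linarith
qed

lemma riesz_energy_cmult: "riesz_energy a (\<lambda>r. c * \<phi> r) = (norm c)\<^sup>2 * riesz_energy a \<phi>"
proof -
  have "riesz_form a (\<lambda>r. c * \<phi> r) (\<lambda>r. c * \<phi> r) = (c * cnj c) * riesz_form a \<phi> \<phi>"
    by (simp add: riesz_form_cmult_left riesz_form_cmult_right)
  also have "c * cnj c = complex_of_real ((norm c)\<^sup>2)" by (rule complex_norm_square[symmetric])
  finally show ?thesis unfolding riesz_energy_def by simp
qed

section \<open>The oscillating integral of a cosine against a power\<close>

lemma integrable_abs_powr_weighted:
  fixes g :: "real \<Rightarrow> real"
  assumes "0 < a" and [measurable]: "g \<in> borel_measurable borel"
    and B: "\<And>r. r \<in> {b..c} \<Longrightarrow> \<bar>g r\<bar> \<le> B"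
  shows "integrable lborel (\<lambda>r. indicator {b..c} r * (g r * time_kernel a r v))"
proof -
  define l u where "l = min b v" and "u = max c v"
  have lu: "v \<in> {l..u}" "{b..c} \<subseteq> {l..u}" by (auto simp: l_def u_def)
  have "integrable lborel (\<lambda>r. time_kernel a r v * indicator {l..u} r)"
  proof (rule integrableI_bounded)
    have "(\<integral>\<^sup>+r. ennreal (norm (time_kernel a r v * indicator {l..u} r)) \<partial>lborel)
       = (\<integral>\<^sup>+r. ennreal (time_kernel a r v) * indicator {l..u} r \<partial>lborel)"
      by (intro nn_integral_cong) (auto simp: indicator_def)
    also have "\<dots> < \<infinity>"
      using nn_integral_abs_powr_shift[OF assms(1) lu(1)] by (rule order_le_less_trans) simp
    finally show "(\<integral>\<^sup>+r. ennreal (norm (time_kernel a r v * indicator {l..u} r)) \<partial>lborel) < \<infinity>" .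
  qed simp
  then have "integrable lborel (\<lambda>r. \<bar>B\<bar> * (time_kernel a r v * indicator {l..u} r))"
    by simp
  then show ?thesis
  proof (rule Bochner_Integration.integrable_bound)
    show "AE r in lborel. norm (indicator {b..c} r * (g r * time_kernel a r v))
        \<le> norm (\<bar>B\<bar> * (time_kernel a r v * indicator {l..u} r))"
    proof (rule AE_I2)
      fix r
      show "norm (indicator {b..c} r * (g r * time_kernel a r v))
        \<le> norm (\<bar>B\<bar> * (time_kernel a r v * indicator {l..u} r))"
      proof (cases "r \<in> {b..c}")
        case True
        then have "\<bar>g r\<bar> \<le> \<bar>B\<bar>" using B[of r] by auto
        with True lu(2) show ?thesis
          by (auto simp: abs_mult indicator_def intro!: mult_right_mono)
      qed simp
    qed
  qed measurable
qed

lemma one_minus_cos_le: "1 - cos x \<le> x\<^sup>2 / 2" for x :: real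
proof -
  have "1 - cos x = 2 * (sin (x / 2))\<^sup>2" using cos_double_sin[of "x / 2"] by simp
  also have "(sin (x / 2))\<^sup>2 \<le> (x / 2)\<^sup>2"
    using abs_sin_x_le_abs_x[of "x / 2"] by (rule abs_le_square_iff[THEN iffD1])
  finally show ?thesis by (simp add: power2_eq_square)
qed

definition cos_powr_integral :: "real \<Rightarrow> real \<Rightarrow> real" where
  "cos_powr_integral a X = (LINT u|lborel. indicator {0..X} u * (cos u * u powr (a - 1)))"

text \<open>Integrating \<open>u\<^bsup>a - 1\<^esup> cos u\<close> by parts twice, with \<open>1 - cos u\<close> as the second primitive of
  \<open>cos u\<close>, leaves this integral. Its integrand is nonnegative and integrable on the half line,
  so an upper and a strictly positive lower bound can be read off.\<close>

definition cos_powr_defect :: "real \<Rightarrow> real \<Rightarrow> real" where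
  "cos_powr_defect a X = (LINT u|lborel. indicator {0..X} u * ((1 - cos u) * u powr (a - 3)))"

lemma integrable_powr_Icc:
  fixes g :: "real \<Rightarrow> real" and a X :: real
  assumes "0 < a" and [measurable]: "g \<in> borel_measurable borel"
    and B: "\<And>r. r \<in> {0..X} \<Longrightarrow> \<bar>g r\<bar> \<le> B"
  shows "integrable lborel (\<lambda>r. indicator {0..X} r * (g r * r powr (a - 1)))"
  using integrable_abs_powr_weighted[OF assms, where v=0]
  by (rule Bochner_Integration.integrable_cong[THEN iffD1, rotated -1])
     (auto simp: indicator_def)

lemma integral_powr_from_0:
  fixes a c :: real
  assumes "0 < a" "0 \<le> c"
  shows "(LINT u|lborel. indicator {0..c} u * u powr (a - 1)) = c powr a / a"
proof -
  have "(\<integral>\<^sup>+u. ennreal (indicator {0..c} u * u powr (a - 1)) \<partial>lborel) =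
      (\<integral>\<^sup>+u. ennreal (u powr (a - 1)) * indicator {0..c} u \<partial>lborel)"
    by (intro nn_integral_cong) (simp add: indicator_def)
  also have "\<dots> = ennreal (c powr a / a)" by (rule nn_integral_powr_from_0[OF assms])
  finally show ?thesis
    using assms by (subst integral_eq_nn_integral) auto
qed

lemma defect_integrand_le:
  fixes a x :: real
  assumes "0 < x"
  shows "(1 - cos x) * x powr (a - 3) \<le> x powr (a - 1) / 2"
proof -
  have "(1 - cos x) * x powr (a - 3) \<le> x\<^sup>2 / 2 * x powr (a - 3)"
    by (intro mult_right_mono one_minus_cos_le) auto
  also have "x\<^sup>2 = x powr 2" using assms by simp
  also have "x powr 2 / 2 * x powr (a - 3) = x powr (a - 1) / 2"
    by (simp add: powr_add[symmetric])
  finally show ?thesis .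
qed

lemma integrable_cos_powr_defect:
  fixes a X :: real
  assumes "0 < a"
  shows "integrable lborel (\<lambda>u. indicator {0..X} u * ((1 - cos u) * u powr (a - 3)))"
proof (rule Bochner_Integration.integrable_bound)
  show "integrable lborel (\<lambda>r::real. indicator {0..X} r * (1 / 2 * r powr (a - 1)))"
    by (rule integrable_powr_Icc[OF assms, where B=1]) auto
  show "AE x in lborel. norm (indicator {0..X} x * ((1 - cos x) * x powr (a - 3)))
      \<le> norm (indicator {0..X} x * (1 / 2 * x powr (a - 1)))"
  proof (rule AE_I2)
    fix x :: real
    show "norm (indicator {0..X} x * ((1 - cos x) * x powr (a - 3)))
      \<le> norm (indicator {0..X} x * (1 / 2 * x powr (a - 1)))"
      using defect_integrand_le[of x a] by (cases "x = 0") (auto simp: indicator_def abs_mult)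
  qed
qed measurable

text \<open>The boundary terms of the two integrations by parts are a primitive of the difference of the
  integrands for \<open>X > 0\<close>; they are \<open>O(X\<^bsup>a\<^esup>)\<close>, so this primitive is continuous at \<open>0\<close>.\<close>

lemma cos_powr_integral_eq:
  assumes a: "0 < a" "a < 1" and X: "0 \<le> X"
  shows "cos_powr_integral a X = X powr (a - 1) * sin X + (1 - a) * X powr (a - 2) * (1 - cos X)
     + (1 - a) * (2 - a) * cos_powr_defect a X"
proof -
  define F where "F x = x powr (a - 1) * sin x + (1 - a) * x powr (a - 2) * (1 - cos x)" for x
  define f where "f x = cos x * x powr (a - 1) - (1 - a) * (2 - a) * ((1 - cos x) * x powr (a - 3))" for x
  have bound: "\<bar>F x\<bar> \<le> 2 * x powr a" if "0 \<le> x" for x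
  proof (cases "x = 0")
    case False
    with that have x: "x > 0" by simp
    have "\<bar>x powr (a - 1) * sin x\<bar> \<le> x powr (a - 1) * x"
      using x abs_sin_x_le_abs_x[of x] by (simp add: abs_mult)
    also have "\<dots> = x powr a" using x by (simp add: powr_diff)
    finally have 1: "\<bar>x powr (a - 1) * sin x\<bar> \<le> x powr a" .
    have "\<bar>(1 - a) * x powr (a - 2) * (1 - cos x)\<bar> = (1 - a) * x powr (a - 2) * (1 - cos x)"
      using a by simp
    also have "\<dots> \<le> 1 * x powr (a - 2) * (x\<^sup>2 / 2)"
      using a by (intro mult_mono one_minus_cos_le) auto
    also have "\<dots> = x powr a / 2" using x by (simp add: powr_diff field_simps)
    finally have 2: "\<bar>(1 - a) * x powr (a - 2) * (1 - cos x)\<bar> \<le> x powr a"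
      using powr_ge_zero[of x a] by linarith
    show ?thesis unfolding F_def using 1 2 by linarith
  qed (simp add: F_def)
  have F0: "F 0 = 0" by (simp add: F_def)
  have cont0: "(F \<longlongrightarrow> F 0) (at 0 within {0..X})"
    unfolding F0
  proof (rule Lim_null_comparison)
    show "\<forall>\<^sub>F x in at 0 within {0..X}. norm (F x) \<le> 2 * x powr a"
      unfolding eventually_at_filter by (rule always_eventually) (use bound in auto)
    have "((\<lambda>x. 2 * x powr a) \<longlongrightarrow> 2 * 0 powr a) (at 0 within {0..X})"
      using a by (intro tendsto_intros) (auto simp: eventually_at_filter)
    then show "((\<lambda>x. 2 * x powr a) \<longlongrightarrow> 0) (at 0 within {0..X})" by simp
  qed
  have deriv: "(F has_real_derivative f x) (at x)" if "0 < x" for x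
  proof -
    have "(F has_real_derivative ((a - 1) * x powr (a - 1 - 1) * sin x + x powr (a - 1) * cos x
       + ((1 - a) * ((a - 2) * x powr (a - 2 - 1)) * (1 - cos x) + (1 - a) * x powr (a - 2) * sin x))) (at x)"
      unfolding F_def using that by (auto intro!: derivative_eq_intros simp: field_simps)
    moreover have "a - 1 - 1 = a - 2" "a - 2 - 1 = a - 3" by auto
    ultimately show ?thesis
      by (simp add: f_def algebra_simps)
  qed
  have cont: "continuous_on {0..X} F"
    unfolding continuous_on_def
  proof
    fix x assume x: "x \<in> {0..X}"
    show "(F \<longlongrightarrow> F x) (at x within {0..X})"
    proof (cases "x = 0")
      case False
      with x have "isCont F x" using deriv[of x] by (intro DERIV_isCont[of F "f x"]) auto
      then show ?thesis unfolding isCont_def by (rule tendsto_within_subset) simp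
    qed (use cont0 in simp)
  qed
  have "(f has_integral (F X - F 0)) {0..X}"
    using X cont deriv by (intro fundamental_theorem_of_calculus_interior)
      (auto simp: has_real_derivative_iff_has_vector_derivative)
  then have hi: "((\<lambda>x. indicator {0..X} x * f x) has_integral F X) UNIV"
    unfolding F0 using has_integral_restrict_UNIV[of "{0..X}" f "F X"]
    by (subst has_integral_cong[where g="\<lambda>x. if x \<in> {0..X} then f x else 0"]) auto
  have int1: "integrable lborel (\<lambda>u. indicator {0..X} u * (cos u * u powr (a - 1)))"
    by (rule integrable_powr_Icc[OF a(1), where B=1]) auto
  have int2: "integrable lborel (\<lambda>u. (1 - a) * (2 - a) * (indicator {0..X} u * ((1 - cos u) * u powr (a - 3))))"
    using integrable_cos_powr_defect[OF a(1)] by simp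
  have eq: "(\<lambda>x. indicator {0..X} x * f x) = (\<lambda>u. indicator {0..X} u * (cos u * u powr (a - 1))
      - (1 - a) * (2 - a) * (indicator {0..X} u * ((1 - cos u) * u powr (a - 3))))"
    by (auto simp: f_def algebra_simps)
  have "integrable lborel (\<lambda>x. indicator {0..X} x * f x)"
    unfolding eq by (rule Bochner_Integration.integrable_diff[OF int1 int2])
  from has_integral_integral_lborel[OF this] hi
  have "F X = (LINT x|lborel. indicator {0..X} x * f x)"
    by (rule has_integral_unique[rotated])
  also have "\<dots> = cos_powr_integral a X - (1 - a) * (2 - a) * cos_powr_defect a X"
    unfolding eq Bochner_Integration.integral_diff[OF int1 int2]
    by (simp add: cos_powr_integral_def cos_powr_defect_def)
  finally show ?thesis by (simp add: F_def)
qed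

lemma cos_powr_defect_bounds:
  assumes a: "0 < a" "a < 1"
  shows "0 \<le> cos_powr_defect a X"
    and "cos_powr_defect a X \<le> 1 / (2 * a) + 2 / (2 - a)"
    and "2 \<le> X \<Longrightarrow> 2 powr (a - 3) * (1 - cos 1) \<le> cos_powr_defect a X"
proof -
  show "0 \<le> cos_powr_defect a X"
    unfolding cos_powr_defect_def by (intro integral_nonneg_AE AE_I2) (auto simp: indicator_def)
  have "ennreal (cos_powr_defect a X) = (\<integral>\<^sup>+u. ennreal (indicator {0..X} u * ((1 - cos u) * u powr (a - 3))) \<partial>lborel)"
    unfolding cos_powr_defect_def
    by (intro nn_integral_eq_integral[symmetric] integrable_cos_powr_defect a AE_I2) (auto simp: indicator_def)
  also have "\<dots> \<le> (\<integral>\<^sup>+u. ennreal (1/2) * (ennreal (u powr (a - 1)) * indicator {0..1} u)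
        + ennreal 2 * (ennreal (u powr (a - 3)) * indicator {1..} u) \<partial>lborel)"
  proof (rule nn_integral_mono)
    fix u :: real
    consider "u \<le> 0" | "0 < u" "u \<le> 1" | "1 < u" by linarith
    then show "ennreal (indicator {0..X} u * ((1 - cos u) * u powr (a - 3)))
        \<le> ennreal (1/2) * (ennreal (u powr (a - 1)) * indicator {0..1} u)
        + ennreal 2 * (ennreal (u powr (a - 3)) * indicator {1..} u)"
    proof cases
      case 1
      then show ?thesis by (cases "u = 0") (auto simp: indicator_def)
    next
      case 2
      have "indicator {0..X} u * ((1 - cos u) * u powr (a - 3)) \<le> 1 / 2 * u powr (a - 1)"
        using defect_integrand_le[of u a] 2 by (auto simp: indicator_def)
      then have "ennreal (indicator {0..X} u * ((1 - cos u) * u powr (a - 3))) \<le> ennreal (1 / 2) * ennreal (u powr (a - 1))"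
        by (subst ennreal_mult[symmetric]) (auto intro!: ennreal_leI)
      also have "\<dots> = ennreal (1/2) * (ennreal (u powr (a - 1)) * indicator {0..1} u)"
        using 2 by simp
      finally show ?thesis by (rule order_trans) simp
    next
      case 3
      have "(1 - cos u) * u powr (a - 3) \<le> 2 * u powr (a - 3)"
        using cos_ge_minus_one[of u] by (intro mult_right_mono) auto
      then have "indicator {0..X} u * ((1 - cos u) * u powr (a - 3)) \<le> 2 * u powr (a - 3)"
        by (auto simp: indicator_def)
      then have "ennreal (indicator {0..X} u * ((1 - cos u) * u powr (a - 3))) \<le> ennreal 2 * ennreal (u powr (a - 3))"
        by (subst ennreal_mult[symmetric]) (auto intro!: ennreal_leI)
      also have "\<dots> = ennreal 2 * (ennreal (u powr (a - 3)) * indicator {1..} u)"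
        using 3 by simp
      finally show ?thesis by (rule order_trans) simp
    qed
  qed
  also have "\<dots> = ennreal (1/2) * ennreal (1 powr a / a) + ennreal 2 * ennreal (- (1 powr (a - 3 + 1)) / (a - 3 + 1))"
    using a by (subst nn_integral_add, simp, simp, subst nn_integral_cmult, simp, subst nn_integral_cmult, simp,
       subst nn_integral_powr_from_0, simp, simp, subst nn_integral_powr_to_inf) auto
  also have "\<dots> = ennreal (1 / (2 * a) + 2 / (2 - a))"
  proof -
    have "- (1::real) / (a - 2) = 1 / (2 - a)" using a by (simp add: field_simps)
    moreover have "ennreal (1/2) * ennreal (1 / a) + ennreal 2 * ennreal (1 / (2 - a))
       = ennreal (1/2 * (1 / a) + 2 * (1 / (2 - a)))"
      using a by (subst ennreal_mult[symmetric], simp, simp, subst ennreal_mult[symmetric], simp, simp,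
          subst ennreal_plus) auto
    ultimately show ?thesis by simp
  qed
  finally show "cos_powr_defect a X \<le> 1 / (2 * a) + 2 / (2 - a)"
    using a by (subst (asm) ennreal_le_iff) auto
  assume X: "2 \<le> X"
  have "2 powr (a - 3) * (1 - cos 1) = (LINT u|lborel. indicator {1..2::real} u * (2 powr (a - 3) * (1 - cos 1::real)))"
    by simp
  also have "\<dots> \<le> cos_powr_defect a X"
    unfolding cos_powr_defect_def
  proof (intro integral_mono integrable_cos_powr_defect a)
    fix u :: real
    show "indicator {1..2} u * (2 powr (a - 3) * (1 - cos 1)) \<le> indicator {0..X} u * ((1 - cos u) * u powr (a - 3))"
    proof (cases "u \<in> {1..2}")
      case True
      have "cos u \<le> cos 1" using True pi_gt3 by (subst cos_mono_le_eq) auto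
      moreover have "2 powr (a - 3) \<le> u powr (a - 3)" using True a by (intro powr_mono2') auto
      ultimately show ?thesis using True X
        by (auto simp: mult.commute intro!: mult_mono)
    qed (auto simp: indicator_def)
  qed simp
  finally show "2 powr (a - 3) * (1 - cos 1) \<le> cos_powr_defect a X" .
qed

lemma cos_powr_integral_bounded:
  assumes a: "0 < a" "a < 1"
  obtains C where "0 < C" "\<And>X. 0 \<le> X \<Longrightarrow> \<bar>cos_powr_integral a X\<bar> \<le> C"
proof
  show "0 < 8 + 1 / a" using a by (simp add: add_pos_pos)
  fix X :: real assume X: "0 \<le> X"
  show "\<bar>cos_powr_integral a X\<bar> \<le> 8 + 1 / a"
  proof (cases "X \<le> 1")
    case True
    have "\<bar>cos_powr_integral a X\<bar> \<le> (LINT u|lborel. \<bar>indicator {0..X} u * (cos u * u powr (a - 1))\<bar>)"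
      unfolding cos_powr_integral_def by (rule integral_abs_bound)
    also have "\<dots> \<le> (LINT u|lborel. indicator {0..1} u * (1 * u powr (a - 1)))"
    proof (intro integral_mono)
      show "integrable lborel (\<lambda>u. \<bar>indicator {0..X} u * (cos u * u powr (a - 1))\<bar>)"
        by (intro integrable_abs integrable_powr_Icc[OF a(1), where B=1]) auto
      show "integrable lborel (\<lambda>u. indicator {0..1} u * (1 * u powr (a - 1)))"
        by (intro integrable_powr_Icc[OF a(1), where B=1]) auto
      show "\<bar>indicator {0..X} u * (cos u * u powr (a - 1))\<bar> \<le> indicator {0..1} u * (1 * u powr (a - 1))" for u
        using True by (auto simp: indicator_def abs_mult mult_left_le_one_le)
    qed
    also have "\<dots> = 1 / a"
      using integral_powr_from_0[OF a(1), of 1] by simp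
    finally show ?thesis by simp
  next
    case False
    then have X1: "X powr (a - 1) \<le> 1" "X powr (a - 2) \<le> 1"
      using a powr_mono2'[of "a - 1" 1 X] powr_mono2'[of "a - 2" 1 X] by auto
    have "\<bar>X powr (a - 1) * sin X\<bar> \<le> 1"
      unfolding abs_mult using X1(1) abs_sin_le_one[of X] by (intro mult_le_one) auto
    moreover have "\<bar>(1 - a) * X powr (a - 2) * (1 - cos X)\<bar> \<le> 2"
    proof -
      have "(1 - a) * X powr (a - 2) * (1 - cos X) \<le> (1 * 1) * 2"
        using a X1 cos_ge_minus_one[of X] by (intro mult_mono) auto
      moreover have "0 \<le> (1 - a) * X powr (a - 2) * (1 - cos X)" using a by simp
      ultimately show ?thesis by linarith
    qed
    moreover have "\<bar>(1 - a) * (2 - a) * cos_powr_defect a X\<bar> \<le> 1 / a + 4"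
    proof -
      have "(1 - a) * (2 - a) * cos_powr_defect a X \<le> (1 * 2) * (1 / (2 * a) + 2 / (2 - a))"
        using a cos_powr_defect_bounds(1,2)[OF a, of X] by (intro mult_mono) auto
      moreover have "2 / (2 - a) \<le> 2" using a by (simp add: field_simps)
      moreover have "(1 * 2) * (1 / (2 * a) + 2 / (2 - a)) = 1 / a + 2 * (2 / (2 - a))" by simp
      moreover have "0 \<le> (1 - a) * (2 - a) * cos_powr_defect a X"
        using a cos_powr_defect_bounds(1)[OF a, of X] by simp
      ultimately show ?thesis by linarith
    qed
    ultimately show ?thesis unfolding cos_powr_integral_eq[OF a X] by linarith
  qed
qed

text \<open>In \<open>cos_powr_integral_eq\<close> the defect is bounded below for \<open>X \<ge> 2\<close>, the second boundary term
  is nonnegative, and the first one tends to \<open>0\<close>.\<close>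

lemma cos_powr_integral_eventually_ge:
  assumes a: "0 < a" "a < 1"
  obtains c X0 where "0 < c" "0 < X0" "\<And>X. X0 \<le> X \<Longrightarrow> c \<le> cos_powr_integral a X"
proof -
  define c where "c = (1 - a) * (2 - a) * (2 powr (a - 3) * (1 - cos 1)) / 2"
  have "cos (1::real) < cos 0" using pi_gt3 by (subst cos_mono_less_eq) auto
  then have c: "c > 0" using a by (simp add: c_def)
  define X0 where "X0 = max 2 (c powr (1 / (a - 1)))"
  show ?thesis
  proof
    show "0 < c" by fact
    show "0 < X0" by (auto simp: X0_def)
    fix X assume X: "X0 \<le> X"
    then have X2: "2 \<le> X" "c powr (1 / (a - 1)) \<le> X" by (auto simp: X0_def)
    have "X powr (a - 1) \<le> (c powr (1 / (a - 1))) powr (a - 1)"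
      using X2 a c by (intro powr_mono2') auto
    also have "\<dots> = c" using a c by (simp add: powr_powr)
    finally have 1: "X powr (a - 1) \<le> c" .
    have "- (X powr (a - 1)) \<le> X powr (a - 1) * sin X"
      using mult_left_mono[of "-1" "sin X" "X powr (a - 1)"] by simp
    moreover have "0 \<le> (1 - a) * X powr (a - 2) * (1 - cos X)" using a by simp
    moreover have "2 * c \<le> (1 - a) * (2 - a) * cos_powr_defect a X"
      unfolding c_def using cos_powr_defect_bounds(3)[OF a X2(1)] a by (simp add: mult_left_mono)
    ultimately show "c \<le> cos_powr_integral a X"
      using 1 X2 a cos_powr_integral_eq[OF a, of X] by linarith
  qed
qed

text \<open>Substituting \<open>u = k (r - v)\<close> on either side of \<open>v\<close> produces the factor \<open>k\<^bsup>-a\<^esup>\<close>.\<close>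

lemma inner_cos_integral:
  assumes a: "0 < a" and k: "0 < k" and v: "v \<in> {b..c}"
  shows "(LINT r|lborel. indicator {b..c} r * (cos (k * (r - v)) * time_kernel a r v)) =
     k powr (- a) * (cos_powr_integral a (k * (c - v)) + cos_powr_integral a (k * (v - b)))"
proof -
  define p q where "p = k * (v - b)" and "q = k * (c - v)"
  have pq: "p \<ge> 0" "q \<ge> 0" using v k by (auto simp: p_def q_def)
  have int: "integrable lborel (\<lambda>u. indicator {0..X} u * (cos u * u powr (a - 1)))" for X
    by (rule integrable_powr_Icc[OF a, where B=1]) auto
  have "(LINT r|lborel. indicator {b..c} r * (cos (k * (r - v)) * time_kernel a r v)) =
     \<bar>1 / k\<bar> *\<^sub>R (LINT x|lborel. indicator {b..c} (v + 1 / k * x) *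
        (cos (k * (v + 1 / k * x - v)) * \<bar>v + 1 / k * x - v\<bar> powr (a - 1)))"
    using k by (intro lborel_integral_real_affine) auto
  also have "\<dots> = 1 / k * (LINT x|lborel. k powr (1 - a) *
     (indicator {0..q} x * (cos x * x powr (a - 1)) + indicator {0..p} (- x) * (cos (- x) * (- x) powr (a - 1))))"
  proof -
    have "indicator {b..c} (v + 1 / k * x) * (cos (k * (v + 1 / k * x - v)) * \<bar>v + 1 / k * x - v\<bar> powr (a - 1))
       = k powr (1 - a) * (indicator {0..q} x * (cos x * x powr (a - 1)) + indicator {0..p} (- x) * (cos (- x) * (- x) powr (a - 1)))" for x
    proof -
      have "\<bar>v + 1 / k * x - v\<bar> powr (a - 1) = k powr (1 - a) * \<bar>x\<bar> powr (a - 1)"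
      proof -
        have "\<bar>v + 1 / k * x - v\<bar> = \<bar>x\<bar> / k" using k by (simp add: abs_mult)
        moreover have "k powr (1 - a) = 1 / k powr (a - 1)"
          using powr_minus_divide[of k "a - 1"] by simp
        ultimately show ?thesis using k by (simp add: powr_divide)
      qed
      moreover have "indicator {b..c} (v + 1 / k * x) = (indicator {-p..q} x :: real)"
      proof -
        have "b \<le> v + 1 / k * x \<longleftrightarrow> - p \<le> x" "v + 1 / k * x \<le> c \<longleftrightarrow> x \<le> q"
          using k by (auto simp: p_def q_def field_simps)
        then show ?thesis by (simp add: indicator_def)
      qed
      moreover have "k * (v + 1 / k * x - v) = x" using k by simp
      ultimately have "indicator {b..c} (v + 1 / k * x) * (cos (k * (v + 1 / k * x - v)) * \<bar>v + 1 / k * x - v\<bar> powr (a - 1))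
         = k powr (1 - a) * (indicator {-p..q} x * (cos x * \<bar>x\<bar> powr (a - 1)))"
        by simp
      also have "indicator {-p..q} x * (cos x * \<bar>x\<bar> powr (a - 1)) =
         indicator {0..q} x * (cos x * x powr (a - 1)) + indicator {0..p} (- x) * (cos (- x) * (- x) powr (a - 1))"
        using pq by (cases x "0::real" rule: linorder_cases) (auto simp: indicator_def)
      finally show ?thesis .
    qed
    then show ?thesis using k by (simp only:) simp
  qed
  also have "\<dots> = 1 / k * (k powr (1 - a) * (cos_powr_integral a q + cos_powr_integral a p))"
  proof -
    have i2: "integrable lborel (\<lambda>x. indicator {0..p} (- x) * (cos (- x) * (- x) powr (a - 1)))"
      using lborel_integrable_real_affine[OF int[of p], of "-1" 0] by simp
    have "(LINT x|lborel. indicator {0..p} (- x) * (cos (- x) * (- x) powr (a - 1))) = cos_powr_integral a p"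
      unfolding cos_powr_integral_def
      using lborel_integral_real_affine[of "-1" "\<lambda>u. indicator {0..p} u * (cos u * u powr (a - 1))" 0] by simp
    then have "(LINT x|lborel. (indicator {0..q} x * (cos x * x powr (a - 1)) + indicator {0..p} (- x) * (cos (- x) * (- x) powr (a - 1))))
       = cos_powr_integral a q + cos_powr_integral a p"
      using Bochner_Integration.integral_add[OF int[of q] i2] by (simp add: cos_powr_integral_def)
    then show ?thesis by simp
  qed
  also have "1 / k * (k powr (1 - a) * (cos_powr_integral a q + cos_powr_integral a p))
      = k powr (- a) * (cos_powr_integral a q + cos_powr_integral a p)"
  proof -
    have "k powr (1 - a) = k * k powr (- a)"
      using k powr_add[of k 1 "- a"] by simp
    then show ?thesis using k by simp
  qed
  finally show ?thesis by (simp add: p_def q_def)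
qed

section \<open>Energy of trigonometric functions on an interval\<close>

lemma lborel_integral_eq_has_integral:
  fixes f :: "real \<Rightarrow> real"
  assumes int: "integrable lborel (\<lambda>x. indicator {b..c} x * f x)" and hi: "(f has_integral I) {b..c}"
  shows "(LINT x|lborel. indicator {b..c} x * f x) = I"
proof -
  have "((\<lambda>x. indicator {b..c} x * f x) has_integral I) UNIV"
    using hi has_integral_restrict_UNIV[of "{b..c}" f I]
    by (subst has_integral_cong[where g="\<lambda>x. if x \<in> {b..c} then f x else 0"]) auto
  from has_integral_integral_lborel[OF int] this show ?thesis
    by (rule has_integral_unique)
qed

text \<open>With \<open>a = 2 H - 1\<close> this is the covariance \<open>R_fbm H\<close> divided by \<open>alpha_H H\<close>. Both
  integrations are by explicit primitives, which are differentiable off a finite set.\<close>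

lemma covariance_time_integral:
  fixes a s t :: real
  assumes a: "0 < a" "a < 1" and st: "0 \<le> s" "0 \<le> t"
  shows "(LINT v|lborel. LINT r|lborel. indicator {0..s} v * (indicator {0..t} r * time_kernel a r v))
    = (t powr (a + 1) + s powr (a + 1) - \<bar>t - s\<bar> powr (a + 1)) / (a * (a + 1))"
proof -
  define S where "S x = (max x 0 powr a - max (- x) 0 powr a) / a" for x
  define P where "P x = \<bar>x\<bar> powr (a + 1) / (a * (a + 1))" for x
  have contS: "continuous_on A (\<lambda>x. S (f x))" if "continuous_on A f" for A and f :: "real \<Rightarrow> real"
    unfolding S_def using a that by (intro continuous_intros continuous_on_powr') auto
  have contP: "continuous_on A (\<lambda>x. P (f x))" if "continuous_on A f" for A and f :: "real \<Rightarrow> real"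
    unfolding P_def using a that by (intro continuous_intros continuous_on_powr') auto
  have [measurable]: "S \<in> borel_measurable borel"
    by (intro borel_measurable_continuous_onI contS continuous_on_id)
  have dS: "(S has_real_derivative \<bar>x\<bar> powr (a - 1)) (at x)" if "x \<noteq> 0" for x
  proof (cases "x > 0")
    case True
    have "((\<lambda>x. x powr a / a) has_real_derivative \<bar>x\<bar> powr (a - 1)) (at x)"
      using True a by (auto intro!: derivative_eq_intros)
    then show ?thesis
      by (rule has_field_derivative_transform_within_open[of _ _ _ "{0<..}"])
         (use True in \<open>auto simp: S_def max_def\<close>)
  next
    case False
    with that have "x < 0" by simp
    have "((\<lambda>x. - ((- x) powr a / a)) has_real_derivative \<bar>x\<bar> powr (a - 1)) (at x)"
      using \<open>x < 0\<close> a by (auto intro!: derivative_eq_intros)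
    then show ?thesis
      by (rule has_field_derivative_transform_within_open[of _ _ _ "{..<0}"])
         (use \<open>x < 0\<close> in \<open>auto simp: S_def max_def\<close>)
  qed
  have dP: "(P has_real_derivative S x) (at x)" if "x \<noteq> 0" for x
  proof (cases "x > 0")
    case True
    have "((\<lambda>x. x powr (a + 1) / (a * (a + 1))) has_real_derivative S x) (at x)"
      using True a by (auto intro!: derivative_eq_intros simp: S_def max_def divide_simps)
    then show ?thesis
      by (rule has_field_derivative_transform_within_open[of _ _ _ "{0<..}"])
         (use True in \<open>auto simp: P_def\<close>)
  next
    case False
    with that have "x < 0" by simp
    have "((\<lambda>x. (- x) powr (a + 1) / (a * (a + 1))) has_real_derivative S x) (at x)"
      using \<open>x < 0\<close> a by (auto intro!: derivative_eq_intros simp: S_def max_def divide_simps)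
    then show ?thesis
      by (rule has_field_derivative_transform_within_open[of _ _ _ "{..<0}"])
         (use \<open>x < 0\<close> in \<open>auto simp: P_def\<close>)
  qed
  have inner: "(LINT r|lborel. indicator {0..t} r * time_kernel a r v) = S (t - v) + S v" for v
  proof -
    have "((\<lambda>r. time_kernel a r v) has_integral (S (t - v) - S (0 - v))) {0..t}"
    proof (rule fundamental_theorem_of_calculus_strong[of "{v}"])
      show "continuous_on {0..t} (\<lambda>r. S (r - v))" by (intro contS continuous_intros)
      fix r assume "r \<in> {0..t} - {v}"
      then have "((\<lambda>r. S (r - v)) has_real_derivative time_kernel a r v * 1) (at r)"
        by (intro DERIV_chain2[OF dS]) (auto intro!: derivative_eq_intros)
      then show "((\<lambda>r. S (r - v)) has_vector_derivative time_kernel a r v) (at r)"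
        by (simp add: has_real_derivative_iff_has_vector_derivative)
    qed (use st in auto)
    then have "(LINT r|lborel. indicator {0..t} r * time_kernel a r v) = S (t - v) - S (0 - v)"
      using integrable_abs_powr_weighted[of a "\<lambda>_. 1" 0 t 1 v] a
      by (intro lborel_integral_eq_has_integral) auto
    then show ?thesis by (simp add: S_def max_def)
  qed
  have "(LINT v|lborel. LINT r|lborel. indicator {0..s} v * (indicator {0..t} r * time_kernel a r v))
     = (LINT v|lborel. indicator {0..s} v * (S (t - v) + S v))"
    by (simp add: inner)
  also have "\<dots> = (P s - P (t - s)) - (P 0 - P (t - 0))"
  proof (rule lborel_integral_eq_has_integral)
    have "continuous_on {0..s} (\<lambda>v. S (t - v) + S v)"
      by (intro continuous_intros contS)
    from borel_integrable_compact[OF _ this] 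
    show "integrable lborel (\<lambda>v. indicator {0..s} v * (S (t - v) + S v))"
      by (simp add: indicator_def if_distrib cong: if_cong)
    show "((\<lambda>v. S (t - v) + S v) has_integral (P s - P (t - s)) - (P 0 - P (t - 0))) {0..s}"
    proof (rule fundamental_theorem_of_calculus_strong[of "{0, t}"])
      show "continuous_on {0..s} (\<lambda>v. P v - P (t - v))" by (intro contP continuous_intros)
      fix v assume "v \<in> {0..s} - {0, t}"
      then have "((\<lambda>v. P v - P (t - v)) has_real_derivative S v - S (t - v) * (-1)) (at v)"
        by (intro DERIV_diff dP DERIV_chain2[OF dP]) (auto intro!: derivative_eq_intros)
      then show "((\<lambda>v. P v - P (t - v)) has_vector_derivative (S (t - v) + S v)) (at v)"
        by (simp add: has_real_derivative_iff_has_vector_derivative add.commute)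
    qed (use st in auto)
  qed
  also have "\<dots> = (t powr (a + 1) + s powr (a + 1) - \<bar>t - s\<bar> powr (a + 1)) / (a * (a + 1))"
    using st by (simp add: P_def add_divide_distrib diff_divide_distrib)
  finally show ?thesis .
qed

lemma integral_abs_powr:
  fixes a c :: real
  assumes "0 < a" "0 \<le> c"
  shows "(LINT u|lborel. indicator {-c..c} u * \<bar>u\<bar> powr (a - 1)) = 2 * c powr a / a"
proof -
  have "(\<integral>\<^sup>+u. ennreal (indicator {-c..c} u * \<bar>u\<bar> powr (a - 1)) \<partial>lborel) =
      (\<integral>\<^sup>+u. ennreal (\<bar>u\<bar> powr (a - 1)) * indicator {-c..c} u \<partial>lborel)"
    by (intro nn_integral_cong) (simp add: indicator_def)
  also have "\<dots> = ennreal (2 * c powr a / a)" by (rule nn_integral_abs_powr[OF assms])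
  finally show ?thesis
    using assms by (subst integral_eq_nn_integral) auto
qed

lemma integrable_indicator_Icc [simp]: "integrable lborel (indicator {b..c::real} :: real \<Rightarrow> real)"
  by (rule integrable_real_indicator) (auto simp: emeasure_lborel_Icc_eq)

lemma tame_of_real:
  fixes f :: "real \<Rightarrow> real"
  assumes [measurable]: "f \<in> borel_measurable borel" and "\<And>r. r \<in> {b..c} \<Longrightarrow> \<bar>f r\<bar> \<le> B"
  shows "tame (\<lambda>r. complex_of_real (indicator {b..c} r * f r))"
proof -
  have "(\<lambda>r. complex_of_real (indicator {b..c} r * f r)) = (\<lambda>r. indicator {b..c} r * complex_of_real (f r))"
    by (auto simp: indicator_def)
  then show ?thesis
    using tame_indicator_mult[of "\<lambda>r. complex_of_real (f r)" b c B] assms by simp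
qed

lemma tame_indicator: "tame (\<lambda>r. complex_of_real (indicator {b..c} r))"
  using tame_of_real[of "\<lambda>_. 1" b c 1] by simp

lemma integrable_pair_kernel:
  fixes g :: "real \<Rightarrow> real \<Rightarrow> real"
  assumes a: "0 < a" and [measurable]: "case_prod g \<in> borel_measurable (borel \<Otimes>\<^sub>M borel)"
    and B: "\<And>v r. v \<in> {b..c} \<Longrightarrow> r \<in> {b..c} \<Longrightarrow> \<bar>g v r\<bar> \<le> B"
  shows "integrable (lborel \<Otimes>\<^sub>M lborel)
     (\<lambda>(v, r). indicator {b..c} v * (indicator {b..c} r * (g v r * time_kernel a r v)))"
proof -
  have "integrable (lborel \<Otimes>\<^sub>M lborel) (\<lambda>x. B * norm (case x of (v, r) \<Rightarrow>
     complex_of_real (indicator {b..c} r) * cnj (complex_of_real (indicator {b..c} v)) * complex_of_real (time_kernel a r v)))"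
    by (intro integrable_mult_right integrable_norm integrable_tame_kernel a tame_indicator)
  then show ?thesis
  proof (rule Bochner_Integration.integrable_bound)
    show "AE x in lborel \<Otimes>\<^sub>M lborel. norm (case x of (v, r) \<Rightarrow> indicator {b..c} v * (indicator {b..c} r * (g v r * time_kernel a r v)))
       \<le> norm (B * norm (case x of (v, r) \<Rightarrow>
     complex_of_real (indicator {b..c} r) * cnj (complex_of_real (indicator {b..c} v)) * complex_of_real (time_kernel a r v)))"
    proof (rule AE_I2, clarify)
      fix v r :: real
      show "norm (indicator {b..c} v * (indicator {b..c} r * (g v r * time_kernel a r v)))
       \<le> norm (B * norm (
     complex_of_real (indicator {b..c} r) * cnj (complex_of_real (indicator {b..c} v)) * complex_of_real (time_kernel a r v)))"
      proof (cases "v \<in> {b..c} \<and> r \<in> {b..c}")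
        case True
        then have "\<bar>g v r\<bar> \<le> \<bar>B\<bar>" using B[of v r] by auto
        with True show ?thesis by (auto simp: norm_mult abs_mult intro!: mult_right_mono)
      qed auto
    qed
  qed measurable
qed

lemma riesz_energy_of_real:
  "riesz_energy a (\<lambda>r. complex_of_real (f r)) =
    (LINT v|lborel. LINT r|lborel. f r * f v * time_kernel a r v)"
proof -
  have "riesz_form a (\<lambda>r. complex_of_real (f r)) (\<lambda>r. complex_of_real (f r)) =
    (LINT v|lborel. LINT r|lborel. complex_of_real (f r * f v * time_kernel a r v))"
    unfolding riesz_form_def by simp
  also have "\<dots> = complex_of_real (LINT v|lborel. LINT r|lborel. f r * f v * time_kernel a r v)"
    unfolding integral_complex_of_real ..
  finally show ?thesis by (simp add: riesz_energy_def)
qed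

lemma riesz_energy_real_eq_pair:
  assumes a: "0 < a" and [measurable]: "f \<in> borel_measurable borel"
    and B: "\<And>r. r \<in> {b..c} \<Longrightarrow> \<bar>f r\<bar> \<le> B"
  shows "riesz_energy a (\<lambda>r. complex_of_real (indicator {b..c} r * f r)) =
    (LINT (v, r)|(lborel \<Otimes>\<^sub>M lborel). indicator {b..c} v * (indicator {b..c} r * (f r * f v * time_kernel a r v)))"
    (is "?l = ?r")
    and "integrable (lborel \<Otimes>\<^sub>M lborel) (\<lambda>(v, r). indicator {b..c} v * (indicator {b..c} r * (f r * f v * time_kernel a r v)))"
    (is ?int)
proof -
  show i: ?int
  proof (rule integrable_pair_kernel[OF a, where B="\<bar>B\<bar> * \<bar>B\<bar>"])
    show "\<bar>f r * f v\<bar> \<le> \<bar>B\<bar> * \<bar>B\<bar>" if "v \<in> {b..c}" "r \<in> {b..c}" for v r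
      unfolding abs_mult using B[OF that(1)] B[OF that(2)] by (intro mult_mono) auto
  qed measurable
  have "?l = (LINT v|lborel. LINT r|lborel. indicator {b..c} v * (indicator {b..c} r * (f r * f v * time_kernel a r v)))"
    unfolding riesz_energy_of_real by (simp only: ac_simps)
  also have "\<dots> = ?r" by (rule lborel_pair.integral_fst[OF i])
  finally show "?l = ?r" .
qed

lemma trig_kernel_integral:
  assumes a: "0 < a" and k: "0 < k"
  shows "(LINT (v, r)|(lborel \<Otimes>\<^sub>M lborel). indicator {b..c} v * (indicator {b..c} r * (cos (k * (r - v)) * time_kernel a r v))) =
    (LINT v|lborel. indicator {b..c} v * (k powr (- a) * (cos_powr_integral a (k * (c - v)) + cos_powr_integral a (k * (v - b)))))"
    (is "?l = integral\<^sup>L lborel ?g")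
  and "integrable lborel (\<lambda>v. indicator {b..c} v * (k powr (- a) * (cos_powr_integral a (k * (c - v)) + cos_powr_integral a (k * (v - b)))))"
  and "integrable (lborel \<Otimes>\<^sub>M lborel) (\<lambda>(v, r). indicator {b..c} v * (indicator {b..c} r * (cos (k * (r - v)) * time_kernel a r v)))"
    (is ?int)
proof -
  show i: ?int by (rule integrable_pair_kernel[OF a, where B=1]) auto
  have eq: "(LINT r|lborel. indicator {b..c} v * (indicator {b..c} r * (cos (k * (r - v)) * time_kernel a r v))) = ?g v" for v
    using inner_cos_integral[OF a k, of v b c] by (cases "v \<in> {b..c}") auto
  show "integrable lborel ?g" using lborel_pair.integrable_fst[OF i] unfolding eq .
  show "?l = integral\<^sup>L lborel ?g" using lborel_pair.integral_fst[OF i] unfolding eq ..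
qed

abbreviation trig_energy :: "real \<Rightarrow> real \<Rightarrow> real \<Rightarrow> real \<Rightarrow> real \<Rightarrow> real" where
  "trig_energy a b c k \<theta> \<equiv> riesz_energy a (\<lambda>r. complex_of_real (indicator {b..c} r * cos (k * r + \<theta>)))"

text \<open>The energies for the phases \<open>\<theta>\<close> and \<open>\<theta> - \<pi>/2\<close> add up to the integral of
  \<open>cos(k (r - v))\<close> against the kernel, and the second one is nonnegative. The sum is controlled by
  the bounded oscillating integral.\<close>

lemma trig_energy_le:
  assumes a: "0 < a" "a < 1" and C: "\<And>X. 0 \<le> X \<Longrightarrow> \<bar>cos_powr_integral a X\<bar> \<le> C"
    and k: "0 < k" and bc: "b \<le> c"
  shows "trig_energy a b c k \<theta> \<le> 2 * C * (c - b) * k powr (- a)"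
proof -
  let ?E = "\<lambda>\<theta>. trig_energy a b c k \<theta>"
  let ?G = "\<lambda>\<theta> v r. indicator {b..c} v * (indicator {b..c} r * (cos (k * r + \<theta>) * cos (k * v + \<theta>) * time_kernel a r v))"
  note E = riesz_energy_real_eq_pair[OF a(1), of "\<lambda>r. cos (k * r + \<theta>)" b c 1 for \<theta>]
  have i: "integrable (lborel \<Otimes>\<^sub>M lborel) (\<lambda>(v, r). ?G \<theta> v r)" for \<theta>
    by (rule E(2)) auto
  have e: "?E \<theta> = (LINT (v, r)|(lborel \<Otimes>\<^sub>M lborel). ?G \<theta> v r)" for \<theta>
    by (rule E(1)) auto
  have "0 \<le> ?E (\<theta> - pi / 2)"
  proof (rule riesz_energy_nonneg[OF a])
    show "tame (\<lambda>r. complex_of_real (indicator {b..c} r * cos (k * r + (\<theta> - pi / 2))))"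
      by (rule tame_of_real[where B=1]) auto
  qed
  then have "?E \<theta> \<le> ?E \<theta> + ?E (\<theta> - pi / 2)" by simp
  also have "\<dots> = (LINT x|(lborel \<Otimes>\<^sub>M lborel). (case x of (v, r) \<Rightarrow> ?G \<theta> v r) + (case x of (v, r) \<Rightarrow> ?G (\<theta> - pi / 2) v r))"
    unfolding e by (rule Bochner_Integration.integral_add[OF i i, symmetric])
  also have "\<dots> = (LINT (v, r)|(lborel \<Otimes>\<^sub>M lborel). indicator {b..c} v * (indicator {b..c} r * (cos (k * (r - v)) * time_kernel a r v)))"
  proof (intro Bochner_Integration.integral_cong refl, clarify)
    fix v r
    have sh: "cos (x + (\<theta> - pi / 2)) = sin (x + \<theta>)" for x
      using cos_sin_eq[of "x + (\<theta> - pi / 2)"] sin_minus[of "pi - (x + \<theta>)"]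
      by (simp add: algebra_simps sin_diff cos_diff sin_add cos_add)
    have "cos (k * (r - v)) = cos (k * r + \<theta>) * cos (k * v + \<theta>) + cos (k * r + (\<theta> - pi / 2)) * cos (k * v + (\<theta> - pi / 2))"
      unfolding sh using cos_diff[of "k * r + \<theta>" "k * v + \<theta>"] by (simp add: algebra_simps)
    then show "?G \<theta> v r + ?G (\<theta> - pi / 2) v r = indicator {b..c} v * (indicator {b..c} r * (cos (k * (r - v)) * time_kernel a r v))"
      by (simp only: distrib_right distrib_left)
  qed
  also have "\<dots> = (LINT v|lborel. indicator {b..c} v * (k powr (- a) * (cos_powr_integral a (k * (c - v)) + cos_powr_integral a (k * (v - b)))))"
    by (rule trig_kernel_integral(1)[OF a(1) k])
  also have "\<dots> \<le> (LINT v|lborel. indicator {b..c} v * (k powr (- a) * (2 * C)))"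
  proof (intro integral_mono trig_kernel_integral(2)[OF a(1) k])
    fix v
    show "indicator {b..c} v * (k powr (- a) * (cos_powr_integral a (k * (c - v)) + cos_powr_integral a (k * (v - b))))
       \<le> indicator {b..c} v * (k powr (- a) * (2 * C))"
    proof (cases "v \<in> {b..c}")
      case True
      then have "\<bar>cos_powr_integral a (k * (c - v))\<bar> \<le> C" "\<bar>cos_powr_integral a (k * (v - b))\<bar> \<le> C"
        using k by (auto intro!: C)
      then show ?thesis using True by (intro mult_left_mono) auto
    qed simp
  qed simp
  also have "\<dots> = 2 * C * (c - b) * k powr (- a)"
    using bc by simp
  finally show ?thesis .
qed

lemma cos_interval_integral_le:
  fixes m p q \<delta> :: real
  assumes "0 < m"
  shows "\<bar>LINT v|lborel. indicator {p..q} v * cos (m * v + \<delta>)\<bar> \<le> 2 / m"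
proof (cases "p \<le> q")
  case True
  have "(LINT v|lborel. cos (m * v + \<delta>) * indicator {p..q} v) = sin (m * q + \<delta>) / m - sin (m * p + \<delta>) / m"
    using assms by (intro integral_FTC_Icc_real True) (auto intro!: derivative_eq_intros)
  also have "\<bar>\<dots>\<bar> \<le> (1 + 1) / m"
  proof -
    have "\<bar>sin (m * q + \<delta>) - sin (m * p + \<delta>)\<bar> \<le> 1 + 1"
      using abs_sin_le_one[of "m * q + \<delta>"] abs_sin_le_one[of "m * p + \<delta>"] by linarith
    then show ?thesis
      using assms unfolding diff_divide_distrib[symmetric] abs_divide by (simp add: divide_right_mono)
  qed
  finally show ?thesis by (simp add: mult.commute)
qed (use assms in simp)

text \<open>In the variables \<open>v\<close> and \<open>w = r - v\<close> the kernel depends on \<open>w\<close> only, while the cosine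
  oscillates in \<open>v\<close> with frequency \<open>2 k\<close>, so that its integral over any interval is at most
  \<open>1/k\<close>.\<close>

lemma trig_cross_term_le:
  fixes a b c k \<delta> :: real
  assumes a: "0 < a" and k: "0 < k" and bc: "b \<le> c"
  shows "\<bar>LINT (v, r)|(lborel \<Otimes>\<^sub>M lborel). indicator {b..c} v * (indicator {b..c} r * (cos (k * (r + v) + \<delta>) * time_kernel a r v))\<bar>
     \<le> 2 * (c - b) powr a / (a * k)"
proof -
  define L where "L = c - b"
  have L: "L \<ge> 0" using bc by (simp add: L_def)
  define h where "h v w = indicator {b..c} v * (indicator {b..c} (v + w) * (cos (k * (2 * v + w) + \<delta>) * \<bar>w\<bar> powr (a - 1)))" for v w
  have [measurable]: "case_prod h \<in> borel_measurable (borel \<Otimes>\<^sub>M borel)" unfolding h_def by measurable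
  have i: "integrable (lborel \<Otimes>\<^sub>M lborel)
     (\<lambda>(v, r). indicator {b..c} v * (indicator {b..c} r * (cos (k * (r + v) + \<delta>) * time_kernel a r v)))"
    by (rule integrable_pair_kernel[OF a, where B=1]) auto
  have iL: "integrable lborel (\<lambda>w. indicator {-L..L} w * \<bar>w\<bar> powr (a - 1))"
    using integrable_abs_powr_weighted[of a "\<lambda>_. 1" "-L" L 1 0] a by simp
  have ih: "integrable (lborel \<Otimes>\<^sub>M lborel) (case_prod h)"
  proof (rule lborel_pair.Fubini_integrable)
    have hb: "\<bar>h v w\<bar> \<le> indicator {b..c} v * (indicator {-L..L} w * \<bar>w\<bar> powr (a - 1))" for v w
      unfolding h_def abs_mult by (auto simp: indicator_def L_def intro!: mult_left_le_one_le)
    have ihv: "integrable lborel (\<lambda>w. h v w)" for v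
      by (rule Bochner_Integration.integrable_bound[OF integrable_mult_right[OF iL, of "indicator {b..c} v"]])
         (use hb in auto)
    then show "AE v in lborel. integrable lborel (\<lambda>w. case_prod h (v, w))" by simp
    show "integrable lborel (\<lambda>v. LINT w|lborel. norm (case_prod h (v, w)))"
    proof (rule Bochner_Integration.integrable_bound)
      show "integrable lborel (\<lambda>v. indicator {b..c} v * (2 * L powr a / a))" by simp
      show "AE v in lborel. norm (LINT w|lborel. norm (case_prod h (v, w))) \<le> norm (indicator {b..c} v * (2 * L powr a / a))"
      proof (rule AE_I2)
        fix v
        have "(LINT w|lborel. norm (h v w)) \<le> (LINT w|lborel. indicator {b..c} v * (indicator {-L..L} w * \<bar>w\<bar> powr (a - 1)))"
          using hb ihv by (intro integral_mono integrable_norm integrable_mult_right iL) auto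
        also have "\<dots> = indicator {b..c} v * (2 * L powr a / a)"
          using integral_abs_powr[OF a L] by simp
        finally show "norm (LINT w|lborel. norm (case_prod h (v, w))) \<le> norm (indicator {b..c} v * (2 * L powr a / a))"
          using a by (simp add: abs_of_nonneg)
      qed
    qed measurable
  qed simp
  have "(LINT (v, r)|(lborel \<Otimes>\<^sub>M lborel). indicator {b..c} v * (indicator {b..c} r * (cos (k * (r + v) + \<delta>) * time_kernel a r v)))
     = (LINT v|lborel. LINT r|lborel. indicator {b..c} v * (indicator {b..c} r * (cos (k * (r + v) + \<delta>) * time_kernel a r v)))"
    by (rule lborel_pair.integral_fst[OF i, symmetric])
  also have "\<dots> = (LINT v|lborel. LINT w|lborel. h v w)"
  proof (rule Bochner_Integration.integral_cong[OF refl])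
    fix v
    show "(LINT r|lborel. indicator {b..c} v * (indicator {b..c} r * (cos (k * (r + v) + \<delta>) * time_kernel a r v))) = (LINT w|lborel. h v w)"
      using lborel_integral_real_affine[of 1 "\<lambda>r. indicator {b..c} v * (indicator {b..c} r * (cos (k * (r + v) + \<delta>) * time_kernel a r v))" v]
      by (simp add: h_def algebra_simps)
  qed
  also have "\<dots> = (LINT w|lborel. LINT v|lborel. h v w)"
    by (rule lborel_pair.Fubini_integral[OF ih, symmetric])
  also have "norm (LINT w|lborel. LINT v|lborel. h v w) \<le> (LINT w|lborel. 1 / k * (indicator {-L..L} w * \<bar>w\<bar> powr (a - 1)))"
  proof (rule order_trans[OF integral_norm_bound integral_mono])
    show "integrable lborel (\<lambda>w. norm (LINT v|lborel. h v w))"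
      by (intro integrable_norm lborel_pair.integrable_snd[OF ih])
    show "integrable lborel (\<lambda>w. 1 / k * (indicator {-L..L} w * \<bar>w\<bar> powr (a - 1)))"
      using iL by (rule integrable_mult_right)
    fix w :: real
    have "h v w = (indicator {-L..L} w * \<bar>w\<bar> powr (a - 1)) * (indicator {max b (b - w)..min c (c - w)} v * cos ((2 * k) * v + (k * w + \<delta>)))" for v
      by (auto simp: h_def indicator_def L_def algebra_simps)
    then have "(LINT v|lborel. h v w) = (indicator {-L..L} w * \<bar>w\<bar> powr (a - 1)) *
        (LINT v|lborel. indicator {max b (b - w)..min c (c - w)} v * cos ((2 * k) * v + (k * w + \<delta>)))"
      by simp
    also have "norm \<dots> \<le> (indicator {-L..L} w * \<bar>w\<bar> powr (a - 1)) * (2 / (2 * k))"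
      unfolding norm_mult using cos_interval_integral_le[of "2 * k"] k
      by (intro mult_mono) auto
    finally show "norm (LINT v|lborel. h v w) \<le> 1 / k * (indicator {-L..L} w * \<bar>w\<bar> powr (a - 1))"
      by simp
  qed
  also have "\<dots> = 1 / k * (2 * L powr a / a)"
    using integral_abs_powr[OF a L] by simp
  also have "\<dots> = 2 * (c - b) powr a / (a * k)" by (simp add: L_def)
  finally show ?thesis by simp
qed

text \<open>By \<open>2 cos p cos q = cos(p - q) + cos(p + q)\<close> the energy is half of the integral of
  \<open>cos(k (r - v))\<close> against the kernel plus a cross term of order \<open>1/k\<close>. The former is an integral
  over \<open>v\<close> of two values of \<open>cos_powr_integral a\<close>, each of which is at least \<open>c\<close> except for \<open>v\<close>
  within distance \<open>X0/k\<close> of an end point, where it is at least \<open>-C\<close>.\<close>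

lemma trig_energy_ge:
  assumes a: "0 < a" "a < 1" and C: "\<And>X. 0 \<le> X \<Longrightarrow> \<bar>cos_powr_integral a X\<bar> \<le> C"
    and c: "0 < c" "0 < X0" "\<And>X. X0 \<le> X \<Longrightarrow> c \<le> cos_powr_integral a X"
    and k: "0 < k" and s: "0 \<le> s"
  shows "k powr (- a) * (c * s - (c + C) * X0 / k) - s powr a / (a * k)
    \<le> trig_energy a 0 s k \<theta>"
proof -
  let ?K = "\<lambda>v r. time_kernel a r v"
  let ?G = "\<lambda>v r. indicator {0..s} v * (indicator {0..s} r * (cos (k * r + \<theta>) * cos (k * v + \<theta>) * ?K v r))"
  let ?D = "\<lambda>v r. indicator {0..s} v * (indicator {0..s} r * (cos (k * (r - v)) * ?K v r))"
  let ?X = "\<lambda>v r. indicator {0..s} v * (indicator {0..s} r * (cos (k * (r + v) + 2 * \<theta>) * ?K v r))"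
  have iD: "integrable (lborel \<Otimes>\<^sub>M lborel) (\<lambda>(v, r). ?D v r)"
    by (rule trig_kernel_integral(3)[OF a(1) k])
  have iX: "integrable (lborel \<Otimes>\<^sub>M lborel) (\<lambda>(v, r). ?X v r)"
    by (rule integrable_pair_kernel[OF a(1), where B=1]) auto
  have C0: "C \<ge> 0" using C[of 0] by simp
  have "2 * trig_energy a 0 s k \<theta> =
    2 * (LINT (v, r)|(lborel \<Otimes>\<^sub>M lborel). ?G v r)"
    by (subst riesz_energy_real_eq_pair(1)[OF a(1), of _ 0 s 1]) auto
  also have "\<dots> = (LINT x|(lborel \<Otimes>\<^sub>M lborel). 2 * (case x of (v, r) \<Rightarrow> ?G v r))"
    by simp
  also have "\<dots> = (LINT x|(lborel \<Otimes>\<^sub>M lborel). (case x of (v, r) \<Rightarrow> ?D v r) + (case x of (v, r) \<Rightarrow> ?X v r))"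
  proof (intro Bochner_Integration.integral_cong refl, clarify)
    fix v r
    have "2 * (cos (k * r + \<theta>) * cos (k * v + \<theta>)) = cos (k * (r - v)) + cos (k * (r + v) + 2 * \<theta>)"
      using cos_times_cos[of "k * r + \<theta>" "k * v + \<theta>"] by (simp add: algebra_simps)
    then have "2 * (cos (k * r + \<theta>) * cos (k * v + \<theta>) * ?K v r) = cos (k * (r - v)) * ?K v r + cos (k * (r + v) + 2 * \<theta>) * ?K v r"
      by (simp only: distrib_right[symmetric] mult.assoc[symmetric])
    then show "2 * ?G v r = ?D v r + ?X v r"
      by (simp only: distrib_left[symmetric] mult.left_commute[of 2])
  qed
  also have "\<dots> = (LINT (v, r)|(lborel \<Otimes>\<^sub>M lborel). ?D v r) + (LINT (v, r)|(lborel \<Otimes>\<^sub>M lborel). ?X v r)"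
    by (rule Bochner_Integration.integral_add[OF iD iX])
  finally have eq: "2 * trig_energy a 0 s k \<theta> = \<dots>" .
  have X: "- (2 * s powr a / (a * k)) \<le> (LINT (v, r)|(lborel \<Otimes>\<^sub>M lborel). ?X v r)"
    using trig_cross_term_le[OF a(1) k s, of "2 * \<theta>"] by simp
  define Y where "Y = X0 / k"
  have Y: "Y \<ge> 0" using c k by (simp add: Y_def)
  let ?m = "\<lambda>v. k powr (- a) * (2 * c * indicator {0..s} v - (c + C) * (indicator {s-Y..s} v + indicator {0..Y} v))"
  have "k powr (- a) * (2 * c * s - (c + C) * (Y + Y)) = (LINT v|lborel. ?m v)"
    using s Y by simp
  also have "\<dots> \<le> (LINT v|lborel. indicator {0..s} v * (k powr (- a) * (cos_powr_integral a (k * (s - v)) + cos_powr_integral a (k * (v - 0)))))"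
  proof (intro integral_mono trig_kernel_integral(2)[OF a(1) k])
    show "integrable lborel ?m" by simp
    fix v
    show "?m v \<le> indicator {0..s} v * (k powr (- a) * (cos_powr_integral a (k * (s - v)) + cos_powr_integral a (k * (v - 0))))"
    proof (cases "v \<in> {0..s}")
      case True
      have low: "c - (c + C) * (if z \<le> Y then 1 else 0) \<le> cos_powr_integral a (k * z)" if "0 \<le> z" for z
      proof (cases "z \<le> Y")
        case True
        then show ?thesis using C[of "k * z"] that k by auto
      next
        case False
        then have "X0 \<le> k * z" using k by (simp add: Y_def field_simps)
        then show ?thesis using False c(3) by simp
      qed
      have "c - (c + C) * indicator {s-Y..s} v \<le> cos_powr_integral a (k * (s - v))"
        using low[of "s - v"] True by (auto simp: indicator_def split: if_splits)
      moreover have "c - (c + C) * indicator {0..Y} v \<le> cos_powr_integral a (k * v)"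
        using low[of v] True by (auto simp: indicator_def)
      ultimately have "2 * c * 1 - (c + C) * (indicator {s-Y..s} v + indicator {0..Y} v) \<le>
         cos_powr_integral a (k * (s - v)) + cos_powr_integral a (k * (v - 0))"
        by (simp add: distrib_left)
      then show ?thesis using True by (auto intro!: mult_left_mono)
    next
      case False
      then show ?thesis using c(1) C0 by (auto simp: mult_le_0_iff indicator_def)
    qed
  qed
  also have "\<dots> = (LINT (v, r)|(lborel \<Otimes>\<^sub>M lborel). ?D v r)"
    by (rule trig_kernel_integral(1)[OF a(1) k, symmetric])
  finally have "k powr (- a) * (2 * c * s - (c + C) * (Y + Y)) \<le> (LINT (v, r)|(lborel \<Otimes>\<^sub>M lborel). ?D v r)" .
  moreover have "k powr (- a) * (2 * c * s - (c + C) * (Y + Y)) = 2 * (k powr (- a) * (c * s - (c + C) * X0 / k))"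
    by (simp add: Y_def algebra_simps)
  ultimately show ?thesis using eq X by linarith
qed

lemma energy_le_sup:
  assumes a: "0 < a" and [measurable]: "f \<in> borel_measurable borel"
    and B: "\<And>r. r \<in> {b..c} \<Longrightarrow> \<bar>f r\<bar> \<le> B" and bc: "b \<le> c"
  shows "riesz_energy a (\<lambda>r. complex_of_real (indicator {b..c} r * f r)) \<le> B\<^sup>2 * (c - b) * (2 * (c - b) powr a / a)"
proof -
  have B0: "B \<ge> 0" using B[of b] bc by auto
  have i: "integrable (lborel \<Otimes>\<^sub>M lborel)
     (\<lambda>(v, r). indicator {b..c} v * (indicator {b..c} r * (B\<^sup>2 * time_kernel a r v)))"
    by (rule integrable_pair_kernel[OF a, where B="B\<^sup>2"]) auto
  have "riesz_energy a (\<lambda>r. complex_of_real (indicator {b..c} r * f r)) =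
    (LINT (v, r)|(lborel \<Otimes>\<^sub>M lborel). indicator {b..c} v * (indicator {b..c} r * (f r * f v * time_kernel a r v)))"
    by (rule riesz_energy_real_eq_pair(1)[OF a _ B]) auto
  also have "\<dots> \<le> (LINT (v, r)|(lborel \<Otimes>\<^sub>M lborel). indicator {b..c} v * (indicator {b..c} r * (B\<^sup>2 * time_kernel a r v)))"
  proof (intro integral_mono i)
    show "integrable (lborel \<Otimes>\<^sub>M lborel) (\<lambda>(v, r). indicator {b..c} v * (indicator {b..c} r * (f r * f v * time_kernel a r v)))"
      by (rule riesz_energy_real_eq_pair(2)[OF a _ B]) auto
    fix x :: "real \<times> real"
    obtain v r where x: "x = (v, r)" by (cases x)
    show "(case x of (v, r) \<Rightarrow> indicator {b..c} v * (indicator {b..c} r * (f r * f v * time_kernel a r v))) \<le>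
      (case x of (v, r) \<Rightarrow> indicator {b..c} v * (indicator {b..c} r * (B\<^sup>2 * time_kernel a r v)))"
    proof (cases "v \<in> {b..c} \<and> r \<in> {b..c}")
      case True
      have "f r * f v \<le> \<bar>f r\<bar> * \<bar>f v\<bar>" by (simp add: abs_mult[symmetric])
      also have "\<dots> \<le> B * B" using True B B0 by (intro mult_mono) auto
      finally have "f r * f v \<le> B\<^sup>2" by (simp add: power2_eq_square)
      with True show ?thesis by (auto simp: x intro!: mult_right_mono)
    qed (auto simp: x)
  qed
  also have "\<dots> = (LINT v|lborel. LINT r|lborel. indicator {b..c} v * (indicator {b..c} r * (B\<^sup>2 * time_kernel a r v)))"
    by (rule lborel_pair.integral_fst[OF i, symmetric])
  also have "\<dots> \<le> (LINT v|lborel. indicator {b..c} v * (B\<^sup>2 * (2 * (c - b) powr a / a)))"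
  proof (intro integral_mono lborel_pair.integrable_fst[OF i])
    fix v
    show "(LINT r|lborel. indicator {b..c} v * (indicator {b..c} r * (B\<^sup>2 * time_kernel a r v)))
       \<le> indicator {b..c} v * (B\<^sup>2 * (2 * (c - b) powr a / a))"
    proof (cases "v \<in> {b..c}")
      case True
      have "(\<integral>\<^sup>+r. ennreal (indicator {b..c} r * time_kernel a r v) \<partial>lborel) =
        (\<integral>\<^sup>+r. ennreal (time_kernel a r v) * indicator {b..c} r \<partial>lborel)"
        by (intro nn_integral_cong) (simp add: indicator_def)
      also have "\<dots> \<le> ennreal (2 * (c - b) powr a / a)"
        by (rule nn_integral_abs_powr_shift[OF a True])
      finally have "(LINT r|lborel. indicator {b..c} r * time_kernel a r v) \<le> 2 * (c - b) powr a / a"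
        using a by (subst integral_eq_nn_integral) (auto simp: enn2real_leI)
      then have "B\<^sup>2 * (LINT r|lborel. indicator {b..c} r * time_kernel a r v) \<le> B\<^sup>2 * (2 * (c - b) powr a / a)"
        by (intro mult_left_mono) auto
      moreover have "(LINT r|lborel. indicator {b..c} r * (B\<^sup>2 * time_kernel a r v)) = B\<^sup>2 * (LINT r|lborel. indicator {b..c} r * time_kernel a r v)"
        by (simp add: mult.left_commute[of "indicator _ _"])
      ultimately show ?thesis using True by simp
    qed simp
  qed simp
  also have "\<dots> = B\<^sup>2 * (c - b) * (2 * (c - b) powr a / a)"
    using bc by simp
  finally show ?thesis .
qed

section \<open>Energy of the difference of two wave kernels\<close>

lemma riesz_energy_real_cong_AE:
  fixes f g :: "real \<Rightarrow> real"
  assumes [measurable]: "f \<in> borel_measurable borel" "g \<in> borel_measurable borel"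
    and AE: "AE r in lborel. f r = g r"
  shows "riesz_energy a (\<lambda>r. complex_of_real (f r)) = riesz_energy a (\<lambda>r. complex_of_real (g r))"
  unfolding riesz_energy_of_real
proof (rule integral_cong_AE)
  show "AE v in lborel. (LINT r|lborel. f r * f v * time_kernel a r v) = (LINT r|lborel. g r * g v * time_kernel a r v)"
    using AE
  proof eventually_elim
    case (elim v)
    show ?case
      by (rule integral_cong_AE) (use AE elim in auto)
  qed
qed measurable

text \<open>At spatial frequency \<open>k\<close>, the difference of the wave kernels for the times \<open>t\<close> and \<open>s\<close>, up to
  the phase and the factor \<open>1/k\<close>.\<close>

definition wave_diff :: "real \<Rightarrow> real \<Rightarrow> real \<Rightarrow> real \<Rightarrow> real" where
  "wave_diff s t k r = indicator {0..t} r * sin ((t - r) * k) - indicator {0..s} r * sin ((s - r) * k)"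

abbreviation wave_energy :: "real \<Rightarrow> real \<Rightarrow> real \<Rightarrow> real \<Rightarrow> real" where
  "wave_energy a s t k \<equiv> riesz_energy a (\<lambda>r. complex_of_real (wave_diff s t k r))"

lemma wave_diff_measurable [measurable]: "wave_diff s t k \<in> borel_measurable borel"
  unfolding wave_diff_def by measurable

lemma tame_wave_diff: "tame (\<lambda>r. complex_of_real (wave_diff s t k r))"
proof -
  have "tame (\<lambda>r. complex_of_real (indicator {0..u} r * sin ((u - r) * k)))" for u
    by (rule tame_of_real[where B=1]) auto
  from tame_diff[OF this this] show ?thesis
    by (simp add: wave_diff_def)
qed

text \<open>For almost every \<open>r\<close> the difference splits into a cosine on \<open>[0,s]\<close> with amplitude
  \<open>2 sin(k (t - s) / 2)\<close> and a cosine on \<open>[s,t]\<close> with amplitude \<open>1\<close>. The two inequalities bound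
  the energy of the whole by the parts and the energy of the first part by the rest.\<close>

lemma wave_diff_energy_decomposition:
  fixes a s t k :: real
  assumes a: "0 < a" "a < 1" and st: "0 \<le> s" "s < t"
  defines "E1 \<equiv> trig_energy a 0 s k (- ((t + s) * k / 2))"
    and "E2 \<equiv> trig_energy a s t k (pi / 2 - t * k)"
    and "E \<equiv> wave_energy a s t k"
  shows "E \<le> 8 * (sin (k * (t - s) / 2))\<^sup>2 * E1 + 2 * E2"
    and "2 * (sin (k * (t - s) / 2))\<^sup>2 * E1 \<le> E + E2"
proof -
  define \<sigma> where "\<sigma> = 2 * sin (k * (t - s) / 2)"
  define p1 where "p1 r = indicator {0..s} r * cos (k * r + (- ((t + s) * k / 2)))" for r
  define p2 where "p2 r = indicator {s..t} r * cos (k * r + (pi / 2 - t * k))" for r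
  have [measurable]: "p1 \<in> borel_measurable borel" "p2 \<in> borel_measurable borel"
    unfolding p1_def p2_def by measurable
  have t1: "tame (\<lambda>r. complex_of_real (p1 r))" unfolding p1_def by (rule tame_of_real[where B=1]) auto
  have t2: "tame (\<lambda>r. complex_of_real (p2 r))" unfolding p2_def by (rule tame_of_real[where B=1]) auto
  have E1: "E1 = riesz_energy a (\<lambda>r. complex_of_real (p1 r))" and E2: "E2 = riesz_energy a (\<lambda>r. complex_of_real (p2 r))"
    by (simp_all only: E1_def E2_def p1_def p2_def)
  have "wave_diff s t k r = \<sigma> * p1 r + p2 r" if rs: "r \<noteq> s" for r
  proof -
    have 1: "sin ((t - r) * k) - sin ((s - r) * k) = \<sigma> * cos (k * r + (- ((t + s) * k / 2)))"
    proof -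
      have "((t - r) * k + (s - r) * k) / 2 = - (k * r + (- ((t + s) * k / 2)))"
        "((t - r) * k - (s - r) * k) / 2 = k * (t - s) / 2"
        by (simp_all add: field_simps)
      then show ?thesis
        using sin_diff_sin[of "(t - r) * k" "(s - r) * k"] unfolding \<sigma>_def by (simp only: cos_minus)
    qed
    have 2: "sin ((t - r) * k) = cos (k * r + (pi / 2 - t * k))"
      using sin_cos_eq[of "(t - r) * k"] by (simp add: algebra_simps)
    consider "r < 0" | "0 \<le> r" "r < s" | "s < r" "r \<le> t" | "t < r"
      using rs by linarith
    then show ?thesis
      using st 1 2 by cases (auto simp: wave_diff_def p1_def p2_def)
  qed
  then have AE: "AE r in lborel. wave_diff s t k r = \<sigma> * p1 r + p2 r"
    using AE_lborel_singleton[of s] by (auto elim: eventually_mono)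
  have "E = riesz_energy a (\<lambda>r. complex_of_real (\<sigma> * p1 r + p2 r))"
    unfolding E_def by (rule riesz_energy_real_cong_AE[OF _ _ AE]) measurable
  also have "\<dots> \<le> 2 * riesz_energy a (\<lambda>r. complex_of_real \<sigma> * complex_of_real (p1 r)) + 2 * E2"
    unfolding E2 using riesz_energy_add_le[OF a tame_cmult[OF t1] t2] by simp
  finally show "E \<le> 8 * (sin (k * (t - s) / 2))\<^sup>2 * E1 + 2 * E2"
    unfolding riesz_energy_cmult E1 by (simp add: \<sigma>_def power_mult_distrib)
  have AE': "AE r in lborel. \<sigma> * p1 r = wave_diff s t k r + (-1) * p2 r"
    using AE by eventually_elim simp
  have "\<sigma>\<^sup>2 * E1 = riesz_energy a (\<lambda>r. complex_of_real (\<sigma> * p1 r))"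
    unfolding E1 using riesz_energy_cmult[of a "complex_of_real \<sigma>" "\<lambda>r. complex_of_real (p1 r)"] by simp
  also have "\<dots> = riesz_energy a (\<lambda>r. complex_of_real (wave_diff s t k r + (-1) * p2 r))"
    by (rule riesz_energy_real_cong_AE[OF _ _ AE']) measurable
  also have "\<dots> = riesz_energy a (\<lambda>r. complex_of_real (wave_diff s t k r) + (-1) * complex_of_real (p2 r))"
    by simp
  also have "\<dots> \<le> 2 * E + 2 * riesz_energy a (\<lambda>r. (-1) * complex_of_real (p2 r))"
    unfolding E_def by (rule riesz_energy_add_le[OF a tame_wave_diff tame_cmult[OF t2]])
  also have "riesz_energy a (\<lambda>r. (-1) * complex_of_real (p2 r)) = E2"
    unfolding E2 riesz_energy_cmult by simp
  finally show "2 * (sin (k * (t - s) / 2))\<^sup>2 * E1 \<le> E + E2"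
    by (simp add: \<sigma>_def power_mult_distrib)
qed

text \<open>The part on \<open>[0,s]\<close> carries the factor \<open>sin\<^sup>2(h k / 2) \<le> min(1, h\<^sup>2 k\<^sup>2)\<close> with
  \<open>h = t - s\<close>. For the part on \<open>[s,t]\<close> the oscillation is used when \<open>h k \<ge> 1\<close>, and otherwise the
  fact that the sine does not exceed \<open>h k\<close> there.\<close>

lemma wave_diff_energy_le:
  fixes a T :: real
  assumes a: "0 < a" "a < 1" and T: "0 < T"
  obtains C where "0 < C" "\<And>s t k. 0 \<le> s \<Longrightarrow> s < t \<Longrightarrow> t \<le> T \<Longrightarrow> 0 < k \<Longrightarrow>
    wave_energy a s t k \<le> C * (k powr (- a) * min 1 ((k * (t - s))\<^sup>2))"
proof -
  obtain C0 where C0: "0 < C0" "\<And>X. 0 \<le> X \<Longrightarrow> \<bar>cos_powr_integral a X\<bar> \<le> C0"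
    using cos_powr_integral_bounded[OF a] by blast
  define C where "C = 16 * C0 * T + 2 * (2 * C0 * T + 2 * T / a)"
  show ?thesis
  proof
    show "0 < C" unfolding C_def using C0 T a by (intro add_pos_pos mult_pos_pos divide_pos_pos) auto
    fix s t k :: real assume st: "0 \<le> s" "s < t" "t \<le> T" and k: "0 < k"
    define h where "h = t - s"
    have h: "0 < h" "h \<le> T" using st by (auto simp: h_def)
    define m where "m = min 1 ((k * h)\<^sup>2)"
    have m: "0 \<le> m" by (simp add: m_def)
    define E1 where "E1 = trig_energy a 0 s k (- ((t + s) * k / 2))"
    define E2 where "E2 = trig_energy a s t k (pi / 2 - t * k)"
    have "E1 \<le> 2 * C0 * (s - 0) * k powr (- a)"
      unfolding E1_def by (rule trig_energy_le[OF a C0(2) k st(1)])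
    also have "\<dots> \<le> 2 * C0 * T * k powr (- a)"
      using st C0 by (intro mult_right_mono mult_left_mono) auto
    finally have E1: "E1 \<le> 2 * C0 * T * k powr (- a)" .
    have sin2: "(sin (k * h / 2))\<^sup>2 \<le> m"
    proof -
      have "(sin (k * h / 2))\<^sup>2 \<le> 1" by (simp add: abs_square_le_1)
      moreover have "(sin (k * h / 2))\<^sup>2 \<le> (k * h / 2)\<^sup>2"
        using abs_sin_x_le_abs_x[of "k * h / 2"] by (rule abs_le_square_iff[THEN iffD1])
      moreover have "(k * h / 2)\<^sup>2 \<le> (k * h)\<^sup>2" by (simp add: power_divide)
      ultimately show ?thesis by (simp add: m_def)
    qed
    have first: "8 * (sin (k * h / 2))\<^sup>2 * E1 \<le> 16 * C0 * T * (k powr (- a) * m)"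
    proof -
      have "(sin (k * h / 2))\<^sup>2 * E1 \<le> (sin (k * h / 2))\<^sup>2 * (2 * C0 * T * k powr (- a))"
        using E1 by (intro mult_left_mono) auto
      also have "\<dots> \<le> m * (2 * C0 * T * k powr (- a))"
        using sin2 C0 T by (intro mult_right_mono) auto
      finally show ?thesis by (simp add: algebra_simps)
    qed
    have second: "E2 \<le> (2 * C0 * T + 2 * T / a) * (k powr (- a) * m)"
    proof (cases "1 \<le> k * h")
      case True
      then have m1: "m = 1" by (simp add: m_def one_le_power)
      have "E2 \<le> 2 * C0 * (t - s) * k powr (- a)"
        unfolding E2_def using st by (intro trig_energy_le[OF a C0(2) k]) auto
      also have "\<dots> \<le> 2 * C0 * T * k powr (- a)"
        using h C0 by (intro mult_right_mono mult_left_mono) (auto simp: h_def)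
      also have "\<dots> \<le> (2 * C0 * T + 2 * T / a) * k powr (- a)"
        using T a by (intro mult_right_mono) auto
      finally show ?thesis by (simp add: m1)
    next
      case False
      then have "(k * h)\<^sup>2 \<le> 1" using k h by (simp add: power_le_one)
      then have m1: "m = (k * h)\<^sup>2" by (simp add: m_def)
      have "E2 \<le> (k * h)\<^sup>2 * (t - s) * (2 * (t - s) powr a / a)"
        unfolding E2_def
      proof (rule energy_le_sup[OF a(1)])
        fix r assume r: "r \<in> {s..t}"
        have "cos (k * r + (pi / 2 - t * k)) = sin ((t - r) * k)"
          using sin_cos_eq[of "(t - r) * k"] by (simp add: algebra_simps)
        also have "\<bar>\<dots>\<bar> \<le> \<bar>(t - r) * k\<bar>" by (rule abs_sin_x_le_abs_x)
        also have "\<dots> = (t - r) * k" using r k by simp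
        also have "\<dots> \<le> h * k" using r k by (intro mult_right_mono) (auto simp: h_def)
        finally show "\<bar>cos (k * r + (pi / 2 - t * k))\<bar> \<le> k * h" by (simp add: mult.commute)
      qed (use st in auto)
      also have "\<dots> = (k * h)\<^sup>2 * h * (2 * h powr a / a)" by (simp add: h_def)
      also have "\<dots> \<le> (k * h)\<^sup>2 * T * (2 * k powr (- a) / a)"
      proof -
        have "h \<le> 1 / k" using False k by (simp add: field_simps)
        then have "h powr a \<le> (1 / k) powr a" using a h by (intro powr_mono2) auto
        also have "\<dots> = k powr (- a)" using k by (simp add: powr_divide powr_minus_divide)
        finally show ?thesis using h a by (intro mult_mono divide_right_mono mult_left_mono) auto
      qed
      also have "\<dots> = 2 * T / a * (k powr (- a) * m)" by (simp add: m1)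
      also have "\<dots> \<le> (2 * C0 * T + 2 * T / a) * (k powr (- a) * m)"
        using C0 T m by (intro mult_right_mono) auto
      finally show ?thesis .
    qed
    have "wave_energy a s t k \<le> 8 * (sin (k * (t - s) / 2))\<^sup>2 * E1 + 2 * E2"
      unfolding E1_def E2_def by (rule wave_diff_energy_decomposition(1)[OF a st(1,2)])
    also have "\<dots> \<le> 16 * C0 * T * (k powr (- a) * m) + 2 * ((2 * C0 * T + 2 * T / a) * (k powr (- a) * m))"
      using first second unfolding h_def by linarith
    also have "\<dots> = C * (k powr (- a) * m)" by (simp add: C_def algebra_simps)
    finally show "wave_energy a s t k \<le> C * (k powr (- a) * min 1 ((k * (t - s))\<^sup>2))"
      by (simp add: m_def h_def)
  qed
qed

text \<open>For \<open>1 \<le> h k \<le> 2\<close> with \<open>h = t - s\<close> the amplitude on \<open>[0,s]\<close> is bounded below, so that part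
  has energy at least a multiple of \<open>k\<^bsup>-a\<^esup>\<close>. The part on \<open>[s,t]\<close> has an additional
  factor \<open>h\<close> and is absorbed once \<open>h\<close> is small; small \<open>h\<close> also makes \<open>k\<close> large enough for the
  asymptotics of the first part.\<close>

lemma wave_diff_energy_ge_resonant:
  fixes a t0 T :: real
  assumes a: "0 < a" "a < 1" and t0: "0 < t0" "t0 < T"
  obtains c h0 where "0 < c" "0 < h0" "\<And>s t k. t0 \<le> s \<Longrightarrow> s < t \<Longrightarrow> t \<le> T \<Longrightarrow> t - s \<le> h0 \<Longrightarrow>
     1 \<le> k * (t - s) \<Longrightarrow> k * (t - s) \<le> 2 \<Longrightarrow>
     c * k powr (- a) \<le> wave_energy a s t k"
proof -
  obtain C0 where C0: "0 < C0" "\<And>X. 0 \<le> X \<Longrightarrow> \<bar>cos_powr_integral a X\<bar> \<le> C0"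
    using cos_powr_integral_bounded[OF a] by blast
  obtain c1 X0 where c1: "0 < c1" "0 < X0" "\<And>X. X0 \<le> X \<Longrightarrow> c1 \<le> cos_powr_integral a X"
    using cos_powr_integral_eventually_ge[OF a] by blast
  define \<sigma> where "\<sigma> = sin (1/2 :: real)"
  have \<sigma>: "\<sigma> > 0" unfolding \<sigma>_def using pi_gt3 by (intro sin_gt_zero) auto
  (* For k >= k0 each of the two error terms in the lower bound for E1 is at most a quarter of
     its main term c1 * t0 * k powr (- a); for h <= h0 the bound for E2 is half of the resulting
     bound for the first part. *)
  define \<rho> where "\<rho> = a * c1 * t0 / (4 * T powr a)"
  have \<rho>: "\<rho> > 0" using a c1 t0 by (simp add: \<rho>_def)
  define k0 where "k0 = max (4 * (c1 + C0) * X0 / (c1 * t0)) (\<rho> powr (1 / (a - 1)))"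
  have k0: "k0 > 0" using \<rho> by (simp add: k0_def less_max_iff_disj)
  define h0 where "h0 = min (\<sigma>\<^sup>2 * c1 * t0 / (4 * C0)) (1 / k0)"
  define c where "c = \<sigma>\<^sup>2 * c1 * t0 / 2"
  show ?thesis
  proof
    show "0 < c" using \<sigma> c1 t0 by (simp add: c_def)
    show "0 < h0" using \<sigma> c1 t0 C0 k0 by (simp add: h0_def)
    fix s t k assume st: "t0 \<le> s" "s < t" "t \<le> T" "t - s \<le> h0" and kh: "1 \<le> k * (t - s)" "k * (t - s) \<le> 2"
    define h where "h = t - s"
    have h: "0 < h" "h \<le> h0" using st by (auto simp: h_def)
    have k: "0 < k" using kh st by (metis diff_gt_0_iff_gt less_le_trans zero_less_mult_pos2 zero_less_one)
    have "1 / h \<le> k" using kh h by (simp add: field_simps h_def)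
    moreover have "k0 \<le> 1 / h" using h k0 by (simp add: h0_def field_simps)
    ultimately have kk: "k0 \<le> k" by simp
    define E1 where "E1 = trig_energy a 0 s k (- ((t + s) * k / 2))"
    define E2 where "E2 = trig_energy a s t k (pi / 2 - t * k)"
    have E1: "k powr (- a) * (c1 * t0 / 2) \<le> E1"
    proof -
      have "(c1 + C0) * X0 / k \<le> c1 * t0 / 4"
      proof -
        have "4 * (c1 + C0) * X0 / (c1 * t0) \<le> k" using kk by (simp add: k0_def)
        then have "4 * (c1 + C0) * X0 \<le> k * (c1 * t0)" using c1 t0 by (simp add: pos_divide_le_eq)
        then show ?thesis using k by (simp add: field_simps)
      qed
      moreover have "c1 * t0 \<le> c1 * s" using st c1 by simp
      ultimately have 1: "c1 * t0 * (3 / 4) \<le> c1 * s - (c1 + C0) * X0 / k" by linarith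
      have "k powr (a - 1) \<le> (\<rho> powr (1 / (a - 1))) powr (a - 1)"
        using kk \<rho> a by (intro powr_mono2') (auto simp: k0_def)
      also have "\<dots> = \<rho>" using a \<rho> by (simp add: powr_powr)
      finally have kr: "k powr (a - 1) \<le> \<rho>" .
      have "s powr a / (a * k) \<le> T powr a / (a * k)"
        using st t0 a k by (intro divide_right_mono powr_mono2) auto
      also have "\<dots> = k powr (- a) * (k powr (a - 1) * T powr a / a)"
      proof -
        have "k powr (- a) * k powr (a - 1) = k powr (- a + (a - 1))" by (rule powr_add[symmetric])
        also have "\<dots> = 1 / k" using k by (simp add: powr_minus_divide)
        finally have "k powr (- a) * k powr (a - 1) = 1 / k" .
        then show ?thesis by (simp add: mult.assoc[symmetric])
      qed
      also have "\<dots> \<le> k powr (- a) * (\<rho> * T powr a / a)"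
        using kr a by (intro mult_left_mono divide_right_mono mult_right_mono) auto
      also have "\<rho> * T powr a / a = c1 * t0 / 4"
        using a t0 by (simp add: \<rho>_def)
      finally have 2: "s powr a / (a * k) \<le> k powr (- a) * (c1 * t0 / 4)" .
      have "k powr (- a) * (c1 * t0 / 2) = k powr (- a) * (c1 * t0 * (3 / 4)) - k powr (- a) * (c1 * t0 / 4)"
        by (simp add: algebra_simps)
      also have "\<dots> \<le> k powr (- a) * (c1 * s - (c1 + C0) * X0 / k) - s powr a / (a * k)"
        using 1 2 by (intro diff_mono mult_left_mono) auto
      also have "\<dots> \<le> E1"
        unfolding E1_def using st t0 by (intro trig_energy_ge[OF a C0(2) c1 k]) auto
      finally show ?thesis .
    qed
    have E2: "E2 \<le> 2 * C0 * h * k powr (- a)"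
      unfolding E2_def h_def using st by (intro trig_energy_le[OF a C0(2) k]) auto
    also have "\<dots> \<le> 2 * C0 * (\<sigma>\<^sup>2 * c1 * t0 / (4 * C0)) * k powr (- a)"
      using h C0 by (intro mult_right_mono mult_left_mono) (auto simp: h0_def)
    also have "\<dots> = c * k powr (- a)" using C0 by (simp add: c_def)
    finally have E2': "E2 \<le> c * k powr (- a)" .
    have "\<sigma> \<le> sin (k * (t - s) / 2)"
      unfolding \<sigma>_def using kh pi_gt3 by (intro sin_monotone_2pi_le) auto
    then have "\<sigma>\<^sup>2 \<le> (sin (k * (t - s) / 2))\<^sup>2" using \<sigma> by (intro power_mono) auto
    then have "2 * \<sigma>\<^sup>2 * (k powr (- a) * (c1 * t0 / 2)) \<le> 2 * (sin (k * (t - s) / 2))\<^sup>2 * E1"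
      using E1 c1 t0 by (intro mult_mono) auto
    also have "\<dots> \<le> wave_energy a s t k + E2"
      unfolding E1_def E2_def using st t0 by (intro wave_diff_energy_decomposition(2)[OF a]) auto
    also have "2 * \<sigma>\<^sup>2 * (k powr (- a) * (c1 * t0 / 2)) = 2 * (c * k powr (- a))"
      by (simp add: c_def)
    finally show "c * k powr (- a) \<le> wave_energy a s t k"
      using E2' by linarith
  qed
qed

lemma sin_ge_half:
  assumes "0 \<le> x" "x \<le> 1"
  shows "x / 2 \<le> sin (x::real)"
proof -
  have "(\<lambda>x. sin x - x / 2) 0 \<le> (\<lambda>x. sin x - x / 2) x"
  proof (rule DERIV_nonneg_imp_nondecreasing[OF assms(1)])
    fix y :: real assume y: "0 \<le> y" "y \<le> x"
    have "cos (pi / 3) \<le> cos y" using y assms pi_gt3 by (subst cos_mono_le_eq) auto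
    then have "0 \<le> cos y - 1 / 2" by (simp add: cos_60)
    moreover have "((\<lambda>x. sin x - x / 2) has_real_derivative cos y - 1 / 2) (at y)"
      by (auto intro!: derivative_eq_intros)
    ultimately show "\<exists>d. ((\<lambda>x. sin x - x / 2) has_real_derivative d) (at y) \<and> 0 \<le> d" by blast
  qed
  then show ?thesis by simp
qed

text \<open>For \<open>k T \<le> 1\<close> all arguments of the sines lie where the sine increases, so the difference is
  nonnegative. Off the diagonal the kernel is at least \<open>T\<^bsup>a - 1\<^esup>\<close> on \<open>[0,T]\<^sup>2\<close>, so the energy is at
  least this constant times the square of the integral, which is
  \<open>(cos(k s) - cos(k t)) / k\<close>.\<close>

lemma wave_diff_energy_ge_low_frequency:
  fixes a t0 T :: real
  assumes a: "0 < a" "a < 1" and t0: "0 < t0"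
    and st: "t0 \<le> s" "s < t" "t \<le> T" and k: "0 < k" "k * T \<le> 1"
  shows "T powr (a - 1) * (k * t0 * (t - s) / 4)\<^sup>2 \<le> wave_energy a s t k"
proof -
  let ?f = "wave_diff s t k"
  have T: "0 < T" using st t0 by simp
  have kx: "x * k \<le> 1" if "x \<le> T" for x
  proof -
    have "x * k \<le> T * k" using that k by (intro mult_right_mono) auto
    then show ?thesis using k(2) by (simp only: mult.commute[of T k])
  qed
  have f_nonneg: "0 \<le> ?f r" for r
  proof (cases "r \<in> {0..t}")
    case True
    show ?thesis
    proof (cases "r \<le> s")
      case r: True
      have "sin ((s - r) * k) \<le> sin ((t - r) * k)"
      proof (rule sin_monotone_2pi_le)
        have "0 \<le> (s - r) * k" using r k by simp
        then show "- (pi / 2) \<le> (s - r) * k" using pi_gt3 by linarith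
        show "(s - r) * k \<le> (t - r) * k" using st k by (intro mult_right_mono) auto
        have "(t - r) * k \<le> 1" using True st by (intro kx) auto
        then show "(t - r) * k \<le> pi / 2" using pi_gt3 by linarith
      qed
      then show ?thesis using True r by (simp add: wave_diff_def)
    next
      case False
      have "(t - r) * k \<le> 1" using True st by (intro kx) auto
      then have "0 \<le> sin ((t - r) * k)" using True k pi_gt3 by (intro sin_ge_zero) auto
      then show ?thesis using True False by (simp add: wave_diff_def)
    qed
  qed (use st in \<open>auto simp: wave_diff_def\<close>)
  have f_supp: "?f r = indicator {0..T} r * ?f r" for r
    using st by (auto simp: wave_diff_def indicator_def)
  have f_bd: "\<bar>?f r\<bar> \<le> 2" for r
  proof -
    have "\<bar>?f r\<bar> \<le> \<bar>indicator {0..t} r * sin ((t - r) * k)\<bar> + \<bar>indicator {0..s} r * sin ((s - r) * k)\<bar>"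
      unfolding wave_diff_def by (rule abs_triangle_ineq4)
    also have "\<dots> \<le> 1 + 1"
      by (intro add_mono) (auto simp: indicator_def)
    finally show ?thesis by simp
  qed
  have intf: "integrable lborel (\<lambda>r. ?f r)"
  proof (rule Bochner_Integration.integrable_bound)
    show "integrable lborel (\<lambda>r. 2 * indicator {0..T} r :: real)" by simp
    show "AE r in lborel. norm (?f r) \<le> norm (2 * indicator {0..T} r :: real)"
      using f_bd by (subst f_supp) (auto simp: abs_mult indicator_def)
  qed simp
  have J: "(LINT r|lborel. ?f r) = (cos (k * s) - cos (k * t)) / k"
  proof -
    have 1: "(LINT r|lborel. sin ((u - r) * k) * indicator {0..u} r) = (1 - cos (k * u)) / k" if "0 \<le> u" for u
    proof -
      have "(LINT r|lborel. sin ((u - r) * k) * indicator {0..u} r) = cos ((u - u) * k) / k - cos ((u - 0) * k) / k"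
        using k that by (intro integral_FTC_Icc_real) (auto intro!: derivative_eq_intros)
      then show ?thesis by (simp add: diff_divide_distrib mult.commute)
    qed
    have i: "integrable lborel (\<lambda>r. indicator {0..u} r * sin ((u - r) * k))" for u
      by (rule Bochner_Integration.integrable_bound[OF integrable_indicator_Icc[of 0 u]]) (auto simp: indicator_def)
    have "(LINT r|lborel. ?f r) = (LINT r|lborel. indicator {0..t} r * sin ((t - r) * k)) - (LINT r|lborel. indicator {0..s} r * sin ((s - r) * k))"
      unfolding wave_diff_def by (rule Bochner_Integration.integral_diff[OF i i])
    also have "\<dots> = (1 - cos (k * t)) / k - (1 - cos (k * s)) / k"
      using 1[of t] 1[of s] st t0 by (simp add: mult.commute)
    finally show ?thesis by (simp add: diff_divide_distrib)
  qed
  have J_ge: "k * t0 * (t - s) / 4 \<le> (LINT r|lborel. ?f r)"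
  proof -
    have S0: "cos (k * s) - cos (k * t) = 2 * (sin (k * (t + s) / 2) * sin (k * (t - s) / 2))"
      using cos_diff_cos[of "k * s" "k * t"] by (simp add: algebra_simps)
    have S1: "k * (t + s) / 2 / 2 \<le> sin (k * (t + s) / 2)"
      using k st t0 kx[of t] kx[of s] by (intro sin_ge_half) (auto simp: algebra_simps)
    have S2: "k * (t - s) / 2 / 2 \<le> sin (k * (t - s) / 2)"
      using k st t0 kx[of "t - s"] by (intro sin_ge_half) (auto simp: algebra_simps)
    have S3: "k * t0 / 2 \<le> k * (t + s) / 2 / 2"
    proof -
      have "k * (2 * t0) \<le> k * (t + s)" using k st by (intro mult_left_mono) auto
      then show ?thesis by simp
    qed
    have S4: "0 \<le> k * t0 / 2" "0 \<le> k * (t - s) / 2 / 2" using k st t0 by simp_all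
    have "(k * t0 / 2) * (k * (t - s) / 2 / 2) \<le> sin (k * (t + s) / 2) * sin (k * (t - s) / 2)"
      by (rule mult_mono[OF order_trans[OF S3 S1] S2 order_trans[OF S4(1) order_trans[OF S3 S1]] S4(2)])
    then have "2 * ((k * t0 / 2) * (k * (t - s) / 2 / 2)) \<le> cos (k * s) - cos (k * t)"
      unfolding S0 by linarith
    then show ?thesis unfolding J using k by (simp add: field_simps power2_eq_square)
  qed
  have pair: "integrable (lborel \<Otimes>\<^sub>M lborel) (\<lambda>(v, r). ?f r * ?f v * time_kernel a r v)"
  proof -
    have "integrable (lborel \<Otimes>\<^sub>M lborel) (\<lambda>(v, r). indicator {0..T} v * (indicator {0..T} r * (?f r * ?f v * time_kernel a r v)))"
      by (rule riesz_energy_real_eq_pair(2)[OF a(1) _ f_bd]) simp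
    moreover have "indicator {0..T} v * (indicator {0..T} r * (?f r * ?f v * time_kernel a r v)) = ?f r * ?f v * time_kernel a r v" for v r
      by (subst (3 4) f_supp) (simp add: indicator_def)
    ultimately show ?thesis by simp
  qed
  have "T powr (a - 1) * (LINT r|lborel. ?f r)\<^sup>2 = (LINT v|lborel. LINT r|lborel. ?f r * ?f v * T powr (a - 1))"
    by (simp add: power2_eq_square)
  also have "\<dots> \<le> (LINT v|lborel. LINT r|lborel. ?f r * ?f v * time_kernel a r v)"
  proof (rule integral_mono)
    show "integrable lborel (\<lambda>v. LINT r|lborel. ?f r * ?f v * T powr (a - 1))"
      using intf by simp
    show "integrable lborel (\<lambda>v. LINT r|lborel. ?f r * ?f v * time_kernel a r v)"
      by (rule lborel_pair.integrable_fst[OF pair])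
    fix v :: real
    show "(LINT r|lborel. ?f r * ?f v * T powr (a - 1)) \<le> (LINT r|lborel. ?f r * ?f v * time_kernel a r v)"
    proof (rule integral_mono_AE)
      show "integrable lborel (\<lambda>r. ?f r * ?f v * T powr (a - 1))" using intf by simp
      have "integrable lborel (\<lambda>r. indicator {0..T} r * (?f r * ?f v * time_kernel a r v))"
      proof (rule integrable_abs_powr_weighted[OF a(1), where B="2 * 2"])
        show "\<bar>?f r * ?f v\<bar> \<le> 2 * 2" for r
          unfolding abs_mult by (intro mult_mono f_bd) auto
      qed simp
      then show "integrable lborel (\<lambda>r. ?f r * ?f v * time_kernel a r v)"
        by (subst f_supp) (simp only: mult.assoc)
      show "AE r in lborel. ?f r * ?f v * T powr (a - 1) \<le> ?f r * ?f v * time_kernel a r v"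
        using AE_lborel_singleton[of v]
      proof eventually_elim
        case (elim r)
        show ?case
        proof (cases "r \<in> {0..T} \<and> v \<in> {0..T}")
          case True
          then have "T powr (a - 1) \<le> time_kernel a r v" using elim a by (intro powr_mono2') auto
          then show ?thesis using f_nonneg by (intro mult_left_mono) auto
        next
          case False
          then have z: "?f r * ?f v = 0" using f_supp[of r] f_supp[of v] by auto
          show ?thesis unfolding z by simp
        qed
      qed
    qed
  qed
  also have "\<dots> = riesz_energy a (\<lambda>r. complex_of_real (?f r))"
    by (rule riesz_energy_of_real[symmetric])
  finally have "T powr (a - 1) * (LINT r|lborel. ?f r)\<^sup>2 \<le> riesz_energy a (\<lambda>r. complex_of_real (?f r))" .
  moreover have "T powr (a - 1) * (k * t0 * (t - s) / 4)\<^sup>2 \<le> T powr (a - 1) * (LINT r|lborel. ?f r)\<^sup>2"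
    using J_ge k t0 st by (intro mult_left_mono power_mono) auto
  ultimately show ?thesis by linarith
qed

section \<open>Integration over the spectral measure\<close>

text \<open>Polar coordinates for radial functions: both sides have the volume of a ball as distribution
  function.\<close>

lemma distr_norm_lborel:
  "distr (lborel :: 'a::euclidean_space measure) borel norm =
    density lborel (\<lambda>r. ennreal (real DIM('a) * unit_ball_vol DIM('a) * r ^ (DIM('a) - 1)) * indicator {0..} r)"
  (is "?M = ?N")
proof (rule measure_eqI_generator_eq_countable[where E="range atMost" and A="(\<lambda>n::nat. {..real n}) ` UNIV" and \<Omega>=UNIV])
  let ?n = "DIM('a)"
  let ?V = "unit_ball_vol ?n"
  show "Int_stable (range atMost :: real set set)"
    by (auto simp: Int_stable_def)
  show "sets ?M = sigma_sets UNIV (range atMost)" "sets ?N = sigma_sets UNIV (range atMost)"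
    by (simp_all add: borel_eq_atMost sets_measure_of)
  have M: "emeasure ?M {..R} = ennreal (if R < 0 then 0 else ?V * R ^ ?n)" for R
  proof -
    have "emeasure ?M {..R} = emeasure lborel (cball (0::'a) R)"
      by (subst emeasure_distr) (auto simp: cball_def intro!: arg_cong[where f="emeasure lborel"])
    then show ?thesis by (simp add: emeasure_cball)
  qed
  show "emeasure ?M X = emeasure ?N X" if "X \<in> range atMost" for X
  proof -
    from that obtain R where X: "X = {..R}" by auto
    have "emeasure ?N {..R} = (\<integral>\<^sup>+r. ennreal (?n * ?V * r ^ (?n - 1)) * indicator {0..R} r \<partial>lborel)"
      by (subst emeasure_density) (auto intro!: nn_integral_cong simp: indicator_def)
    also have "\<dots> = ennreal (if R < 0 then 0 else ?V * R ^ ?n)"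
    proof (cases "R < 0")
      case False
      have "(\<integral>\<^sup>+r. ennreal (?n * ?V * r ^ (?n - 1)) * indicator {0..R} r \<partial>lborel) = ?V * R ^ ?n - ?V * 0 ^ ?n"
        using False by (intro nn_integral_FTC_Icc) (auto intro!: derivative_eq_intros)
      then show ?thesis using False by simp
    qed simp
    finally show ?thesis unfolding X M ..
  qed
  show "\<Union> ((\<lambda>n::nat. {..real n}) ` UNIV) = UNIV"
    using real_arch_simple by auto
  show "emeasure ?M a \<noteq> \<infinity>" if "a \<in> (\<lambda>n::nat. {..real n}) ` UNIV" for a
    using that by (auto simp: M)
qed auto

lemma nn_integral_spectral_radial:
  fixes F :: "real \<Rightarrow> ennreal"
  assumes [measurable]: "F \<in> borel_measurable borel"
  shows "(\<integral>\<^sup>+\<xi>. F (norm \<xi>) \<partial>(spectral_measure \<beta> :: 'a::euclidean_space measure)) =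
    ennreal (real DIM('a) * unit_ball_vol DIM('a)) *
      (\<integral>\<^sup>+k. ennreal (k powr (\<beta> - 1)) * F k * indicator {0..} k \<partial>lborel)"
proof -
  let ?n = "DIM('a)"
  let ?V = "unit_ball_vol ?n"
  have "(\<integral>\<^sup>+\<xi>. F (norm \<xi>) \<partial>(spectral_measure \<beta> :: 'a measure)) =
     (\<integral>\<^sup>+\<xi>. ennreal (norm \<xi> powr (\<beta> - real ?n)) * F (norm \<xi>) \<partial>(lborel :: 'a measure))"
    unfolding spectral_measure_def by (intro nn_integral_density) measurable
  also have "\<dots> = (\<integral>\<^sup>+k. ennreal (k powr (\<beta> - real ?n)) * F k \<partial>distr (lborel :: 'a measure) borel norm)"
    by (intro nn_integral_distr[symmetric]) measurable
  also have "\<dots> = (\<integral>\<^sup>+k. ennreal (?n * ?V * k ^ (?n - 1)) * indicator {0..} k * (ennreal (k powr (\<beta> - real ?n)) * F k) \<partial>lborel)"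
    unfolding distr_norm_lborel by (intro nn_integral_density) measurable
  also have "\<dots> = (\<integral>\<^sup>+k. ennreal (?n * ?V) * (ennreal (k powr (\<beta> - 1)) * F k * indicator {0..} k) \<partial>lborel)"
  proof (rule nn_integral_cong)
    fix k :: real
    show "ennreal (?n * ?V * k ^ (?n - 1)) * indicator {0..} k * (ennreal (k powr (\<beta> - real ?n)) * F k)
      = ennreal (?n * ?V) * (ennreal (k powr (\<beta> - 1)) * F k * indicator {0..} k)"
    proof (cases "k > 0")
      case True
      have "k ^ (?n - 1) * k powr (\<beta> - real ?n) = k powr (\<beta> - 1)"
        using True by (simp add: powr_realpow[symmetric] powr_add[symmetric] of_nat_diff)
      then have "ennreal (?n * ?V * k ^ (?n - 1)) * ennreal (k powr (\<beta> - real ?n)) = ennreal (?n * ?V) * ennreal (k powr (\<beta> - 1))"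
        using True by (simp add: ennreal_mult[symmetric] mult.assoc)
      then show ?thesis using True by (simp add: mult.assoc[symmetric])
    qed (cases "k = 0"; simp)
  qed
  also have "\<dots> = ennreal (?n * ?V) * (\<integral>\<^sup>+k. ennreal (k powr (\<beta> - 1)) * F k * indicator {0..} k \<partial>lborel)"
    by (intro nn_integral_cmult) measurable
  finally show ?thesis .
qed

text \<open>The energy at spatial frequency \<open>k\<close> of the actual difference of wave kernels, whose transform
  has the denominator \<open>k\<close>.\<close>

definition wave_spectral_density :: "real \<Rightarrow> real \<Rightarrow> real \<Rightarrow> real \<Rightarrow> real" where
  "wave_spectral_density a s t k = wave_energy a s t k / k\<^sup>2"

lemma wave_spectral_density_measurable [measurable]:
  "wave_spectral_density a s t \<in> borel_measurable borel"
  unfolding wave_spectral_density_def riesz_energy_of_real wave_diff_def by measurable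

lemma wave_spectral_density_nonneg:
  "0 < a \<Longrightarrow> a < 1 \<Longrightarrow> 0 \<le> wave_spectral_density a s t k"
  unfolding wave_spectral_density_def
  by (intro divide_nonneg_nonneg riesz_energy_nonneg tame_wave_diff) auto

text \<open>Splitting at \<open>k = 1/h\<close> with \<open>h = t - s\<close> leaves the integrals of
  \<open>h\<^sup>2 k\<^bsup>\<beta> - a - 1\<^esup>\<close> below and of \<open>k\<^bsup>\<beta> - a - 3\<^esup>\<close> above. The hypotheses on \<open>\<beta>\<close> are exactly
  the convergence of these at \<open>0\<close> and at infinity, and both are of order \<open>h\<^bsup>a + 2 - \<beta>\<^esup>\<close>.\<close>

lemma wave_spectral_integral_le:
  fixes a \<beta> T :: real
  assumes a: "0 < a" "a < 1" and \<beta>: "a < \<beta>" "\<beta> < a + 2" and T: "0 < T"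
  obtains C where "0 < C" "\<And>s t. 0 \<le> s \<Longrightarrow> s < t \<Longrightarrow> t \<le> T \<Longrightarrow>
    (\<integral>\<^sup>+k. ennreal (k powr (\<beta> - 1)) * ennreal (wave_spectral_density a s t k) * indicator {0..} k \<partial>lborel)
      \<le> ennreal (C * (t - s) powr (a + 2 - \<beta>))"
proof -
  obtain C where C: "0 < C" "\<And>s t k. 0 \<le> s \<Longrightarrow> s < t \<Longrightarrow> t \<le> T \<Longrightarrow> 0 < k \<Longrightarrow>
    wave_energy a s t k \<le> C * (k powr (- a) * min 1 ((k * (t - s))\<^sup>2))"
    using wave_diff_energy_le[OF a T] by blast
  show ?thesis
  proof
    show "0 < C * (1 / (\<beta> - a) + 1 / (a + 2 - \<beta>))" using C \<beta> by (intro mult_pos_pos add_pos_pos) auto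
    fix s t :: real assume st: "0 \<le> s" "s < t" "t \<le> T"
    define h where "h = t - s"
    have h: "0 < h" using st by (simp add: h_def)
    have "(\<integral>\<^sup>+k. ennreal (k powr (\<beta> - 1)) * ennreal (wave_spectral_density a s t k) * indicator {0..} k \<partial>lborel)
      \<le> (\<integral>\<^sup>+k. ennreal (C * h\<^sup>2) * (ennreal (k powr (\<beta> - a - 1)) * indicator {0..1/h} k)
          + ennreal C * (ennreal (k powr (\<beta> - a - 3)) * indicator {1/h..} k) \<partial>lborel)"
    proof (rule nn_integral_mono)
      fix k :: real
      let ?l = "ennreal (k powr (\<beta> - 1)) * ennreal (wave_spectral_density a s t k) * indicator {0..} k"
      let ?r1 = "ennreal (C * h\<^sup>2) * (ennreal (k powr (\<beta> - a - 1)) * indicator {0..1/h} k)"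
      let ?r2 = "ennreal C * (ennreal (k powr (\<beta> - a - 3)) * indicator {1/h..} k)"
      show "?l \<le> ?r1 + ?r2"
      proof (cases "k > 0")
        case k: True
        have e: "wave_spectral_density a s t k \<le> C * (k powr (- a) * min 1 ((k * h)\<^sup>2)) / k\<^sup>2"
          unfolding wave_spectral_density_def h_def by (intro divide_right_mono C(2) st k) auto
        have k2: "k powr (\<beta> - 1) * (k powr (- a)) / k\<^sup>2 = k powr (\<beta> - a - 3)"
        proof -
          have "k powr (\<beta> - a - 3) = k powr ((\<beta> - 1) + (- a) - 2)" by simp
          also have "\<dots> = k powr ((\<beta> - 1) + (- a)) / k powr 2" by (rule powr_diff)
          also have "k powr 2 = k\<^sup>2" using k by simp
          finally show ?thesis by (simp only: powr_add times_divide_eq_right mult_ac)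
        qed
        have k3: "k powr (\<beta> - a - 3) * k\<^sup>2 = k powr (\<beta> - a - 1)"
        proof -
          have "k powr (\<beta> - a - 1) = k powr ((\<beta> - a - 3) + 2)" by simp
          also have "\<dots> = k powr (\<beta> - a - 3) * k powr 2" by (rule powr_add)
          also have "k powr 2 = k\<^sup>2" using k by simp
          finally show ?thesis ..
        qed
        have "?l = ennreal (k powr (\<beta> - 1) * wave_spectral_density a s t k)"
          using k by (simp add: ennreal_mult')
        also have "\<dots> \<le> ennreal (k powr (\<beta> - 1) * (C * (k powr (- a) * min 1 ((k * h)\<^sup>2)) / k\<^sup>2))"
          using e by (intro ennreal_leI mult_left_mono) auto
        also have "k powr (\<beta> - 1) * (C * (k powr (- a) * min 1 ((k * h)\<^sup>2)) / k\<^sup>2) =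
            C * (k powr (\<beta> - a - 3) * min 1 ((k * h)\<^sup>2))"
          unfolding k2[symmetric] by simp
        finally have l: "?l \<le> ennreal (C * (k powr (\<beta> - a - 3) * min 1 ((k * h)\<^sup>2)))" .
        show ?thesis
        proof (cases "k \<le> 1 / h")
          case True
          have "C * (k powr (\<beta> - a - 3) * min 1 ((k * h)\<^sup>2)) \<le> C * (k powr (\<beta> - a - 3) * (k * h)\<^sup>2)"
            using C(1) by (intro mult_left_mono) auto
          also have "\<dots> = C * h\<^sup>2 * k powr (\<beta> - a - 1)"
            unfolding k3[symmetric] by (simp add: power_mult_distrib)
          finally have "?l \<le> ennreal (C * h\<^sup>2 * k powr (\<beta> - a - 1))"
            by (rule order_trans[OF l ennreal_leI])
          also have "\<dots> = ?r1" using True k C(1) by (simp add: ennreal_mult)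
          finally show ?thesis by (rule order_trans) simp
        next
          case False
          have "C * (k powr (\<beta> - a - 3) * min 1 ((k * h)\<^sup>2)) \<le> C * (k powr (\<beta> - a - 3) * 1)"
            using C(1) by (intro mult_left_mono) auto
          then have "?l \<le> ennreal (C * (k powr (\<beta> - a - 3) * 1))"
            by (rule order_trans[OF l ennreal_leI])
          also have "\<dots> = ?r2" using False k C(1) by (simp add: ennreal_mult)
          finally show ?thesis by (rule order_trans) simp
        qed
      qed (cases "k = 0"; simp)
    qed
    also have "\<dots> = ennreal (C * h\<^sup>2) * ennreal ((1 / h) powr (\<beta> - a) / (\<beta> - a)) +
        ennreal C * ennreal (- ((1 / h) powr (\<beta> - a - 3 + 1)) / (\<beta> - a - 3 + 1))"
    proof -
      have 1: "(\<integral>\<^sup>+k. ennreal (k powr (\<beta> - a - 1)) * indicator {0..1/h} k \<partial>lborel) = ennreal ((1 / h) powr (\<beta> - a) / (\<beta> - a))"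
        using \<beta> h by (intro nn_integral_powr_from_0) auto
      have 2: "(\<integral>\<^sup>+k. ennreal (k powr (\<beta> - a - 3)) * indicator {1/h..} k \<partial>lborel) =
          ennreal (- ((1 / h) powr (\<beta> - a - 3 + 1)) / (\<beta> - a - 3 + 1))"
        using \<beta> h by (intro nn_integral_powr_to_inf) auto
      show ?thesis
        unfolding 1[symmetric] 2[symmetric]
        by (subst (1 2) nn_integral_cmult[symmetric], measurable, rule nn_integral_add) measurable
    qed
    also have "\<dots> = ennreal (C * (1 / (\<beta> - a) + 1 / (a + 2 - \<beta>)) * h powr (a + 2 - \<beta>))"
    proof -
      have p1: "(1 / h) powr (\<beta> - a) = h powr (a - \<beta>)"
        using h powr_minus_divide[of h "\<beta> - a"] by (simp add: powr_divide)
      have p2: "(1 / h) powr (\<beta> - a - 3 + 1) = h powr (a + 2 - \<beta>)"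
        using h powr_minus_divide[of h "\<beta> - a - 3 + 1"] by (simp add: powr_divide algebra_simps)
      have p3: "h\<^sup>2 * h powr (a - \<beta>) = h powr (a + 2 - \<beta>)"
      proof -
        have "h powr (a + 2 - \<beta>) = h powr (2 + (a - \<beta>))" by (simp add: algebra_simps)
        also have "\<dots> = h powr 2 * h powr (a - \<beta>)" by (rule powr_add)
        also have "h powr 2 = h\<^sup>2" using h by simp
        finally show ?thesis ..
      qed
      have p4: "- (h powr (a + 2 - \<beta>)) / (\<beta> - a - 3 + 1) = h powr (a + 2 - \<beta>) / (a + 2 - \<beta>)"
        using \<beta> by (simp add: field_simps)
      have "ennreal (C * h\<^sup>2) * ennreal ((1 / h) powr (\<beta> - a) / (\<beta> - a)) = ennreal (C * (1 / (\<beta> - a)) * h powr (a + 2 - \<beta>))"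
        unfolding p1 p3[symmetric] using C \<beta> h by (simp add: ennreal_mult[symmetric] ac_simps)
      moreover have "ennreal C * ennreal (- ((1 / h) powr (\<beta> - a - 3 + 1)) / (\<beta> - a - 3 + 1)) = ennreal (C * (1 / (a + 2 - \<beta>)) * h powr (a + 2 - \<beta>))"
        unfolding p2 p4 using C \<beta> by (simp add: ennreal_mult[symmetric])
      ultimately show ?thesis
        using C \<beta> by (simp only:, subst ennreal_plus[symmetric]) (auto simp: distrib_left distrib_right)
    qed
    finally show "(\<integral>\<^sup>+k. ennreal (k powr (\<beta> - 1)) * ennreal (wave_spectral_density a s t k) * indicator {0..} k \<partial>lborel)
      \<le> ennreal (C * (1 / (\<beta> - a) + 1 / (a + 2 - \<beta>)) * (t - s) powr (a + 2 - \<beta>))"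
      by (simp add: h_def)
  qed
qed

text \<open>For \<open>h = t - s \<le> h0\<close> the frequencies between \<open>1/h\<close> and \<open>2/h\<close> contribute the claimed order.
  For \<open>h > h0\<close> the frequencies below \<open>1/T\<close> contribute a multiple of \<open>h\<^sup>2\<close>, which is at least a
  multiple of \<open>h\<^bsup>a + 2 - \<beta>\<^esup>\<close> since \<open>h\<close> is bounded away from \<open>0\<close>.\<close>

lemma wave_spectral_integral_ge:
  fixes a \<beta> t0 T :: real
  assumes a: "0 < a" "a < 1" and \<beta>: "a < \<beta>" "\<beta> < a + 2" and t0: "0 < t0" "t0 < T"
  obtains c where "0 < c" "\<And>s t. t0 \<le> s \<Longrightarrow> s < t \<Longrightarrow> t \<le> T \<Longrightarrow>
    ennreal (c * (t - s) powr (a + 2 - \<beta>)) \<le>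
    (\<integral>\<^sup>+k. ennreal (k powr (\<beta> - 1)) * ennreal (wave_spectral_density a s t k) * indicator {0..} k \<partial>lborel)"
proof -
  obtain c h0 where c: "0 < c" "0 < h0" "\<And>s t k. t0 \<le> s \<Longrightarrow> s < t \<Longrightarrow> t \<le> T \<Longrightarrow> t - s \<le> h0 \<Longrightarrow>
     1 \<le> k * (t - s) \<Longrightarrow> k * (t - s) \<le> 2 \<Longrightarrow>
     c * k powr (- a) \<le> wave_energy a s t k"
    using wave_diff_energy_ge_resonant[OF a t0] by blast
  (* The least value of k powr (beta - a - 3) on the window is attained at its right end 2/h. *)
  define c1 where "c1 = c * 2 powr (\<beta> - a - 3)"
  define D where "D = T powr (a - 1) * (t0 / 4)\<^sup>2"
  define c2 where "c2 = D * ((1 / T) powr \<beta> / \<beta>) * h0 powr (\<beta> - a)"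
  have c12: "c1 > 0" "c2 > 0" "D > 0"
    using c t0 \<beta> a by (auto simp: c1_def c2_def D_def)
  show ?thesis
  proof
    show "0 < min c1 c2" using c12 by simp
    fix s t assume st: "t0 \<le> s" "s < t" "t \<le> T"
    define h where "h = t - s"
    have h: "0 < h" using st by (simp add: h_def)
    let ?I = "\<integral>\<^sup>+k. ennreal (k powr (\<beta> - 1)) * ennreal (wave_spectral_density a s t k) * indicator {0..} k \<partial>lborel"
    show "ennreal (min c1 c2 * (t - s) powr (a + 2 - \<beta>)) \<le> ?I"
    proof (cases "h \<le> h0")
      case True
      have "ennreal (min c1 c2 * (t - s) powr (a + 2 - \<beta>)) \<le> ennreal (c1 * h powr (a + 2 - \<beta>))"
        unfolding h_def by (intro ennreal_leI mult_right_mono) auto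
      also have "c1 * h powr (a + 2 - \<beta>) = c * (2 / h) powr (\<beta> - a - 3) * (1 / h)"
      proof -
        have "(1 / h) powr (\<beta> - a - 3) * (1 / h) = (1 / h) powr (\<beta> - a - 3) * (1 / h) powr 1" using h by simp
        also have "\<dots> = (1 / h) powr (\<beta> - a - 3 + 1)" by (rule powr_add[symmetric])
        also have "\<dots> = h powr (a + 2 - \<beta>)"
          using h powr_minus_divide[of h "\<beta> - a - 3 + 1"] by (simp add: powr_divide algebra_simps)
        finally have 1: "(1 / h) powr (\<beta> - a - 3) * (1 / h) = h powr (a + 2 - \<beta>)" .
        have "(2 / h) powr (\<beta> - a - 3) = 2 powr (\<beta> - a - 3) * (1 / h) powr (\<beta> - a - 3)"
          using powr_mult[of 2 "1 / h" "\<beta> - a - 3"] h by simp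
        then show ?thesis unfolding c1_def 1[symmetric] by simp
      qed
      also have "ennreal \<dots> = (\<integral>\<^sup>+k. ennreal (c * (2 / h) powr (\<beta> - a - 3)) * indicator {1/h..2/h} k \<partial>lborel)"
      proof -
        have "2 / h - 1 / h = 1 / h" by simp
        then have "emeasure lborel {1/h..2/h} = ennreal (1 / h)"
          using h by (subst emeasure_lborel_Icc) (auto simp: divide_right_mono)
        then have "(\<integral>\<^sup>+k. ennreal (c * (2 / h) powr (\<beta> - a - 3)) * indicator {1/h..2/h} k \<partial>lborel)
            = ennreal (c * (2 / h) powr (\<beta> - a - 3)) * ennreal (1 / h)"
          by (subst nn_integral_cmult_indicator) auto
        then show ?thesis
          using h c(1) by (subst ennreal_mult) auto
      qed
      also have "\<dots> \<le> ?I"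
      proof (rule nn_integral_mono)
        fix k :: real
        show "ennreal (c * (2 / h) powr (\<beta> - a - 3)) * indicator {1/h..2/h} k \<le>
           ennreal (k powr (\<beta> - 1)) * ennreal (wave_spectral_density a s t k) * indicator {0..} k"
        proof (cases "k \<in> {1/h..2/h}")
          case kk: True
          then have k: "0 < k" using h by (auto intro: less_le_trans[of 0 "1/h"])
          have "1 \<le> k * (t - s)" "k * (t - s) \<le> 2"
            using kk h by (auto simp: h_def[symmetric] field_simps)
          then have "c * k powr (- a) / k\<^sup>2 \<le> wave_spectral_density a s t k"
            unfolding wave_spectral_density_def using True st
            by (intro divide_right_mono c(3)) (auto simp: h_def)
          then have "k powr (\<beta> - 1) * (c * k powr (- a) / k\<^sup>2) \<le> k powr (\<beta> - 1) * wave_spectral_density a s t k"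
            by (intro mult_left_mono) auto
          moreover have "k powr (\<beta> - 1) * (c * k powr (- a) / k\<^sup>2) = c * k powr (\<beta> - a - 3)"
          proof -
            have "k powr (\<beta> - a - 3) = k powr ((\<beta> - 1) + (- a) - 2)" by simp
            also have "\<dots> = k powr ((\<beta> - 1) + (- a)) / k powr 2" by (rule powr_diff)
            also have "k powr 2 = k\<^sup>2" using k by simp
            finally show ?thesis by (simp only: powr_add times_divide_eq_right mult_ac)
          qed
          moreover have "c * (2 / h) powr (\<beta> - a - 3) \<le> c * k powr (\<beta> - a - 3)"
            using kk k c(1) \<beta> a by (intro mult_left_mono powr_mono2') auto
          ultimately have "ennreal (c * (2 / h) powr (\<beta> - a - 3)) \<le> ennreal (k powr (\<beta> - 1) * wave_spectral_density a s t k)"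
            by (intro ennreal_leI) linarith
          then show ?thesis using kk k by (simp add: ennreal_mult')
        qed simp
      qed
      finally show ?thesis .
    next
      case False
      have T: "0 < T" using t0 by simp
      have "h powr (a + 2 - \<beta>) * h0 powr (\<beta> - a) \<le> h powr (a + 2 - \<beta>) * h powr (\<beta> - a)"
        using False c(2) \<beta> by (intro mult_left_mono powr_mono2) auto
      also have "\<dots> = h powr ((a + 2 - \<beta>) + (\<beta> - a))" by (rule powr_add[symmetric])
      also have "\<dots> = h\<^sup>2" using h by simp
      finally have hh: "h powr (a + 2 - \<beta>) * h0 powr (\<beta> - a) \<le> h\<^sup>2" .
      have "min c1 c2 * h powr (a + 2 - \<beta>) \<le> c2 * h powr (a + 2 - \<beta>)" by (intro mult_right_mono) auto
      also have "\<dots> = D * ((1 / T) powr \<beta> / \<beta>) * (h powr (a + 2 - \<beta>) * h0 powr (\<beta> - a))" by (simp add: c2_def)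
      also have "\<dots> \<le> D * ((1 / T) powr \<beta> / \<beta>) * h\<^sup>2"
        using hh c12 a \<beta> by (intro mult_left_mono) auto
      finally have "ennreal (min c1 c2 * (t - s) powr (a + 2 - \<beta>)) \<le> ennreal (D * h\<^sup>2 * ((1 / T) powr \<beta> / \<beta>))"
        by (intro ennreal_leI) (simp add: h_def mult_ac)
      also have "\<dots> = ennreal (D * h\<^sup>2) * ennreal ((1 / T) powr \<beta> / \<beta>)"
        using c12 a \<beta> by (intro ennreal_mult) auto
      also have "\<dots> = (\<integral>\<^sup>+k. ennreal (D * h\<^sup>2) * (ennreal (k powr (\<beta> - 1)) * indicator {0..1/T} k) \<partial>lborel)"
        using a \<beta> T by (subst nn_integral_cmult) (auto simp: nn_integral_powr_from_0)
      also have "\<dots> \<le> ?I"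
      proof (rule nn_integral_mono)
        fix k :: real
        show "ennreal (D * h\<^sup>2) * (ennreal (k powr (\<beta> - 1)) * indicator {0..1/T} k)
          \<le> ennreal (k powr (\<beta> - 1)) * ennreal (wave_spectral_density a s t k) * indicator {0..} k"
        proof (cases "0 < k \<and> k \<le> 1 / T")
          case True
          then have k: "0 < k" "k * T \<le> 1" using T by (auto simp: field_simps)
          have "D * h\<^sup>2 = T powr (a - 1) * (k * t0 * (t - s) / 4)\<^sup>2 / k\<^sup>2"
            using k by (simp add: D_def h_def power_mult_distrib power_divide)
          also have "\<dots> \<le> wave_spectral_density a s t k"
            unfolding wave_spectral_density_def
            by (intro divide_right_mono wave_diff_energy_ge_low_frequency[OF a t0(1) st k]) auto
          finally have "ennreal (D * h\<^sup>2) \<le> ennreal (wave_spectral_density a s t k)" by (rule ennreal_leI)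
          then have "ennreal (k powr (\<beta> - 1)) * ennreal (D * h\<^sup>2) \<le> ennreal (k powr (\<beta> - 1)) * ennreal (wave_spectral_density a s t k)"
            by (rule mult_left_mono) simp
          then show ?thesis using True by (simp add: mult.commute)
        next
          case False
          then show ?thesis by (cases "k = 0") (auto simp: indicator_def)
        qed
      qed
      finally show ?thesis .
    qed
  qed
qed

section \<open>Gaussian test functions\<close>

text \<open>Polynomial functions are closed under partial derivatives. Together with the product rule this
  provides the whole family of iterated derivatives of a Gaussian.\<close>

lemma real_polynomial_function_partials:
  fixes p :: "'a::euclidean_space \<Rightarrow> real"
  assumes "real_polynomial_function p"
  shows "\<exists>q. (\<forall>b. real_polynomial_function (q b)) \<and>
    (\<forall>y. (p has_derivative (\<lambda>h. \<Sum>b\<in>Basis. (h \<bullet> b) * q b y)) (at y))"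
  using assms
proof induction
  case (linear f)
  have rep: "f h = (\<Sum>b\<in>Basis. (h \<bullet> b) * f b)" for h
  proof -
    have "f h = f (\<Sum>b\<in>Basis. (h \<bullet> b) *\<^sub>R b)" by (simp add: euclidean_representation)
    also have "\<dots> = (\<Sum>b\<in>Basis. (h \<bullet> b) * f b)"
      using bounded_linear.linear[OF linear] by (simp add: linear_sum linear_scale)
    finally show ?thesis .
  qed
  have eq: "(\<lambda>h. \<Sum>b\<in>Basis. (h \<bullet> b) * f b) = f"
    by (rule ext) (rule rep[symmetric])
  show ?case
  proof (intro exI[of _ "\<lambda>b _. f b"] conjI allI)
    show "real_polynomial_function (\<lambda>_. f b)" for b by (rule real_polynomial_function.intros(2))
    show "(f has_derivative (\<lambda>h. \<Sum>b\<in>Basis. (h \<bullet> b) * f b)) (at y)" for y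
      unfolding eq by (rule bounded_linear_imp_has_derivative[OF linear])
  qed
next
  case (const c)
  show ?case by (intro exI[of _ "\<lambda>_ _. 0"]) auto
next
  case (add f g)
  then obtain q1 q2 where q: "\<And>b. real_polynomial_function (q1 b)" "\<And>b. real_polynomial_function (q2 b)"
    "\<And>y. (f has_derivative (\<lambda>h. \<Sum>b\<in>Basis. (h \<bullet> b) * q1 b y)) (at y)"
    "\<And>y. (g has_derivative (\<lambda>h. \<Sum>b\<in>Basis. (h \<bullet> b) * q2 b y)) (at y)"
    by blast
  show ?case
  proof (intro exI[of _ "\<lambda>b y. q1 b y + q2 b y"] conjI allI)
    show "((\<lambda>x. f x + g x) has_derivative (\<lambda>h. \<Sum>b\<in>Basis. (h \<bullet> b) * (q1 b y + q2 b y))) (at y)" for y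
      using has_derivative_add[OF q(3,4)] by (simp add: distrib_left sum.distrib)
  qed (use q in auto)
next
  case (mult f g)
  then obtain q1 q2 where q: "\<And>b. real_polynomial_function (q1 b)" "\<And>b. real_polynomial_function (q2 b)"
    "\<And>y. (f has_derivative (\<lambda>h. \<Sum>b\<in>Basis. (h \<bullet> b) * q1 b y)) (at y)"
    "\<And>y. (g has_derivative (\<lambda>h. \<Sum>b\<in>Basis. (h \<bullet> b) * q2 b y)) (at y)"
    by blast
  show ?case
  proof (intro exI[of _ "\<lambda>b y. f y * q2 b y + q1 b y * g y"] conjI allI)
    show "real_polynomial_function (\<lambda>y. f y * q2 b y + q1 b y * g y)" for b
      by (rule real_polynomial_function.intros(3)[OF
            real_polynomial_function.intros(4)[OF mult.hyps(1) q(2)] real_polynomial_function.intros(4)[OF q(1) mult.hyps(2)]])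
    show "((\<lambda>x. f x * g x) has_derivative (\<lambda>h. \<Sum>b\<in>Basis. (h \<bullet> b) * (f y * q2 b y + q1 b y * g y))) (at y)" for y
      using has_derivative_mult[OF q(3,4), of y]
      by (simp add: distrib_left sum.distrib sum_distrib_left sum_distrib_right mult_ac)
  qed
qed

lemma real_polynomial_function_growth:
  fixes p :: "'a::euclidean_space \<Rightarrow> real"
  assumes "real_polynomial_function p"
  shows "\<exists>C n. 0 \<le> C \<and> (\<forall>y. \<bar>p y\<bar> \<le> C * (1 + norm y) ^ n)"
  using assms
proof induction
  case (linear f)
  then obtain K where K: "0 < K" "\<And>y. norm (f y) \<le> norm y * K"
    using bounded_linear.pos_bounded by blast
  have "\<bar>f y\<bar> \<le> K * (1 + norm y) ^ 1" for y
    using K(2)[of y] K(1) by (simp add: algebra_simps)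
  then show ?case using K(1) less_imp_le by blast
next
  case (const c)
  show ?case by (intro exI[of _ "\<bar>c\<bar>"] exI[of _ 0]) auto
next
  case (add f g)
  then obtain C n D m where *: "0 \<le> C" "0 \<le> D" "\<And>y. \<bar>f y\<bar> \<le> C * (1 + norm y) ^ n" "\<And>y. \<bar>g y\<bar> \<le> D * (1 + norm y) ^ m"
    by blast
  have "\<bar>f y + g y\<bar> \<le> (C + D) * (1 + norm y) ^ (n + m)" for y
  proof -
    have "(1 + norm y) ^ n \<le> (1 + norm y) ^ (n + m)" "(1 + norm y) ^ m \<le> (1 + norm y) ^ (n + m)"
      by (auto intro!: power_increasing)
    then have "C * (1 + norm y) ^ n \<le> C * (1 + norm y) ^ (n + m)" "D * (1 + norm y) ^ m \<le> D * (1 + norm y) ^ (n + m)"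
      using *(1,2) by (auto intro!: mult_left_mono)
    then show ?thesis using *(3,4)[of y] abs_triangle_ineq[of "f y" "g y"] by (simp add: distrib_right)
  qed
  then show ?case using *(1,2) by (intro exI[of _ "C + D"] exI[of _ "n + m"]) auto
next
  case (mult f g)
  then obtain C n D m where *: "0 \<le> C" "0 \<le> D" "\<And>y. \<bar>f y\<bar> \<le> C * (1 + norm y) ^ n" "\<And>y. \<bar>g y\<bar> \<le> D * (1 + norm y) ^ m"
    by blast
  have "\<bar>f y * g y\<bar> \<le> (C * D) * (1 + norm y) ^ (n + m)" for y
  proof -
    have "\<bar>f y\<bar> * \<bar>g y\<bar> \<le> (C * (1 + norm y) ^ n) * (D * (1 + norm y) ^ m)"
      using * by (intro mult_mono) auto
    then show ?thesis by (simp add: abs_mult power_add mult_ac)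
  qed
  then show ?case using *(1,2) by (intro exI[of _ "C * D"] exI[of _ "n + m"]) auto
qed

lemma power_times_gaussian_bounded:
  fixes c :: real
  assumes c: "0 < c"
  shows "\<exists>K. \<forall>y::'a::euclidean_space. (1 + norm y) ^ m * exp (- c * (norm (y - w))\<^sup>2) \<le> K"
proof (intro exI allI)
  fix y :: 'a
  let ?n = "norm y"
  have "?n \<le> norm (y - w) + norm w" using norm_triangle_ineq[of "y - w" w] by simp
  then have "?n\<^sup>2 \<le> (norm (y - w) + norm w)\<^sup>2" by (intro power_mono) auto
  also have "\<dots> \<le> 2 * (norm (y - w))\<^sup>2 + 2 * (norm w)\<^sup>2"
    using sum_squares_bound[of "norm (y - w)" "norm w"] by (simp add: power2_sum)
  finally have 1: "c * ?n\<^sup>2 \<le> c * (2 * (norm (y - w))\<^sup>2 + 2 * (norm w)\<^sup>2)"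
    using c by (intro mult_left_mono) auto
  have "0 \<le> (c * ?n - 1)\<^sup>2" by simp
  then have "0 \<le> ((c * ?n - 1)\<^sup>2) / (2 * c)" using c by simp
  also have "((c * ?n - 1)\<^sup>2) / (2 * c) = c * ?n\<^sup>2 / 2 - ?n + 1 / (2 * c)"
    using c by (simp add: power2_eq_square field_simps)
  finally have 2: "?n \<le> c * ?n\<^sup>2 / 2 + 1 / (2 * c)" by simp
  have "(1 + ?n) ^ m / fact m \<le> exp (1 + ?n)"
  proof -
    have "(\<Sum>k\<in>{m}. inverse (fact k) * (1 + ?n) ^ k) \<le> (\<Sum>k. inverse (fact k) * (1 + ?n) ^ k)"
      by (rule sum_le_suminf[OF summable_exp]) auto
    then show ?thesis by (simp add: exp_def field_simps)
  qed
  then have 3: "(1 + ?n) ^ m \<le> fact m * exp (1 + ?n)" by (simp add: field_simps)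
  have "(1 + ?n) ^ m * exp (- c * (norm (y - w))\<^sup>2) \<le> (fact m * exp (1 + ?n)) * exp (- c * (norm (y - w))\<^sup>2)"
    using 3 by (intro mult_right_mono) auto
  also have "\<dots> = fact m * exp (1 + ?n - c * (norm (y - w))\<^sup>2)" by (simp add: mult_exp_exp)
  also have "\<dots> \<le> fact m * exp (1 + 1 / (2 * c) + c * (norm w)\<^sup>2)"
    using 1 2 by (intro mult_left_mono) (auto simp: algebra_simps)
  finally show "(1 + ?n) ^ m * exp (- c * (norm (y - w))\<^sup>2) \<le> fact m * exp (1 + 1 / (2 * c) + c * (norm w)\<^sup>2)" .
qed

text \<open>Every iterated partial derivative of a Gaussian is a polynomial times that Gaussian. The
  polynomials are obtained recursively along the list of directions from a choice \<open>dp P b\<close> of the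
  factor in the derivative of \<open>P\<close> times the Gaussian in the direction \<open>b\<close>.\<close>

lemma schwartz_gaussian:
  fixes w :: "'a::euclidean_space"
  assumes c: "0 < c"
  shows "schwartz (\<lambda>y. complex_of_real (exp (- c * (norm (y - w))\<^sup>2)))"
proof -
  define G where "G y = exp (- c * (norm (y - w))\<^sup>2)" for y :: 'a
  have dG: "(G has_derivative (\<lambda>h. \<Sum>b\<in>Basis. (h \<bullet> b) * ((- 2 * c * ((y - w) \<bullet> b)) * G y))) (at y)" for y
  proof -
    have "((\<lambda>y. exp (- c * ((y - w) \<bullet> (y - w)))) has_derivative
       (\<lambda>h. exp (- c * ((y - w) \<bullet> (y - w))) * (- c * ((y - w) \<bullet> h + h \<bullet> (y - w))))) (at y)"
      by (auto intro!: derivative_eq_intros)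
    then have "(G has_derivative (\<lambda>h. G y * (- c * ((y - w) \<bullet> h + h \<bullet> (y - w))))) (at y)"
      unfolding G_def power2_norm_eq_inner .
    moreover have "G y * (- c * ((y - w) \<bullet> h + h \<bullet> (y - w))) = (\<Sum>b\<in>Basis. (h \<bullet> b) * ((- 2 * c * ((y - w) \<bullet> b)) * G y))" for h
    proof -
      have "h \<bullet> (y - w) = (\<Sum>b\<in>Basis. (h \<bullet> b) * ((y - w) \<bullet> b))" by (rule euclidean_inner)
      then have "G y * (- c * ((y - w) \<bullet> h + h \<bullet> (y - w))) = (- 2 * c * G y) * (\<Sum>b\<in>Basis. (h \<bullet> b) * ((y - w) \<bullet> b))"
        by (simp add: inner_commute[of "y - w" h])
      then show ?thesis by (simp add: sum_distrib_left mult_ac)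
    qed
    ultimately show ?thesis by (simp only:)
  qed
  have "\<forall>P. \<exists>q. real_polynomial_function P \<longrightarrow> (\<forall>b. real_polynomial_function (q b)) \<and>
     (\<forall>y. ((\<lambda>y. P y * G y) has_derivative (\<lambda>h. \<Sum>b\<in>Basis. (h \<bullet> b) * (q b y * G y))) (at y))"
  proof
    fix P :: "'a \<Rightarrow> real"
    show "\<exists>q. real_polynomial_function P \<longrightarrow> (\<forall>b. real_polynomial_function (q b)) \<and>
     (\<forall>y. ((\<lambda>y. P y * G y) has_derivative (\<lambda>h. \<Sum>b\<in>Basis. (h \<bullet> b) * (q b y * G y))) (at y))"
    proof (cases "real_polynomial_function P")
      case True
      then obtain q where q: "\<And>b. real_polynomial_function (q b)"
        "\<And>y. (P has_derivative (\<lambda>h. \<Sum>b\<in>Basis. (h \<bullet> b) * q b y)) (at y)"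
        using real_polynomial_function_partials by blast
      have lin: "real_polynomial_function (\<lambda>y. - 2 * c * ((y - w) \<bullet> b))" for b
      proof -
        have "real_polynomial_function (\<lambda>y. (- 2 * c) * (y \<bullet> b) + 2 * c * (w \<bullet> b))"
          by (intro real_polynomial_function.intros bounded_linear_inner_left)
        then show ?thesis by (simp add: inner_diff_left algebra_simps)
      qed
      show ?thesis
      proof (intro exI[of _ "\<lambda>b y. P y * (- 2 * c * ((y - w) \<bullet> b)) + q b y"] impI conjI allI)
        show "real_polynomial_function (\<lambda>y. P y * (- 2 * c * ((y - w) \<bullet> b)) + q b y)" for b
          by (rule real_polynomial_function.intros(3)[OF real_polynomial_function.intros(4)[OF True lin] q(1)])
        show "((\<lambda>y. P y * G y) has_derivative (\<lambda>h. \<Sum>b\<in>Basis. (h \<bullet> b) * ((P y * (- 2 * c * ((y - w) \<bullet> b)) + q b y) * G y))) (at y)" for y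
        proof -
          have "P y * (\<Sum>b\<in>Basis. (h \<bullet> b) * ((- 2 * c * ((y - w) \<bullet> b)) * G y)) + (\<Sum>b\<in>Basis. (h \<bullet> b) * q b y) * G y
             = (\<Sum>b\<in>Basis. (h \<bullet> b) * ((P y * (- 2 * c * ((y - w) \<bullet> b)) + q b y) * G y))" for h
            unfolding sum_distrib_left sum_distrib_right sum.distrib[symmetric]
            by (intro sum.cong refl) (simp add: algebra_simps)
          then show ?thesis
            using has_derivative_mult[OF q(2) dG, of y] by (simp only:)
        qed
      qed
    qed simp
  qed
  from choice[OF this] obtain dp where dp0: "\<forall>P. real_polynomial_function P \<longrightarrow> (\<forall>b. real_polynomial_function (dp P b)) \<and>
     (\<forall>y. ((\<lambda>y. P y * G y) has_derivative (\<lambda>h. \<Sum>b\<in>Basis. (h \<bullet> b) * (dp P b y * G y))) (at y))" ..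
  have dp: "real_polynomial_function (dp P b)"
     "((\<lambda>y. P y * G y) has_derivative (\<lambda>h. \<Sum>b\<in>Basis. (h \<bullet> b) * (dp P b y * G y))) (at y)"
    if "real_polynomial_function P" for P b y
    using mp[OF spec[OF dp0] that] by simp_all
  define Q where "Q = rec_list (\<lambda>_. 1) (\<lambda>b bs P. dp P b)"
  have Q: "real_polynomial_function (Q bs)" for bs
    by (induction bs) (auto simp: Q_def intro: dp)
  show ?thesis
    unfolding schwartz_def
  proof (intro exI[of _ "\<lambda>bs y. complex_of_real (Q bs y * G y)"] conjI ballI allI)
    show "(\<lambda>y. complex_of_real (Q [] y * G y)) = (\<lambda>y. complex_of_real (exp (- c * (norm (y - w))\<^sup>2)))"
      by (simp add: Q_def G_def)
    fix bs :: "'a list"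
    show "((\<lambda>y. complex_of_real (Q bs y * G y)) has_derivative
       (\<lambda>h. \<Sum>b\<in>Basis. (h \<bullet> b) *\<^sub>R complex_of_real (Q (b # bs) y * G y))) (at y)" for y
    proof -
      have "((\<lambda>y. complex_of_real (Q bs y * G y)) has_derivative
         (\<lambda>h. complex_of_real (\<Sum>b\<in>Basis. (h \<bullet> b) * (dp (Q bs) b y * G y)))) (at y)"
        by (intro has_derivative_of_real dp Q)
      then show ?thesis by (simp add: Q_def scaleR_conv_of_real)
    qed
    fix k :: nat
    obtain C n where C: "0 \<le> C" "\<And>y. \<bar>Q bs y\<bar> \<le> C * (1 + norm y) ^ n"
      using real_polynomial_function_growth[OF Q] by blast
    obtain K where K: "\<And>y::'a. (1 + norm y) ^ (k + n) * exp (- c * (norm (y - w))\<^sup>2) \<le> K"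
      using power_times_gaussian_bounded[OF c] by blast
    show "bounded (range (\<lambda>y. norm y ^ k *\<^sub>R complex_of_real (Q bs y * G y)))"
    proof (rule boundedI, clarify)
      fix y :: 'a
      have "norm (norm y ^ k *\<^sub>R complex_of_real (Q bs y * G y)) = norm y ^ k * (\<bar>Q bs y\<bar> * G y)"
        by (simp add: norm_mult G_def abs_mult)
      also have "\<dots> \<le> (1 + norm y) ^ k * ((C * (1 + norm y) ^ n) * G y)"
        using C by (intro mult_mono power_mono) (auto simp: G_def)
      also have "\<dots> = C * ((1 + norm y) ^ (k + n) * G y)" by (simp add: power_add mult_ac)
      also have "\<dots> \<le> C * K" using K[of y] C(1) by (intro mult_left_mono) (auto simp: G_def)
      finally show "norm (norm y ^ k *\<^sub>R complex_of_real (Q bs y * G y)) \<le> C * K" .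
    qed
  qed
qed

lemma exp_minus_norm_sq_eq_prod:
  "exp (- c * (norm (z::'a::euclidean_space))\<^sup>2) = (\<Prod>b\<in>Basis. exp (- c * (z \<bullet> b)\<^sup>2))"
proof -
  have "(norm z)\<^sup>2 = (\<Sum>b\<in>Basis. (z \<bullet> b)\<^sup>2)"
    unfolding power2_norm_eq_inner by (subst euclidean_inner) (simp add: power2_eq_square)
  then show ?thesis by (simp add: sum_distrib_left exp_sum)
qed

lemma integrable_gaussian:
  fixes c :: real
  assumes "0 < c"
  shows "integrable lborel (\<lambda>z::'a::euclidean_space. exp (- c * (norm z)\<^sup>2))"
proof (rule integrableI_bounded)
  have one: "(\<integral>\<^sup>+x. ennreal (exp (- c * x\<^sup>2)) \<partial>lborel) < \<infinity>"
  proof -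
    define \<sigma> where "\<sigma> = 1 / sqrt (2 * c)"
    have \<sigma>: "\<sigma> > 0" using assms by (simp add: \<sigma>_def)
    have "\<sigma>\<^sup>2 = 1 / (2 * c)" using assms by (simp add: \<sigma>_def power_divide)
    then have "exp (- c * x\<^sup>2) = sqrt (2 * pi * \<sigma>\<^sup>2) * normal_density 0 \<sigma> x" for x
      using assms \<sigma> by (simp add: normal_density_def)
    then have "integrable lborel (\<lambda>x. exp (- c * x\<^sup>2))"
      using integrable_normal_density[OF \<sigma>, of 0] by simp
    then show ?thesis by (auto simp: integrable_iff_bounded)
  qed
  have "(\<integral>\<^sup>+z. ennreal (norm (exp (- c * (norm (z::'a))\<^sup>2))) \<partial>lborel) =
     (\<integral>\<^sup>+z. (\<Prod>b\<in>Basis. ennreal (exp (- c * ((z::'a) \<bullet> b)\<^sup>2))) \<partial>lborel)"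
    unfolding exp_minus_norm_sq_eq_prod by (intro nn_integral_cong) (simp add: prod_ennreal prod_nonneg)
  also have "\<dots> = (\<Prod>b\<in>(Basis::'a set). (\<integral>\<^sup>+x. ennreal (exp (- c * x\<^sup>2)) \<partial>lborel))"
    by (rule nn_integral_lborel_prod) auto
  also have "\<dots> < \<infinity>" using one by (simp add: power_less_top_ennreal)
  finally show "(\<integral>\<^sup>+z. ennreal (norm (exp (- c * (norm (z::'a))\<^sup>2))) \<partial>lborel) < \<infinity>" .
qed simp

abbreviation wave_character :: "'a::euclidean_space \<Rightarrow> 'a \<Rightarrow> complex" where
  "wave_character \<xi> x \<equiv> exp (- \<i> * complex_of_real (\<xi> \<bullet> x))"

lemma fourier_std_gaussian:
  fixes \<xi> :: "'a::euclidean_space"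
  shows "(LINT z|lborel. wave_character \<xi> z * complex_of_real (exp (- (1/2) * (norm z)\<^sup>2)))
    = complex_of_real (sqrt (2 * pi) ^ DIM('a) * exp (- (1/2) * (norm \<xi>)\<^sup>2))"
proof -
  interpret product_sigma_finite "\<lambda>_::'a. lborel :: real measure" ..
  have ch: "(LINT x|lborel. exp (- \<i> * complex_of_real (t * x)) * complex_of_real (exp (- (1/2) * x\<^sup>2))) =
      complex_of_real (sqrt (2 * pi) * exp (- (1/2) * t\<^sup>2))" for t :: real
  proof -
    have "complex_of_real (exp (- ((- t)\<^sup>2) / 2)) = char std_normal_distribution (- t)"
      by (simp add: char_std_normal_distribution)
    also have "\<dots> = (LINT x|lborel. std_normal_density x *\<^sub>R iexp (- t * x))"
      unfolding char_def by (subst integral_density) (auto simp: normal_density_nonneg)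
    also have "\<dots> = (LINT x|lborel. complex_of_real (1 / sqrt (2 * pi)) * (exp (- \<i> * complex_of_real (t * x)) * complex_of_real (exp (- (1/2) * x\<^sup>2))))"
      by (simp add: std_normal_density_def scaleR_conv_of_real mult_ac)
    finally show ?thesis by (simp add: field_simps)
  qed
  have int: "integrable lborel (\<lambda>x. exp (- \<i> * complex_of_real (t * x)) * complex_of_real (exp (- (1/2) * x\<^sup>2)))" for t :: real
  proof (rule Bochner_Integration.integrable_bound)
    show "integrable lborel (\<lambda>x::real. exp (- (1/2) * (norm x)\<^sup>2))" by (rule integrable_gaussian) simp
  qed (auto simp: norm_mult)
  have "(LINT z|lborel. wave_character \<xi> z * complex_of_real (exp (- (1/2) * (norm (z::'a))\<^sup>2)))
    = (LINT z|lborel. (\<Prod>b\<in>Basis. exp (- \<i> * complex_of_real ((\<xi> \<bullet> b) * (z \<bullet> b))) * complex_of_real (exp (- (1/2) * (z \<bullet> b)\<^sup>2))))"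
  proof (intro Bochner_Integration.integral_cong refl)
    fix z :: 'a
    have "wave_character \<xi> z = (\<Prod>b\<in>Basis. exp (- \<i> * complex_of_real ((\<xi> \<bullet> b) * (z \<bullet> b))))"
      unfolding euclidean_inner[of \<xi> z] by (simp add: sum_distrib_left exp_sum)
    then show "wave_character \<xi> z * complex_of_real (exp (- (1/2) * (norm z)\<^sup>2)) =
      (\<Prod>b\<in>Basis. exp (- \<i> * complex_of_real ((\<xi> \<bullet> b) * (z \<bullet> b))) * complex_of_real (exp (- (1/2) * (z \<bullet> b)\<^sup>2)))"
      unfolding exp_minus_norm_sq_eq_prod prod.distrib by simp
  qed
  also have "\<dots> = (LINT y|(\<Pi>\<^sub>M b\<in>(Basis::'a set). lborel). (\<Prod>b\<in>Basis.
      exp (- \<i> * complex_of_real ((\<xi> \<bullet> b) * y b)) * complex_of_real (exp (- (1/2) * (y b)\<^sup>2))))"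
    by (subst lborel_eq, subst integral_distr) (auto intro!: Bochner_Integration.integral_cong prod.cong)
  also have "\<dots> = (\<Prod>b\<in>Basis. (LINT x|lborel. exp (- \<i> * complex_of_real ((\<xi> \<bullet> b) * x)) * complex_of_real (exp (- (1/2) * x\<^sup>2))))"
    by (rule product_integral_prod[where f="\<lambda>b x. exp (- \<i> * complex_of_real ((\<xi> \<bullet> b) * x)) * complex_of_real (exp (- (1/2) * x\<^sup>2))"])
       (simp_all only: finite_Basis int)
  also have "\<dots> = (\<Prod>b\<in>Basis. complex_of_real (sqrt (2 * pi) * exp (- (1/2) * (\<xi> \<bullet> b)\<^sup>2)))"
    unfolding ch ..
  also have "\<dots> = complex_of_real (sqrt (2 * pi) ^ DIM('a) * exp (- (1/2) * (norm \<xi>)\<^sup>2))"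
    unfolding exp_minus_norm_sq_eq_prod by (simp add: prod.distrib)
  finally show ?thesis .
qed

lemma lborel_integral_affine:
  fixes g :: "'a::euclidean_space \<Rightarrow> 'b::{banach, second_countable_topology}"
  assumes g[measurable]: "g \<in> borel_measurable borel" and c: "c \<noteq> 0"
  shows "(LINT x|lborel. g x) = \<bar>c\<bar> ^ DIM('a) *\<^sub>R (LINT z|lborel. g (t + c *\<^sub>R z))"
proof -
  have "(LINT x|lborel. g x) = (LINT x|density (distr lborel borel (\<lambda>x. t + c *\<^sub>R x)) (\<lambda>_. \<bar>c\<bar>^DIM('a)). g x)"
    using lborel_affine[OF c, of t] by (rule arg_cong[where f="\<lambda>M. integral\<^sup>L M g"])
  also have "\<dots> = (LINT x|distr lborel borel (\<lambda>x. t + c *\<^sub>R x). \<bar>c\<bar>^DIM('a) *\<^sub>R g x)"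
    by (rule integral_density) auto
  also have "\<dots> = (LINT z|lborel. \<bar>c\<bar>^DIM('a) *\<^sub>R g (t + c *\<^sub>R z))"
    by (rule integral_distr) auto
  finally show ?thesis by simp
qed

lemma lborel_integral_shift:
  fixes g :: "'a::euclidean_space \<Rightarrow> 'b::{banach, second_countable_topology}"
  assumes "g \<in> borel_measurable borel"
  shows "(LINT x|lborel. g x) = (LINT z|lborel. g (z + t))"
  using lborel_integral_affine[OF assms, of 1 t] by (simp add: add.commute)

lemma lborel_integrable_shift:
  fixes g :: "'a::euclidean_space \<Rightarrow> 'b::{banach, second_countable_topology}"
  assumes "integrable lborel g"
  shows "integrable lborel (\<lambda>z. g (z + t))"
proof -
  have [measurable]: "g \<in> borel_measurable borel" using borel_measurable_integrable[OF assms] by simp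
  have "integrable (distr lborel borel ((+) t)) g" using assms by (simp add: lborel_distr_plus)
  then have "integrable lborel (\<lambda>z. g (t + z))" by (subst (asm) integrable_distr_eq) auto
  then show ?thesis by (simp add: add.commute)
qed

lemma (in pair_sigma_finite) integrable_tensor:
  fixes f g :: "_ \<Rightarrow> real"
  assumes f: "integrable M1 f" and g: "integrable M2 g"
  shows "integrable (M1 \<Otimes>\<^sub>M M2) (\<lambda>(x, y). f x * g y)"
proof -
  have [measurable]: "f \<in> borel_measurable M1" "g \<in> borel_measurable M2" using f g by auto
  show ?thesis
    by (rule Fubini_integrable) (use f g in \<open>auto simp: abs_mult\<close>)
qed

text \<open>Outside the unit ball the spectral density is at most \<open>1\<close>; inside, the spectral measure is
  finite by polar coordinates.\<close>

lemma integrable_gaussian_spectral: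
  fixes c \<beta> :: real
  assumes c: "0 < c" and \<beta>: "0 < \<beta>" "\<beta> < real DIM('a)"
  shows "integrable (spectral_measure \<beta>) (\<lambda>\<xi>::'a::euclidean_space. exp (- c * (norm \<xi>)\<^sup>2))"
proof (rule integrableI_bounded)
  have "(\<integral>\<^sup>+\<xi>. ennreal (norm (exp (- c * (norm \<xi>)\<^sup>2))) \<partial>(spectral_measure \<beta> :: 'a measure))
     = (\<integral>\<^sup>+\<xi>. ennreal (norm \<xi> powr (\<beta> - real DIM('a))) * ennreal (exp (- c * (norm \<xi>)\<^sup>2)) \<partial>(lborel :: 'a measure))"
    unfolding spectral_measure_def by (subst nn_integral_density) auto
  also have "\<dots> \<le> (\<integral>\<^sup>+\<xi>. ennreal (norm \<xi> powr (\<beta> - real DIM('a))) * indicator {0..1} (norm \<xi>) + ennreal (exp (- c * (norm \<xi>)\<^sup>2)) \<partial>(lborel :: 'a measure))"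
  proof (rule nn_integral_mono)
    fix \<xi> :: 'a
    show "ennreal (norm \<xi> powr (\<beta> - real DIM('a))) * ennreal (exp (- c * (norm \<xi>)\<^sup>2))
      \<le> ennreal (norm \<xi> powr (\<beta> - real DIM('a))) * indicator {0..1} (norm \<xi>) + ennreal (exp (- c * (norm \<xi>)\<^sup>2))"
    proof (cases "norm \<xi> \<le> 1")
      case True
      have "ennreal (norm \<xi> powr (\<beta> - real DIM('a))) * ennreal (exp (- c * (norm \<xi>)\<^sup>2)) \<le> ennreal (norm \<xi> powr (\<beta> - real DIM('a))) * 1"
        using c by (intro mult_left_mono) (auto simp: ennreal_le_1)
      with True show ?thesis by (simp add: add_increasing2)
    next
      case False
      then have "norm \<xi> powr (\<beta> - real DIM('a)) \<le> 1"
        using \<beta> powr_mono2'[of "\<beta> - real DIM('a)" 1 "norm \<xi>"] by simp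
      then have "ennreal (norm \<xi> powr (\<beta> - real DIM('a))) * ennreal (exp (- c * (norm \<xi>)\<^sup>2)) \<le> 1 * ennreal (exp (- c * (norm \<xi>)\<^sup>2))"
        by (intro mult_right_mono) (auto simp: ennreal_le_1)
      then show ?thesis by (simp add: add_increasing)
    qed
  qed
  also have "\<dots> = (\<integral>\<^sup>+\<xi>. ennreal (norm \<xi> powr (\<beta> - real DIM('a))) * indicator {0..1} (norm \<xi>) \<partial>(lborel :: 'a measure))
      + (\<integral>\<^sup>+\<xi>. ennreal (exp (- c * (norm \<xi>)\<^sup>2)) \<partial>(lborel :: 'a measure))"
    by (intro nn_integral_add) auto
  also have "(\<integral>\<^sup>+\<xi>. ennreal (norm \<xi> powr (\<beta> - real DIM('a))) * indicator {0..1} (norm \<xi>) \<partial>(lborel :: 'a measure))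
    = (\<integral>\<^sup>+\<xi>. indicator {0..1} (norm \<xi>) \<partial>(spectral_measure \<beta> :: 'a measure))"
    unfolding spectral_measure_def by (intro nn_integral_density[symmetric]) auto
  also have "\<dots> = ennreal (real DIM('a) * unit_ball_vol DIM('a)) *
      (\<integral>\<^sup>+k. ennreal (k powr (\<beta> - 1)) * indicator {0..1} k * indicator {0..} k \<partial>lborel)"
    by (intro nn_integral_spectral_radial) auto
  also have "(\<integral>\<^sup>+k. ennreal (k powr (\<beta> - 1)) * indicator {0..1} k * indicator {0..} k \<partial>lborel) =
     (\<integral>\<^sup>+k. ennreal (k powr (\<beta> - 1)) * indicator {0..1} k \<partial>lborel)"
    by (intro nn_integral_cong) (auto simp: indicator_def)
  also have "\<dots> = ennreal (1 powr \<beta> / \<beta>)"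
    using \<beta> by (intro nn_integral_powr_from_0) auto
  also have "ennreal (real DIM('a) * unit_ball_vol DIM('a)) * ennreal (1 powr \<beta> / \<beta>) + (\<integral>\<^sup>+\<xi>. ennreal (exp (- c * (norm \<xi>)\<^sup>2)) \<partial>(lborel :: 'a measure)) < \<infinity>"
    using integrable_gaussian[OF c, where 'a='a] by (auto simp: integrable_iff_bounded ennreal_mult_less_top)
  finally show "(\<integral>\<^sup>+\<xi>. ennreal (norm (exp (- c * (norm \<xi>)\<^sup>2))) \<partial>(spectral_measure \<beta> :: 'a measure)) < \<infinity>" .
qed (auto simp: spectral_measure_def)

section \<open>Parseval identity for the Riesz kernel\<close>

lemma sigma_finite_spectral_measure: "sigma_finite_measure (spectral_measure \<beta> :: 'a::euclidean_space measure)"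
  unfolding spectral_measure_def
  by (subst sigma_finite_measure.sigma_finite_iff_density_finite[OF lborel.sigma_finite_measure_axioms]) auto

lemma sets_spectral_measure [measurable_cong, simp]: "sets (spectral_measure \<beta>) = sets borel"
  by (simp add: spectral_measure_def)

lemma space_spectral_measure [simp]: "space (spectral_measure \<beta>) = UNIV"
  by (simp add: spectral_measure_def)

lemma borel_measurable_complex_exp [measurable]: "(exp :: complex \<Rightarrow> complex) \<in> borel_measurable borel"
  by (intro borel_measurable_continuous_onI continuous_on_exp continuous_on_id)

lemma fourier_measurable [measurable]:
  assumes [measurable]: "\<phi> \<in> borel_measurable borel"
  shows "fourier \<phi> \<in> borel_measurable borel"
  unfolding fourier_def by measurable

lemma integrable_cball_indicator: "integrable lborel (indicator (cball (c::'a::euclidean_space) R) :: 'a \<Rightarrow> real)"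
  by (intro integrable_real_indicator emeasure_bounded_finite bounded_cball) simp

lemma riesz_kernel_measurable: "riesz_kernel \<beta> f \<Longrightarrow> f \<in> borel_measurable borel"
  by (simp add: riesz_kernel_def)

lemma riesz_kernel_gaussian_integrable:
  fixes f :: "'a::euclidean_space \<Rightarrow> real"
  assumes "riesz_kernel \<beta> f" and "0 < c"
  shows "integrable lborel (\<lambda>u. \<bar>f u\<bar> * exp (- c * (norm (u - w))\<^sup>2))"
proof -
  have "integrable lborel (\<lambda>u. complex_of_real (f u) * complex_of_real (exp (- c * (norm (u - w))\<^sup>2)))"
    using assms schwartz_gaussian[of c w] unfolding riesz_kernel_def by blast
  from integrable_norm[OF this] show ?thesis by (simp add: norm_mult)
qed

text \<open>Testing \<open>f\<close> against a Gaussian centred at \<open>w\<close> with standard deviation \<open>e\<close>. The Gaussians are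
  not normalised; the Jacobian of the substitution appears on both sides and cancels.\<close>

lemma riesz_kernel_mollified:
  fixes f :: "'a::euclidean_space \<Rightarrow> real"
  assumes f: "riesz_kernel \<beta> f" and e: "0 < e"
  shows "complex_of_real (LINT z|lborel. f (w + e *\<^sub>R z) * exp (- (1/2) * (norm z)\<^sup>2)) =
    (LINT \<xi>|spectral_measure \<beta>. wave_character \<xi> w *
       complex_of_real (sqrt (2 * pi) ^ DIM('a) * exp (- (e\<^sup>2 / 2) * (norm \<xi>)\<^sup>2)))"
proof -
  note [measurable] = riesz_kernel_measurable[OF f]
  define c where "c = 1 / (2 * e\<^sup>2)"
  have c: "c > 0" using e by (simp add: c_def)
  have ce: "- c * (norm (w + e *\<^sub>R z - w))\<^sup>2 = - (1/2) * (norm z)\<^sup>2" for z :: 'a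
    using e by (simp add: c_def power_mult_distrib)
  let ?\<phi> = "\<lambda>x. complex_of_real (exp (- c * (norm (x - w))\<^sup>2))"
  let ?n = "DIM('a)"
  have "(LINT x|lborel. complex_of_real (f x) * ?\<phi> x) = (LINT \<xi>|spectral_measure \<beta>. fourier ?\<phi> \<xi>)"
    using f schwartz_gaussian[OF c, of w] unfolding riesz_kernel_def by blast
  moreover have "(LINT x|lborel. complex_of_real (f x) * ?\<phi> x) = complex_of_real (e ^ ?n * (LINT z|lborel. f (w + e *\<^sub>R z) * exp (- (1/2) * (norm z)\<^sup>2)))"
  proof -
    have "(LINT x|lborel. complex_of_real (f x) * ?\<phi> x) = (LINT x|lborel. complex_of_real (f x * exp (- c * (norm (x - w))\<^sup>2)))"
      by simp
    also have "\<dots> = complex_of_real (LINT x|lborel. f x * exp (- c * (norm (x - w))\<^sup>2))"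
      by (rule integral_complex_of_real)
    also have "(LINT x|lborel. f x * exp (- c * (norm (x - w))\<^sup>2)) = \<bar>e\<bar> ^ ?n *\<^sub>R (LINT z|lborel. f (w + e *\<^sub>R z) * exp (- c * (norm (w + e *\<^sub>R z - w))\<^sup>2))"
      using e by (intro lborel_integral_affine) auto
    finally show ?thesis unfolding ce using e by simp
  qed
  moreover have "fourier ?\<phi> \<xi> = complex_of_real (e ^ ?n) * (wave_character \<xi> w *
       complex_of_real (sqrt (2 * pi) ^ ?n * exp (- (e\<^sup>2 / 2) * (norm \<xi>)\<^sup>2)))" for \<xi> :: 'a
  proof -
    have "fourier ?\<phi> \<xi> = \<bar>e\<bar> ^ ?n *\<^sub>R (LINT z|lborel. exp (- \<i> * complex_of_real (\<xi> \<bullet> (w + e *\<^sub>R z))) * ?\<phi> (w + e *\<^sub>R z))"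
      unfolding fourier_def using e by (intro lborel_integral_affine) auto
    also have "(LINT z|lborel. exp (- \<i> * complex_of_real (\<xi> \<bullet> (w + e *\<^sub>R z))) * ?\<phi> (w + e *\<^sub>R z))
      = (LINT z|lborel. wave_character \<xi> w * (exp (- \<i> * complex_of_real ((e *\<^sub>R \<xi>) \<bullet> z)) * complex_of_real (exp (- (1/2) * (norm z)\<^sup>2))))"
    proof (intro Bochner_Integration.integral_cong refl)
      fix z :: 'a
      have "exp (- \<i> * complex_of_real (\<xi> \<bullet> (w + e *\<^sub>R z))) = wave_character \<xi> w * exp (- \<i> * complex_of_real ((e *\<^sub>R \<xi>) \<bullet> z))"
        by (simp add: inner_add_right exp_add[symmetric] algebra_simps)
      then show "exp (- \<i> * complex_of_real (\<xi> \<bullet> (w + e *\<^sub>R z))) * ?\<phi> (w + e *\<^sub>R z) =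
        wave_character \<xi> w * (exp (- \<i> * complex_of_real ((e *\<^sub>R \<xi>) \<bullet> z)) * complex_of_real (exp (- (1/2) * (norm z)\<^sup>2)))"
        unfolding ce by (simp only: mult.assoc)
    qed
    also have "\<dots> = wave_character \<xi> w * complex_of_real (sqrt (2 * pi) ^ ?n * exp (- (1/2) * (norm (e *\<^sub>R \<xi>))\<^sup>2))"
      unfolding integral_mult_right_zero fourier_std_gaussian ..
    also have "- (1/2) * (norm (e *\<^sub>R \<xi>))\<^sup>2 = - (e\<^sup>2 / 2) * (norm \<xi>)\<^sup>2"
      by (simp add: power_mult_distrib)
    finally show ?thesis using e by (simp add: scaleR_conv_of_real)
  qed
  ultimately have "complex_of_real (e ^ ?n) * complex_of_real (LINT z|lborel. f (w + e *\<^sub>R z) * exp (- (1/2) * (norm z)\<^sup>2)) =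
    complex_of_real (e ^ ?n) * (LINT \<xi>|spectral_measure \<beta>. wave_character \<xi> w *
       complex_of_real (sqrt (2 * pi) ^ ?n * exp (- (e\<^sup>2 / 2) * (norm \<xi>)\<^sup>2)))"
    by (simp only: of_real_mult integral_mult_right_zero)
  then show ?thesis using e by simp
qed

text \<open>For a continuous function \<open>h\<close> with compact support, average the mollified identity over \<open>w\<close>
  with weight \<open>h\<close> and exchange integrals. On the spectral side this is the Fourier transform of \<open>h\<close>
  damped by a Gaussian that flattens out. On the other side \<open>f\<close> is integrated against a mollification
  of \<open>h\<close>, which converges to \<open>h\<close> under a Gaussian majorant, and \<open>f\<close> is integrable against
  Gaussians.\<close>

lemma riesz_kernel_smoothed_pairing:
  fixes f h :: "'a::euclidean_space \<Rightarrow> real"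
  assumes f: "riesz_kernel \<beta> f" and \<beta>: "0 < \<beta>" "\<beta> < real DIM('a)"
    and cont: "continuous_on UNIV h" and R: "0 \<le> R" and C: "0 \<le> C"
    and hb: "\<And>w. \<bar>h w\<bar> \<le> C * indicator (cball 0 R) w"
  shows "(\<lambda>n. LINT \<xi>|spectral_measure \<beta>. complex_of_real (exp (- ((inverse (real (Suc n)))\<^sup>2 / 2) * (norm \<xi>)\<^sup>2)) *
       fourier (\<lambda>w. complex_of_real (h w)) \<xi>) \<longlonglongrightarrow> complex_of_real (LINT w|lborel. f w * h w)"
proof -
  note [measurable] = riesz_kernel_measurable[OF f]
  have [measurable]: "h \<in> borel_measurable borel" using cont by (rule borel_measurable_continuous_onI)
  let ?\<mu> = "spectral_measure \<beta> :: 'a measure"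
  define K where "K = sqrt (2 * pi) ^ DIM('a)"
  have K: "K > 0" by (simp add: K_def)
  define g where "g z = exp (- (1/2) * (norm z)\<^sup>2)" for z :: 'a
  have [measurable]: "g \<in> borel_measurable borel" unfolding g_def by measurable
  have g0: "g z \<ge> 0" for z by (simp add: g_def)
  have K_int: "(LINT z|lborel. g z) = K"
  proof -
    have "complex_of_real (LINT z|lborel. g z) = complex_of_real K"
      using fourier_std_gaussian[of "0::'a"] unfolding g_def K_def integral_complex_of_real[symmetric] by simp
    then show ?thesis by (simp only: of_real_eq_iff)
  qed
  define S where "S z u e = f u * h (u - e *\<^sub>R z) * g z" for z u :: 'a and e :: real
  have [measurable]: "(\<lambda>(z, u). S z u e) \<in> borel_measurable (borel \<Otimes>\<^sub>M borel)" for e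
    unfolding S_def by measurable
  (* The majorant rests on norm u <= R + norm z whenever h (u - e z) is nonzero and e <= 1: the
     decay in z of the Gaussian pays for decay in both variables. *)
  define dom where "dom z u = (C * exp (R\<^sup>2 / 8)) * (exp (- (3/8) * (norm z)\<^sup>2) * (\<bar>f u\<bar> * exp (- (1/16) * (norm u)\<^sup>2)))" for z u :: 'a
  have dom_int: "integrable (lborel \<Otimes>\<^sub>M lborel) (\<lambda>(z, u). dom z u)"
  proof -
    have "integrable (lborel \<Otimes>\<^sub>M lborel) (\<lambda>(z::'a, u). exp (- (3/8) * (norm z)\<^sup>2) * (\<bar>f u\<bar> * exp (- (1/16) * (norm u)\<^sup>2)))"
      using riesz_kernel_gaussian_integrable[OF f, of "1/16" 0]
      by (intro lborel_pair.integrable_tensor integrable_gaussian) auto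
    from integrable_mult_right[OF this, of "C * exp (R\<^sup>2 / 8)"] show ?thesis
      by (simp add: dom_def case_prod_beta')
  qed
  have S_dom: "\<bar>S z u e\<bar> \<le> dom z u" if e: "0 \<le> e" "e \<le> 1" for z u e
  proof (cases "norm (u - e *\<^sub>R z) \<le> R")
    case True
    have "norm u \<le> norm (u - e *\<^sub>R z) + norm (e *\<^sub>R z)" using norm_triangle_ineq[of "u - e *\<^sub>R z" "e *\<^sub>R z"] by simp
    also have "\<dots> \<le> R + norm z"
      using True e by (intro add_mono) (auto simp: mult_left_le_one_le)
    finally have "(norm u)\<^sup>2 \<le> (R + norm z)\<^sup>2" by (intro power_mono) auto
    also have "\<dots> \<le> 2 * R\<^sup>2 + 2 * (norm z)\<^sup>2"
      using sum_squares_bound[of R "norm z"] by (simp add: power2_sum)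
    finally have "0 \<le> R\<^sup>2 / 8 + (norm z)\<^sup>2 / 8 + (- (1/16) * (norm u)\<^sup>2)" by simp
    then have "1 \<le> exp (R\<^sup>2 / 8 + (norm z)\<^sup>2 / 8 + (- (1/16) * (norm u)\<^sup>2))" by simp
    then have "g z * 1 \<le> g z * exp (R\<^sup>2 / 8 + (norm z)\<^sup>2 / 8 + (- (1/16) * (norm u)\<^sup>2))"
      by (intro mult_left_mono g0)
    also have "\<dots> = exp (R\<^sup>2 / 8) * (exp (- (3/8) * (norm z)\<^sup>2) * exp (- (1/16) * (norm u)\<^sup>2))"
      by (simp add: g_def mult_exp_exp)
    finally have gz: "g z \<le> exp (R\<^sup>2 / 8) * (exp (- (3/8) * (norm z)\<^sup>2) * exp (- (1/16) * (norm u)\<^sup>2))" by simp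
    have "\<bar>h (u - e *\<^sub>R z)\<bar> \<le> C" using hb[of "u - e *\<^sub>R z"] True by simp
    then have "\<bar>f u\<bar> * \<bar>h (u - e *\<^sub>R z)\<bar> * g z \<le> \<bar>f u\<bar> * C * (exp (R\<^sup>2 / 8) * (exp (- (3/8) * (norm z)\<^sup>2) * exp (- (1/16) * (norm u)\<^sup>2)))"
      using gz g0 C by (intro mult_mono) auto
    then show ?thesis by (simp add: S_def dom_def abs_mult g0 mult_ac)
  next
    case False
    then have "h (u - e *\<^sub>R z) = 0" using hb[of "u - e *\<^sub>R z"] by simp
    then show ?thesis using C by (simp add: S_def dom_def)
  qed
  have S_int: "integrable (lborel \<Otimes>\<^sub>M lborel) (\<lambda>(z, u). S z u e)" if e: "0 \<le> e" "e \<le> 1" for e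
  proof (rule Bochner_Integration.integrable_bound[OF dom_int])
    show "AE x in lborel \<Otimes>\<^sub>M lborel. norm (case x of (z, u) \<Rightarrow> S z u e) \<le> norm (case x of (z, u) \<Rightarrow> dom z u)"
    proof (rule AE_I2, clarify)
      show "norm (S z u e) \<le> norm (dom z u)" for z u
        using S_dom[OF e, of z u] by simp
    qed
  qed measurable
  have f_gauss: "integrable lborel (\<lambda>u. \<bar>f u\<bar> * exp (- (1/16) * (norm u)\<^sup>2))"
    using riesz_kernel_gaussian_integrable[OF f, of "1/16" 0] by simp
  have S_int_u: "integrable lborel (\<lambda>u. S z u e)" if e: "0 \<le> e" "e \<le> 1" for z e
  proof (rule Bochner_Integration.integrable_bound)
    show "integrable lborel (\<lambda>u. dom z u)" unfolding dom_def using f_gauss by (intro integrable_mult_right)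
    show "AE u in lborel. norm (S z u e) \<le> norm (dom z u)"
    proof (rule AE_I2)
      show "norm (S z u e) \<le> norm (dom z u)" for u
        using S_dom[OF e, of z u] by simp
    qed
  qed measurable
  define e where "e n = inverse (real (Suc n))" for n
  have e: "0 < e n" "0 \<le> e n" "e n \<le> 1" for n by (auto simp: e_def field_simps)
  have e0: "e \<longlonglongrightarrow> 0" unfolding e_def by (rule LIMSEQ_inverse_real_of_nat)
  have lim: "(\<lambda>n. LINT (z, u)|(lborel \<Otimes>\<^sub>M lborel). S z u (e n)) \<longlonglongrightarrow> (LINT (z, u)|(lborel \<Otimes>\<^sub>M lborel). S z u 0)"
  proof (rule integral_dominated_convergence[where w="\<lambda>(z, u). dom z u"])
    show "AE x in lborel \<Otimes>\<^sub>M lborel. (\<lambda>n. case x of (z, u) \<Rightarrow> S z u (e n)) \<longlonglongrightarrow> (case x of (z, u) \<Rightarrow> S z u 0)"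
    proof (rule AE_I2, clarify)
      fix z u :: 'a
      have "(\<lambda>n. u - e n *\<^sub>R z) \<longlonglongrightarrow> u - 0 *\<^sub>R z" by (intro tendsto_intros e0)
      moreover have "isCont h (u - 0 *\<^sub>R z)" using cont by (simp add: continuous_on_eq_continuous_at)
      ultimately have "(\<lambda>n. h (u - e n *\<^sub>R z)) \<longlonglongrightarrow> h (u - 0 *\<^sub>R z)" by (rule isCont_tendsto_compose[rotated])
      then show "(\<lambda>n. S z u (e n)) \<longlonglongrightarrow> S z u 0" unfolding S_def by (intro tendsto_intros)
    qed
    show "AE x in lborel \<Otimes>\<^sub>M lborel. norm (case x of (z, u) \<Rightarrow> S z u (e n)) \<le> (case x of (z, u) \<Rightarrow> dom z u)" for n
      using S_dom e by (intro AE_I2) auto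
  qed (use dom_int in auto)
  have "(LINT (z, u)|(lborel \<Otimes>\<^sub>M lborel). S z u 0) = (LINT z|lborel. LINT u|lborel. S z u 0)"
    by (rule lborel_pair.integral_fst[OF S_int, symmetric]) auto
  also have "\<dots> = (LINT w|lborel. f w * h w) * K"
    by (simp add: S_def K_int[symmetric])
  finally have lim0: "(LINT (z, u)|(lborel \<Otimes>\<^sub>M lborel). S z u 0) = (LINT w|lborel. f w * h w) * K" .
  have eq: "complex_of_real (LINT (z, u)|(lborel \<Otimes>\<^sub>M lborel). S z u (e n)) =
    complex_of_real K * (LINT \<xi>|?\<mu>. complex_of_real (exp (- ((e n)\<^sup>2 / 2) * (norm \<xi>)\<^sup>2)) * fourier (\<lambda>w. complex_of_real (h w)) \<xi>)" for n
  proof -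
    let ?e = "e n"
    (* L is S after the translation u = w + e z, which leaves the integral over u unchanged for
       each z. *)
    define L where "L z w = f (w + ?e *\<^sub>R z) * h w * g z" for z w :: 'a
    have [measurable]: "(\<lambda>(z, w). L z w) \<in> borel_measurable (borel \<Otimes>\<^sub>M borel)" unfolding L_def by measurable
    have LS: "L z w = S z (w + ?e *\<^sub>R z) ?e" for z w by (simp add: L_def S_def)
    have L_int: "integrable (lborel \<Otimes>\<^sub>M lborel) (\<lambda>(z, w). L z w)"
    proof (rule lborel_pair.Fubini_integrable)
      show "AE z in lborel. integrable lborel (\<lambda>w. case (z, w) of (z, w) \<Rightarrow> L z w)"
        unfolding LS using e by (auto intro!: lborel_integrable_shift S_int_u)
      have "integrable lborel (\<lambda>z. LINT u|lborel. norm (S z u ?e))"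
        using lborel_pair.integrable_fst[of "\<lambda>z u. norm (S z u ?e)"] integrable_norm[OF S_int[OF e(2,3), of n]]
        by (simp add: case_prod_beta')
      moreover have "(LINT u|lborel. norm (S z u ?e)) = (LINT w|lborel. norm (L z w))" for z
        unfolding LS by (intro lborel_integral_shift) measurable
      ultimately show "integrable lborel (\<lambda>z. LINT w|lborel. norm (case (z, w) of (z, w) \<Rightarrow> L z w))" by simp
    qed measurable
    have "(LINT (z, u)|(lborel \<Otimes>\<^sub>M lborel). S z u ?e) = (LINT z|lborel. LINT u|lborel. S z u ?e)"
      by (rule lborel_pair.integral_fst[OF S_int, symmetric]) (use e in auto)
    also have "\<dots> = (LINT z|lborel. LINT w|lborel. L z w)"
      unfolding LS by (intro Bochner_Integration.integral_cong refl lborel_integral_shift) measurable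
    also have "\<dots> = (LINT w|lborel. LINT z|lborel. L z w)"
      by (rule lborel_pair.Fubini_integral[OF L_int, symmetric])
    also have "complex_of_real \<dots> = (LINT w|lborel. complex_of_real (h w) * complex_of_real (LINT z|lborel. f (w + ?e *\<^sub>R z) * g z))"
    proof -
      have "(LINT z|lborel. L z w) = h w * (LINT z|lborel. f (w + ?e *\<^sub>R z) * g z)" for w
        unfolding L_def integral_mult_right_zero[symmetric] by (simp add: mult_ac)
      then show ?thesis by (simp only: integral_complex_of_real[symmetric] of_real_mult)
    qed
    also have "\<dots> = (LINT w|lborel. LINT \<xi>|?\<mu>. complex_of_real (h w) * (wave_character \<xi> w *
         complex_of_real (K * exp (- (?e\<^sup>2 / 2) * (norm \<xi>)\<^sup>2))))"
      unfolding g_def K_def riesz_kernel_mollified[OF f e(1)] integral_mult_right_zero ..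
    also have "\<dots> = (LINT \<xi>|?\<mu>. LINT w|lborel. complex_of_real (h w) * (wave_character \<xi> w *
         complex_of_real (K * exp (- (?e\<^sup>2 / 2) * (norm \<xi>)\<^sup>2))))"
    proof -
      interpret mu: sigma_finite_measure ?\<mu> by (rule sigma_finite_spectral_measure)
      interpret P: pair_sigma_finite ?\<mu> "lborel :: 'a measure" ..
      have "integrable (?\<mu> \<Otimes>\<^sub>M lborel) (\<lambda>(\<xi>, w). (K * exp (- (?e\<^sup>2 / 2) * (norm \<xi>)\<^sup>2)) * (C * indicator (cball 0 R) (w::'a)))"
      proof (rule P.integrable_tensor)
        show "integrable ?\<mu> (\<lambda>\<xi>. K * exp (- (?e\<^sup>2 / 2) * (norm \<xi>)\<^sup>2))"
          using e(1)[of n] by (intro integrable_mult_right integrable_gaussian_spectral \<beta>) auto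
        show "integrable lborel (\<lambda>w::'a. C * indicator (cball 0 R) w)"
          by (intro integrable_mult_right integrable_cball_indicator)
      qed
      then have "integrable (?\<mu> \<Otimes>\<^sub>M lborel) (\<lambda>(\<xi>, w). complex_of_real (h w) * (wave_character \<xi> w *
         complex_of_real (K * exp (- (?e\<^sup>2 / 2) * (norm \<xi>)\<^sup>2))))"
      proof (rule Bochner_Integration.integrable_bound)
        show "AE x in ?\<mu> \<Otimes>\<^sub>M lborel. norm (case x of (\<xi>, w) \<Rightarrow> complex_of_real (h w) * (wave_character \<xi> w *
         complex_of_real (K * exp (- (?e\<^sup>2 / 2) * (norm \<xi>)\<^sup>2)))) \<le> norm (case x of (\<xi>, w) \<Rightarrow> (K * exp (- (?e\<^sup>2 / 2) * (norm \<xi>)\<^sup>2)) * (C * indicator (cball 0 R) (w::'a)))"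
        proof (rule AE_I2, clarify)
          fix \<xi> w :: 'a
          have "\<bar>h w\<bar> * (K * exp (- (?e\<^sup>2 / 2) * (norm \<xi>)\<^sup>2)) \<le> (C * indicator (cball 0 R) w) * (K * exp (- (?e\<^sup>2 / 2) * (norm \<xi>)\<^sup>2))"
            using hb K by (intro mult_right_mono) auto
          then show "norm (complex_of_real (h w) * (wave_character \<xi> w *
         complex_of_real (K * exp (- (?e\<^sup>2 / 2) * (norm \<xi>)\<^sup>2)))) \<le> norm ((K * exp (- (?e\<^sup>2 / 2) * (norm \<xi>)\<^sup>2)) * (C * indicator (cball 0 R) w))"
            using K C by (simp add: norm_mult mult_ac)
        qed
      qed measurable
      from P.Fubini_integral[OF this] show ?thesis .
    qed
    also have "\<dots> = (LINT \<xi>|?\<mu>. complex_of_real K * (complex_of_real (exp (- (?e\<^sup>2 / 2) * (norm \<xi>)\<^sup>2)) * fourier (\<lambda>w. complex_of_real (h w)) \<xi>))"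
      unfolding fourier_def integral_mult_right_zero[symmetric] of_real_mult by (simp only: mult_ac)
    also have "\<dots> = complex_of_real K * (LINT \<xi>|?\<mu>. complex_of_real (exp (- (?e\<^sup>2 / 2) * (norm \<xi>)\<^sup>2)) * fourier (\<lambda>w. complex_of_real (h w)) \<xi>)"
      by (rule integral_mult_right_zero)
    finally show ?thesis .
  qed
  have "(\<lambda>n. complex_of_real (LINT (z, u)|(lborel \<Otimes>\<^sub>M lborel). S z u (e n)) / complex_of_real K) \<longlonglongrightarrow>
      complex_of_real ((LINT w|lborel. f w * h w) * K) / complex_of_real K"
    using lim K unfolding lim0 by (intro tendsto_intros) auto
  then show ?thesis unfolding eq using K by (simp add: e_def)
qed

text \<open>The convolution of the indicator of \<open>A\<close> with that of \<open>- B\<close>. It carries the double integral of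
  \<open>f (x - y)\<close> over \<open>A \<times> B\<close> and, unlike the indicators, is continuous.\<close>

definition overlap :: "'a::euclidean_space set \<Rightarrow> 'a set \<Rightarrow> 'a \<Rightarrow> real" where
  "overlap A B w = (LINT x|lborel. indicator A x * indicator B (x - w))"

lemma bounded_borelD:
  assumes "bounded_borel A"
  shows "A \<in> sets borel" "emeasure lborel A < \<infinity>" "integrable lborel (indicator A :: 'a::euclidean_space \<Rightarrow> real)"
proof -
  show A: "A \<in> sets borel" using assms by (simp add: bounded_borel_def)
  show fin: "emeasure lborel A < \<infinity>" using assms emeasure_bounded_finite[of A] by (simp add: bounded_borel_def)
  show "integrable lborel (indicator A :: 'a \<Rightarrow> real)" using A fin by (intro integrable_real_indicator) auto
qed

lemma overlap_integrable:
  assumes "bounded_borel A" and [measurable]: "B \<in> sets borel"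
  shows "integrable lborel (\<lambda>x. indicator A x * indicator B (x - w) :: real)"
proof (rule Bochner_Integration.integrable_bound[OF bounded_borelD(3)[OF assms(1)]])
  have [measurable]: "A \<in> sets borel" using assms by (simp add: bounded_borelD)
  show "(\<lambda>x. indicator A x * indicator B (x - w) :: real) \<in> borel_measurable lborel" by measurable
qed (auto simp: indicator_def)

text \<open>For an open set \<open>U\<close> in place of \<open>B\<close> this is Fatou's lemma, and outer regularity provides an
  open \<open>U\<close> around \<open>B\<close> for which the two overlaps differ by at most \<open>e/2\<close>, uniformly in the
  translation.\<close>

lemma overlap_lower_semicontinuous:
  assumes A: "bounded_borel A" and B[measurable]: "B \<in> sets borel" and u: "u \<longlonglongrightarrow> w" and e: "0 < e"
  shows "eventually (\<lambda>n. overlap A B w - e < overlap A B (u n)) sequentially"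
proof -
  have [measurable]: "A \<in> sets borel" using A by (simp add: bounded_borelD)
  obtain U where U: "open U" "B \<subseteq> U" "emeasure lborel (U - B) < ennreal (e / 2)"
    using outer_regular_lborel[OF B, of "e / 2"] e by auto
  have [measurable]: "U \<in> sets borel" using U by simp
  have near: "overlap A U v \<le> overlap A B v + e / 2" for v
  proof -
    have fin: "emeasure lborel (U - B) < \<infinity>" using U(3) by (rule order.strict_trans) simp
    have iUB: "integrable lborel (\<lambda>x. indicator (U - B) (x - v) :: real)"
      using lborel_integrable_shift[OF integrable_real_indicator[OF _ fin], of "- v"] by simp
    have "overlap A U v \<le> (LINT x|lborel. indicator A x * indicator B (x - v) + indicator (U - B) (x - v))"
      unfolding overlap_def using U(2)
      by (intro integral_mono overlap_integrable A Bochner_Integration.integrable_add iUB) (auto simp: indicator_def)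
    also have "\<dots> = overlap A B v + (LINT x|lborel. indicator (U - B) (x - v))"
      unfolding overlap_def by (intro Bochner_Integration.integral_add overlap_integrable A iUB) auto
    also have "(LINT x|lborel. indicator (U - B) (x - v)) = measure lborel (U - B)"
      using lborel_integral_shift[of "indicator (U - B) :: 'a \<Rightarrow> real" "- v"] by simp
    also have "\<dots> \<le> e / 2"
      unfolding measure_def using U(3) e by (intro enn2real_leI) auto
    finally show ?thesis by simp
  qed
  have ov: "ennreal (overlap A U v) = (\<integral>\<^sup>+x. indicator A x * indicator U (x - v) \<partial>lborel)" for v
  proof -
    have "ennreal (overlap A U v) = (\<integral>\<^sup>+x. ennreal (indicator A x * indicator U (x - v)) \<partial>lborel)"
      unfolding overlap_def by (intro nn_integral_eq_integral[symmetric] overlap_integrable A) auto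
    also have "\<dots> = (\<integral>\<^sup>+x. indicator A x * indicator U (x - v) \<partial>lborel)"
      by (intro nn_integral_cong) (auto simp: indicator_def)
    finally show ?thesis .
  qed
  have "ennreal (overlap A U w) \<le> (\<integral>\<^sup>+x. liminf (\<lambda>n. indicator A x * indicator U (x - u n)) \<partial>lborel)"
    unfolding ov
  proof (rule nn_integral_mono)
    fix x
    show "indicator A x * indicator U (x - w) \<le> liminf (\<lambda>n. indicator A x * indicator U (x - u n) :: ennreal)"
    proof (cases "x - w \<in> U")
      case True
      have "(\<lambda>n. x - u n) \<longlonglongrightarrow> x - w" by (intro tendsto_intros u)
      then have "eventually (\<lambda>n. x - u n \<in> U) sequentially" by (rule topological_tendstoD[OF _ U(1) True])
      then have "eventually (\<lambda>n. indicator A x * indicator U (x - w) \<le> (indicator A x * indicator U (x - u n) :: ennreal)) sequentially"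
        by eventually_elim (use True in auto)
      then show ?thesis by (rule Liminf_bounded)
    qed simp
  qed
  also have "\<dots> \<le> liminf (\<lambda>n. ennreal (overlap A U (u n)))"
    unfolding ov by (rule nn_integral_liminf) measurable
  finally have lim: "ennreal (overlap A U w) \<le> liminf (\<lambda>n. ennreal (overlap A U (u n)))" .
  have ov0: "0 \<le> overlap A X v" for X v unfolding overlap_def by (intro integral_nonneg_AE) auto
  have ev: "eventually (\<lambda>n. overlap A U w - e / 2 < overlap A U (u n)) sequentially"
  proof (cases "overlap A U w - e / 2 < 0")
    case True
    then show ?thesis using ov0[of U] by (intro always_eventually allI) (meson less_le_trans)
  next
    case False
    then have "ennreal (overlap A U w - e / 2) < ennreal (overlap A U w)"
      using e by (intro ennreal_lessI) auto
    with lim have "ennreal (overlap A U w - e / 2) < liminf (\<lambda>n. ennreal (overlap A U (u n)))" by simp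
    from less_LiminfD[OF this] show ?thesis
      by eventually_elim (use False ov0 in \<open>auto simp: ennreal_less_iff\<close>)
  qed
  have le: "overlap A B w \<le> overlap A U w"
    unfolding overlap_def using U(2)
    by (intro integral_mono overlap_integrable A) (auto simp: indicator_def)
  from ev show ?thesis
  proof eventually_elim
    case (elim n)
    then show ?case using near[of "u n"] le by linarith
  qed
qed

text \<open>Upper semicontinuity is lower semicontinuity for the complement of \<open>B\<close>.\<close>

lemma overlap_continuous:
  assumes A: "bounded_borel A" and B[measurable]: "B \<in> sets borel"
  shows "continuous_on UNIV (overlap A B)"
proof -
  have [measurable]: "A \<in> sets borel" using A by (simp add: bounded_borelD)
  have compl: "overlap A (- B) v = measure lborel A - overlap A B v" for v
  proof -
    have "overlap A (- B) v = (LINT x|lborel. indicator A x - indicator A x * indicator B (x - v))"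
      unfolding overlap_def by (intro Bochner_Integration.integral_cong) (auto simp: indicator_def)
    also have "\<dots> = (LINT x|lborel. indicator A x) - overlap A B v"
      unfolding overlap_def by (intro Bochner_Integration.integral_diff overlap_integrable A bounded_borelD(3) B)
    finally show ?thesis by simp
  qed
  have "isCont (overlap A B) w" for w
  proof (rule continuous_at_sequentiallyI)
    fix u assume u: "u \<longlonglongrightarrow> w"
    show "(\<lambda>n. overlap A B (u n)) \<longlonglongrightarrow> overlap A B w"
    proof (rule tendstoI)
      fix e :: real assume e: "0 < e"
      have "eventually (\<lambda>n. overlap A B w - e < overlap A B (u n)) sequentially"
        by (rule overlap_lower_semicontinuous[OF A B u e])
      moreover have "eventually (\<lambda>n. overlap A (- B) w - e < overlap A (- B) (u n)) sequentially"
        by (rule overlap_lower_semicontinuous[OF A _ u e]) measurable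
      ultimately show "eventually (\<lambda>n. dist (overlap A B (u n)) (overlap A B w) < e) sequentially"
        unfolding compl by eventually_elim (auto simp: dist_real_def)
    qed
  qed
  then show ?thesis by (simp add: continuous_on_eq_continuous_at)
qed

lemma bounded_borel_subset_cball:
  assumes "bounded_borel A"
  obtains r where "0 \<le> r" "A \<subseteq> cball 0 r"
proof -
  obtain r where "\<forall>x\<in>A. norm x \<le> r"
    using assms unfolding bounded_borel_def bounded_iff by blast
  then have "A \<subseteq> cball 0 r" by auto
  also have "cball 0 r \<subseteq> cball 0 (max 0 r)" by (intro subset_cball) simp
  finally show ?thesis by (intro that[of "max 0 r"]) simp_all
qed

text \<open>Substitute \<open>y = x - w\<close> and integrate over \<open>x\<close> first.\<close>

lemma double_integral_overlap:
  fixes g :: "'a::euclidean_space \<Rightarrow> 'b::{banach, second_countable_topology}"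
  assumes A: "bounded_borel A" and B: "bounded_borel B" and [measurable]: "g \<in> borel_measurable borel"
    and loc: "\<And>R. integrable lborel (\<lambda>w. indicator (cball 0 R) w * norm (g w))"
  shows "(LINT x:A|lborel. LINT y:B|lborel. g (x - y)) = (LINT w|lborel. overlap A B w *\<^sub>R g w)"
proof -
  have [measurable]: "A \<in> sets borel" "B \<in> sets borel" using A B by (simp_all add: bounded_borelD)
  obtain r1 r2 where r: "A \<subseteq> cball 0 r1" "B \<subseteq> cball 0 r2"
    using A B by (meson bounded_borel_subset_cball)
  define k where "k x w = indicator A x *\<^sub>R (indicator B (x - w) *\<^sub>R g w)" for x w
  have [measurable]: "case_prod k \<in> borel_measurable (borel \<Otimes>\<^sub>M borel)" unfolding k_def by measurable
  have k_int: "integrable (lborel \<Otimes>\<^sub>M lborel) (case_prod k)"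
  proof (rule Bochner_Integration.integrable_bound)
    show "integrable (lborel \<Otimes>\<^sub>M lborel) (\<lambda>(x, w). indicator A x * (indicator (cball 0 (r1 + r2)) w * norm (g w)))"
      by (intro lborel_pair.integrable_tensor bounded_borelD(3) A loc)
    show "AE p in lborel \<Otimes>\<^sub>M lborel. norm (case_prod k p) \<le> norm (case p of (x, w) \<Rightarrow> indicator A x * (indicator (cball 0 (r1 + r2)) w * norm (g w)))"
    proof (rule AE_I2, clarify)
      fix x w
      show "norm (k x w) \<le> norm (indicator A x * (indicator (cball 0 (r1 + r2)) w * norm (g w)))"
      proof (cases "x \<in> A \<and> x - w \<in> B")
        case True
        then have "norm x \<le> r1" "norm (x - w) \<le> r2" using r by auto
        then have "norm w \<le> r1 + r2" using norm_triangle_ineq4[of x "x - w"] by simp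
        then show ?thesis using True by (simp add: k_def)
      qed (auto simp: k_def)
    qed
  qed measurable
  have "(LINT x:A|lborel. LINT y:B|lborel. g (x - y)) = (LINT x|lborel. LINT w|lborel. k x w)"
  proof -
    have "indicator A x *\<^sub>R (LINT y|lborel. indicator B y *\<^sub>R g (x - y)) = (LINT w|lborel. k x w)" for x
    proof -
      have "(LINT y|lborel. indicator B y *\<^sub>R g (x - y)) =
        \<bar>-1\<bar> ^ DIM('a) *\<^sub>R (LINT w|lborel. indicator B (x + (-1) *\<^sub>R w) *\<^sub>R g (x - (x + (-1) *\<^sub>R w)))"
        by (intro lborel_integral_affine) auto
      moreover have "(LINT w|lborel. k x w) = indicator A x *\<^sub>R (LINT w|lborel. indicator B (x - w) *\<^sub>R g w)"
        unfolding k_def by (rule integral_scaleR_right)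
      ultimately show ?thesis by simp
    qed
    then show ?thesis by (simp only: set_lebesgue_integral_def)
  qed
  also have "\<dots> = (LINT w|lborel. LINT x|lborel. k x w)"
    by (rule lborel_pair.Fubini_integral[OF k_int, symmetric])
  also have "\<dots> = (LINT w|lborel. overlap A B w *\<^sub>R g w)"
  proof -
    have "(LINT x|lborel. k x w) = overlap A B w *\<^sub>R g w" for w
    proof -
      have "(LINT x|lborel. k x w) = (LINT x|lborel. (indicator A x * indicator B (x - w)) *\<^sub>R g w)"
        unfolding k_def by (simp add: scaleR_scaleR)
      also have "\<dots> = overlap A B w *\<^sub>R g w"
        unfolding overlap_def using overlap_integrable[OF A, of B w] by (intro integral_scaleR_left) auto
      finally show ?thesis .
    qed
    then show ?thesis by simp
  qed
  finally show ?thesis .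
qed

abbreviation indicator_hat :: "'a::euclidean_space set \<Rightarrow> 'a \<Rightarrow> complex" where
  "indicator_hat A \<equiv> fourier (\<lambda>x. complex_of_real (indicator A x))"

lemma fourier_overlap:
  assumes A: "bounded_borel A" and B: "bounded_borel B"
  shows "fourier (\<lambda>w. complex_of_real (overlap A B w)) \<xi> = indicator_hat A \<xi> * cnj (indicator_hat B \<xi>)"
proof -
  let ?g = "\<lambda>w. wave_character \<xi> w"
  have ng: "norm (?g w) = 1" for w by (simp)
  have "fourier (\<lambda>w. complex_of_real (overlap A B w)) \<xi> = (LINT w|lborel. overlap A B w *\<^sub>R ?g w)"
    unfolding fourier_def by (simp add: scaleR_conv_of_real mult.commute)
  also have "\<dots> = (LINT x:A|lborel. LINT y:B|lborel. ?g (x - y))"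
  proof (rule double_integral_overlap[OF A B, symmetric])
    show "integrable lborel (\<lambda>w::'a. indicator (cball 0 R) w * norm (?g w))" for R
      unfolding ng using integrable_cball_indicator[of "0::'a" R] by simp
  qed measurable
  also have "\<dots> = (LINT x|lborel. (?g x * complex_of_real (indicator A x)) * (LINT y|lborel. cnj (?g y * complex_of_real (indicator B y))))"
  proof -
    have g: "?g (x - y) = ?g x * cnj (?g y)" for x y
    proof -
      have "cnj (?g y) = exp (\<i> * complex_of_real (\<xi> \<bullet> y))" by (simp add: exp_cnj)
      then show ?thesis by (simp add: inner_diff_right exp_add[symmetric] algebra_simps)
    qed
    have "indicator A x *\<^sub>R (LINT y|lborel. indicator B y *\<^sub>R ?g (x - y)) =
       (?g x * complex_of_real (indicator A x)) * (LINT y|lborel. cnj (?g y * complex_of_real (indicator B y)))" for x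
    proof -
      have "indicator B y *\<^sub>R ?g (x - y) = ?g x * cnj (?g y * complex_of_real (indicator B y))" for y
        unfolding g scaleR_conv_of_real complex_cnj_mult complex_cnj_complex_of_real by (simp only: mult_ac)
      then have "(LINT y|lborel. indicator B y *\<^sub>R ?g (x - y)) = ?g x * (LINT y|lborel. cnj (?g y * complex_of_real (indicator B y)))"
        by (simp only: integral_mult_right_zero)
      then show ?thesis by (simp only: scaleR_conv_of_real mult_ac)
    qed
    then show ?thesis unfolding set_lebesgue_integral_def by (simp only:)
  qed
  also have "\<dots> = indicator_hat A \<xi> * cnj (indicator_hat B \<xi>)"
  proof -
    have "(LINT y|lborel. cnj (?g y * complex_of_real (indicator B y))) = cnj (indicator_hat B \<xi>)"
      unfolding fourier_def by (rule integral_bounded_linear'[OF bounded_linear_cnj bounded_linear_cnj]) simp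
    then show ?thesis
      unfolding integral_mult_left_zero by (simp only: fourier_def)
  qed
  finally show ?thesis .
qed

lemma overlap_bound:
  assumes A: "bounded_borel A" and B: "bounded_borel B"
  obtains R C where "0 \<le> R" "0 \<le> C" "\<And>w. \<bar>overlap A B w\<bar> \<le> C * indicator (cball 0 R) w"
proof -
  have [measurable]: "A \<in> sets borel" "B \<in> sets borel" using A B by (simp_all add: bounded_borelD)
  obtain r1 where r1: "0 \<le> r1" "A \<subseteq> cball 0 r1" using A by (rule bounded_borel_subset_cball)
  obtain r2 where r2: "0 \<le> r2" "B \<subseteq> cball 0 r2" using B by (rule bounded_borel_subset_cball)
  show ?thesis
  proof
    show "0 \<le> r1 + r2" using r1 r2 by simp
    show "0 \<le> measure lborel A" by simp
    fix w
    show "\<bar>overlap A B w\<bar> \<le> measure lborel A * indicator (cball 0 (r1 + r2)) w"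
    proof (cases "norm w \<le> r1 + r2")
      case True
      have "0 \<le> overlap A B w" unfolding overlap_def by (intro integral_nonneg_AE) auto
      moreover have "overlap A B w \<le> (LINT x|lborel. indicator A x)"
        unfolding overlap_def by (intro integral_mono overlap_integrable A bounded_borelD(3)) (auto simp: indicator_def)
      ultimately show ?thesis using True by simp
    next
      case False
      have "indicator A x * indicator B (x - w) = (0::real)" for x :: 'a
      proof (rule ccontr)
        assume "indicator A x * indicator B (x - w) \<noteq> (0::real)"
        then have "norm x \<le> r1" "norm (x - w) \<le> r2" using r1 r2 by (auto simp: indicator_def split: if_splits)
        then show False using False norm_triangle_ineq4[of x "x - w"] by simp
      qed
      then have "overlap A B w = (LINT x|(lborel :: 'a measure). 0)"
        unfolding overlap_def by (intro Bochner_Integration.integral_cong) auto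
      then show ?thesis using False by simp
    qed
  qed
qed

text \<open>The smoothed pairing is applied to the overlap of \<open>A\<close> and \<open>B\<close>, whose transform is the product
  in question. For \<open>A = B\<close> this product is nonnegative and Fatou's lemma gives its integrability; in
  general it is dominated by the squares, and the Gaussian damping can be removed by dominated
  convergence.\<close>

lemma riesz_kernel_parseval:
  fixes f :: "'a::euclidean_space \<Rightarrow> real"
  assumes f: "riesz_kernel \<beta> f" and \<beta>: "0 < \<beta>" "\<beta> < real DIM('a)"
    and A: "bounded_borel A" and B: "bounded_borel B"
  shows "integrable (spectral_measure \<beta>) (\<lambda>\<xi>. indicator_hat A \<xi> * cnj (indicator_hat B \<xi>))"
    and "(LINT \<xi>|spectral_measure \<beta>. indicator_hat A \<xi> * cnj (indicator_hat B \<xi>)) =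
      complex_of_real (LINT x:A|lborel. LINT y:B|lborel. f (x - y))"
proof -
  note [measurable] = riesz_kernel_measurable[OF f]
  let ?\<mu> = "spectral_measure \<beta> :: 'a measure"
  define q where "q n \<xi> = exp (- ((inverse (real (Suc n)))\<^sup>2 / 2) * (norm \<xi>)\<^sup>2)" for n and \<xi> :: 'a
  have [measurable]: "q n \<in> borel_measurable borel" for n unfolding q_def by measurable
  have q: "0 \<le> q n \<xi>" "q n \<xi> \<le> 1" for n \<xi> by (auto simp: q_def)
  have q_lim: "(\<lambda>n. q n \<xi>) \<longlonglongrightarrow> 1" for \<xi>
  proof -
    have "(\<lambda>n. q n \<xi>) \<longlonglongrightarrow> exp (- (0\<^sup>2 / 2) * (norm \<xi>)\<^sup>2)"
      unfolding q_def by (intro tendsto_intros LIMSEQ_inverse_real_of_nat) auto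
    then show ?thesis by simp
  qed
  have lim: "(\<lambda>n. LINT \<xi>|?\<mu>. complex_of_real (q n \<xi>) * (indicator_hat A \<xi> * cnj (indicator_hat B \<xi>)))
      \<longlonglongrightarrow> complex_of_real (LINT w|lborel. f w * overlap A B w)"
    if A: "bounded_borel A" and B: "bounded_borel B" for A B :: "'a set"
  proof -
    obtain R C where RC: "0 \<le> R" "0 \<le> C" "\<And>w. \<bar>overlap A B w\<bar> \<le> C * indicator (cball 0 R) w"
      using overlap_bound[OF A B] by blast
    show ?thesis
      using riesz_kernel_smoothed_pairing[OF f \<beta> overlap_continuous[OF A bounded_borelD(1)[OF B]] RC]
      unfolding fourier_overlap[OF A B] q_def .
  qed
  have meas: "indicator_hat A \<in> borel_measurable borel" if "bounded_borel A" for A :: "'a set"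
  proof -
    have [measurable]: "A \<in> sets borel" using that by (rule bounded_borelD(1))
    show ?thesis by measurable
  qed
  have hat_bound: "\<exists>D. \<forall>\<xi>. norm (indicator_hat A \<xi>) \<le> D" if A: "bounded_borel A" for A :: "'a set"
  proof (intro exI allI)
    fix \<xi>
    have "norm (indicator_hat A \<xi>) \<le> (LINT x|lborel. norm (wave_character \<xi> x * complex_of_real (indicator A x)))"
      unfolding fourier_def by (rule integral_norm_bound)
    also have "\<dots> = (LINT x|lborel. indicator A x)" by (simp add: norm_mult)
    finally show "norm (indicator_hat A \<xi>) \<le> (LINT x|lborel. indicator A x)" .
  qed
  have sq: "integrable ?\<mu> (\<lambda>\<xi>. (norm (indicator_hat A \<xi>))\<^sup>2)" if A: "bounded_borel A" for A :: "'a set"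
  proof (rule integrableI_bounded)
    note [measurable] = meas[OF A]
    obtain D where D: "\<And>\<xi>. norm (indicator_hat A \<xi>) \<le> D" using hat_bound[OF A] by blast
    have D0: "D \<ge> 0" using D[of 0] norm_ge_zero order_trans by blast
    define s where "s n = (LINT \<xi>|?\<mu>. q n \<xi> * (norm (indicator_hat A \<xi>))\<^sup>2)" for n
    have q_int: "integrable ?\<mu> (\<lambda>\<xi>. q n \<xi> * (norm (indicator_hat A \<xi>))\<^sup>2)" for n
    proof (rule Bochner_Integration.integrable_bound)
      show "integrable ?\<mu> (\<lambda>\<xi>. D\<^sup>2 * q n \<xi>)"
        unfolding q_def by (intro integrable_mult_right integrable_gaussian_spectral \<beta>) auto
      show "AE \<xi> in ?\<mu>. norm (q n \<xi> * (norm (indicator_hat A \<xi>))\<^sup>2) \<le> norm (D\<^sup>2 * q n \<xi>)"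
        using D D0 q by (intro AE_I2) (auto simp: abs_mult mult.commute[of "q _ _"] intro!: mult_right_mono power_mono)
    qed measurable
    have "complex_of_real (s n) = (LINT \<xi>|?\<mu>. complex_of_real (q n \<xi>) * (indicator_hat A \<xi> * cnj (indicator_hat A \<xi>)))" for n
      unfolding s_def integral_complex_of_real[symmetric] complex_norm_square[symmetric] of_real_mult ..
    with lim[OF A A] have "(\<lambda>n. complex_of_real (s n)) \<longlonglongrightarrow> complex_of_real (LINT w|lborel. f w * overlap A A w)"
      by simp
    then have s_lim: "s \<longlonglongrightarrow> (LINT w|lborel. f w * overlap A A w)"
      by (simp only: tendsto_of_real_iff)
    have "(\<integral>\<^sup>+\<xi>. ennreal (norm ((norm (indicator_hat A \<xi>))\<^sup>2)) \<partial>?\<mu>) =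
       (\<integral>\<^sup>+\<xi>. liminf (\<lambda>n. ennreal (q n \<xi> * (norm (indicator_hat A \<xi>))\<^sup>2)) \<partial>?\<mu>)"
    proof (rule nn_integral_cong)
      fix \<xi>
      have "(\<lambda>n. q n \<xi> * (norm (indicator_hat A \<xi>))\<^sup>2) \<longlonglongrightarrow> 1 * (norm (indicator_hat A \<xi>))\<^sup>2"
        by (intro tendsto_intros q_lim)
      then have "(\<lambda>n. ennreal (q n \<xi> * (norm (indicator_hat A \<xi>))\<^sup>2)) \<longlonglongrightarrow> ennreal ((norm (indicator_hat A \<xi>))\<^sup>2)"
        by (intro tendsto_ennrealI) simp
      from lim_imp_Liminf[OF _ this] show "ennreal (norm ((norm (indicator_hat A \<xi>))\<^sup>2)) = liminf (\<lambda>n. ennreal (q n \<xi> * (norm (indicator_hat A \<xi>))\<^sup>2))"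
        by simp
    qed
    also have "\<dots> \<le> liminf (\<lambda>n. \<integral>\<^sup>+\<xi>. ennreal (q n \<xi> * (norm (indicator_hat A \<xi>))\<^sup>2) \<partial>?\<mu>)"
      by (rule nn_integral_liminf) measurable
    also have "(\<lambda>n. \<integral>\<^sup>+\<xi>. ennreal (q n \<xi> * (norm (indicator_hat A \<xi>))\<^sup>2) \<partial>?\<mu>) = (\<lambda>n. ennreal (s n))"
      unfolding s_def using q_int q by (intro ext nn_integral_eq_integral) auto
    also have "liminf (\<lambda>n. ennreal (s n)) = ennreal (LINT w|lborel. f w * overlap A A w)"
      by (intro lim_imp_Liminf tendsto_ennrealI s_lim) simp
    finally show "(\<integral>\<^sup>+\<xi>. ennreal (norm ((norm (indicator_hat A \<xi>))\<^sup>2)) \<partial>?\<mu>) < \<infinity>"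
      by (rule order_le_less_trans) simp
  qed (use meas[OF A] in measurable)
  note [measurable] = meas[OF A] meas[OF B]
  define d where "d \<xi> = ((norm (indicator_hat A \<xi>))\<^sup>2 + (norm (indicator_hat B \<xi>))\<^sup>2) / 2" for \<xi>
  have d_int: "integrable ?\<mu> d"
    unfolding d_def using sq[OF A] sq[OF B] by simp
  have prod_le: "norm (indicator_hat A \<xi> * cnj (indicator_hat B \<xi>)) \<le> d \<xi>" for \<xi>
    using sum_squares_bound[of "norm (indicator_hat A \<xi>)" "norm (indicator_hat B \<xi>)"]
    by (simp add: norm_mult d_def)
  show int: "integrable ?\<mu> (\<lambda>\<xi>. indicator_hat A \<xi> * cnj (indicator_hat B \<xi>))"
  proof (rule Bochner_Integration.integrable_bound[OF d_int])
    show "AE \<xi> in ?\<mu>. norm (indicator_hat A \<xi> * cnj (indicator_hat B \<xi>)) \<le> norm (d \<xi>)"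
      using prod_le by (intro AE_I2) (metis abs_ge_self order_trans real_norm_def)
  qed measurable
  have "(\<lambda>n. LINT \<xi>|?\<mu>. complex_of_real (q n \<xi>) * (indicator_hat A \<xi> * cnj (indicator_hat B \<xi>)))
      \<longlonglongrightarrow> (LINT \<xi>|?\<mu>. indicator_hat A \<xi> * cnj (indicator_hat B \<xi>))"
  proof (rule integral_dominated_convergence[where w=d])
    show "AE \<xi> in ?\<mu>. (\<lambda>n. complex_of_real (q n \<xi>) * (indicator_hat A \<xi> * cnj (indicator_hat B \<xi>))) \<longlonglongrightarrow> indicator_hat A \<xi> * cnj (indicator_hat B \<xi>)"
    proof (rule AE_I2)
      fix \<xi>
      have "(\<lambda>n. complex_of_real (q n \<xi>) * (indicator_hat A \<xi> * cnj (indicator_hat B \<xi>))) \<longlonglongrightarrow> complex_of_real 1 * (indicator_hat A \<xi> * cnj (indicator_hat B \<xi>))"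
        by (intro tendsto_intros q_lim)
      then show "(\<lambda>n. complex_of_real (q n \<xi>) * (indicator_hat A \<xi> * cnj (indicator_hat B \<xi>))) \<longlonglongrightarrow> indicator_hat A \<xi> * cnj (indicator_hat B \<xi>)" by simp
    qed
    show "AE \<xi> in ?\<mu>. norm (complex_of_real (q n \<xi>) * (indicator_hat A \<xi> * cnj (indicator_hat B \<xi>))) \<le> d \<xi>" for n
    proof (rule AE_I2)
      fix \<xi>
      have "norm (complex_of_real (q n \<xi>) * (indicator_hat A \<xi> * cnj (indicator_hat B \<xi>))) \<le> 1 * d \<xi>"
        unfolding norm_mult[of "complex_of_real _"] using q prod_le by (intro mult_mono) auto
      then show "norm (complex_of_real (q n \<xi>) * (indicator_hat A \<xi> * cnj (indicator_hat B \<xi>))) \<le> d \<xi>" by simp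
    qed
  qed (use d_int in measurable)
  from LIMSEQ_unique[OF this lim[OF A B]]
  have "(LINT \<xi>|?\<mu>. indicator_hat A \<xi> * cnj (indicator_hat B \<xi>)) = complex_of_real (LINT w|lborel. f w * overlap A B w)" .
  also have "(LINT w|lborel. f w * overlap A B w) = (LINT x:A|lborel. LINT y:B|lborel. f (x - y))"
  proof -
    have "(LINT x:A|lborel. LINT y:B|lborel. f (x - y)) = (LINT w|lborel. overlap A B w *\<^sub>R f w)"
    proof (rule double_integral_overlap[OF A B])
      fix R :: real
      have [measurable]: "cball (0::'a) R \<in> sets borel" by simp
      have "integrable lborel (\<lambda>u. exp (R\<^sup>2) * (\<bar>f u\<bar> * exp (- 1 * (norm (u - 0))\<^sup>2)))"
        by (intro integrable_mult_right riesz_kernel_gaussian_integrable[OF f]) auto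
      then show "integrable lborel (\<lambda>w. indicator (cball 0 R) w * norm (f w))"
      proof (rule Bochner_Integration.integrable_bound)
        show "AE w in lborel. norm (indicator (cball 0 R) w * norm (f w)) \<le> norm (exp (R\<^sup>2) * (\<bar>f w\<bar> * exp (- 1 * (norm (w - 0))\<^sup>2)))"
        proof (rule AE_I2)
          fix w :: 'a
          show "norm (indicator (cball 0 R) w * norm (f w)) \<le> norm (exp (R\<^sup>2) * (\<bar>f w\<bar> * exp (- 1 * (norm (w - 0))\<^sup>2)))"
          proof (cases "norm w \<le> R")
            case True
            then have "(norm w)\<^sup>2 \<le> R\<^sup>2" by (intro power_mono) auto
            then have "1 \<le> exp (R\<^sup>2 + - (norm w)\<^sup>2)" by simp
            then have "\<bar>f w\<bar> * 1 \<le> \<bar>f w\<bar> * (exp (R\<^sup>2) * exp (- (norm w)\<^sup>2))"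
              unfolding exp_add[symmetric] by (intro mult_left_mono) auto
            then show ?thesis using True by (simp add: abs_mult mult_ac)
          qed simp
        qed
      qed measurable
    qed measurable
    then show ?thesis by (simp add: mult.commute)
  qed
  finally show "(LINT \<xi>|?\<mu>. indicator_hat A \<xi> * cnj (indicator_hat B \<xi>)) = complex_of_real (LINT x:A|lborel. LINT y:B|lborel. f (x - y))" .
qed

section \<open>The isometry on step functions\<close>

lemma hp_time_form_eq_riesz_form:
  assumes "\<And>r. r < 0 \<Longrightarrow> \<Phi> r \<xi> = 0" "\<And>r. r < 0 \<Longrightarrow> \<Psi> r \<xi> = 0"
  shows "hp_time_form H \<Phi> \<Psi> \<xi> = riesz_form (2 * H - 1) (\<lambda>r. \<Phi> r \<xi>) (\<lambda>r. \<Psi> r \<xi>)"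
proof -
  have 1: "indicator {0..} r *\<^sub>R (\<Phi> r \<xi> * cnj (\<Psi> v \<xi>) * complex_of_real (\<bar>r - v\<bar> powr (2 * H - 2))) =
     \<Phi> r \<xi> * cnj (\<Psi> v \<xi>) * complex_of_real (\<bar>r - v\<bar> powr (2 * H - 2))" for r v
    using assms(1)[of r] by (cases "r < 0") auto
  have 2: "indicator {0..} v *\<^sub>R (LINT r|lborel. \<Phi> r \<xi> * cnj (\<Psi> v \<xi>) * complex_of_real (\<bar>r - v\<bar> powr (2 * H - 2))) =
     (LINT r|lborel. \<Phi> r \<xi> * cnj (\<Psi> v \<xi>) * complex_of_real (\<bar>r - v\<bar> powr (2 * H - 2)))" for v
    using assms(2)[of v] by (cases "v < 0") auto
  have "2 * H - 2 = (2 * H - 1) - 1" by simp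
  then show ?thesis
    unfolding hp_time_form_def set_lebesgue_integral_def riesz_form_def 1 2 by (simp only:)
qed

lemma tame_sum: "finite I \<Longrightarrow> (\<And>i. i \<in> I \<Longrightarrow> tame (\<phi> i)) \<Longrightarrow> tame (\<lambda>r. \<Sum>i\<in>I. \<phi> i r)"
  by (induction I rule: finite_induct) (auto intro: tame_zero tame_add)

lemma riesz_form_sum_left:
  assumes "0 < a" "finite I" "\<And>i. i \<in> I \<Longrightarrow> tame (\<phi> i)" "tame \<psi>"
  shows "riesz_form a (\<lambda>r. \<Sum>i\<in>I. \<phi> i r) \<psi> = (\<Sum>i\<in>I. riesz_form a (\<phi> i) \<psi>)"
  using assms(2,3)
proof (induction I rule: finite_induct)
  case empty
  then show ?case by (simp add: riesz_form_def)
next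
  case (insert i I)
  then show ?case using assms(1,4) by (simp add: riesz_form_add_left tame_sum)
qed

lemma riesz_form_sum_right:
  assumes "0 < a" "finite I" "\<And>i. i \<in> I \<Longrightarrow> tame (\<phi> i)" "tame \<psi>"
  shows "riesz_form a \<psi> (\<lambda>r. \<Sum>i\<in>I. \<phi> i r) = (\<Sum>i\<in>I. riesz_form a \<psi> (\<phi> i))"
  using assms(2,3)
proof (induction I rule: finite_induct)
  case empty
  then show ?case by (simp add: riesz_form_def)
next
  case (insert i I)
  then show ?case using assms(1,4) by (simp add: riesz_form_add_right tame_sum)
qed

lemma riesz_form_indicators:
  assumes a: "0 < a" "a < 1" and st: "0 \<le> s" "0 \<le> t"
  shows "riesz_form a (\<lambda>r. complex_of_real (indicator {0..t} r)) (\<lambda>r. complex_of_real (indicator {0..s} r)) =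
    complex_of_real ((t powr (a + 1) + s powr (a + 1) - \<bar>t - s\<bar> powr (a + 1)) / (a * (a + 1)))"
proof -
  have "riesz_form a (\<lambda>r. complex_of_real (indicator {0..t} r)) (\<lambda>r. complex_of_real (indicator {0..s} r)) =
    (LINT v|lborel. LINT r|lborel. complex_of_real (indicator {0..s} v * (indicator {0..t} r * time_kernel a r v)))"
    unfolding riesz_form_def complex_cnj_complex_of_real of_real_mult[symmetric] by (simp only: mult_ac)
  then show ?thesis
    unfolding integral_complex_of_real covariance_time_integral[OF a st] .
qed

text \<open>Indexed access to the triples of a step function, which turns the list sums in the definitions
  of \<open>step_fun\<close> and \<open>step_noise\<close> into finite sums over indices.\<close>

definition step_coeff :: "'a step \<Rightarrow> nat \<Rightarrow> real" where "step_coeff p i = fst (p ! i)"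
definition step_time :: "'a step \<Rightarrow> nat \<Rightarrow> real" where "step_time p i = fst (snd (p ! i))"
definition step_set :: "'a step \<Rightarrow> nat \<Rightarrow> 'a set" where "step_set p i = snd (snd (p ! i))"

lemma step_sum_list: "(\<Sum>(c, t, A)\<leftarrow>p. F c t A) = (\<Sum>i<length p. F (step_coeff p i) (step_time p i) (step_set p i))"
  by (simp add: sum_list_sum_nth case_prod_beta' step_coeff_def step_time_def step_set_def atLeast0LessThan)

lemma stepD:
  assumes "step p" "i < length p"
  shows "0 \<le> step_time p i" "bounded_borel (step_set p i)"
  using assms nth_mem[of i p] unfolding step_def step_time_def step_set_def by fastforce+

lemma integrable_indicator_exp:
  assumes "bounded_borel A"
  shows "integrable lborel (\<lambda>x. wave_character \<xi> x * complex_of_real (indicator A x))"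
proof (rule Bochner_Integration.integrable_bound[OF bounded_borelD(3)[OF assms]])
  have [measurable]: "A \<in> sets borel" using assms by (rule bounded_borelD(1))
  show "(\<lambda>x. wave_character \<xi> x * complex_of_real (indicator A x)) \<in> borel_measurable lborel"
    by measurable
qed (auto simp: norm_mult)

lemma step_hat_eq:
  assumes "step p"
  shows "step_hat p r \<xi> = (\<Sum>i<length p. (complex_of_real (step_coeff p i) * indicator_hat (step_set p i) \<xi>) *
     complex_of_real (indicator {0..step_time p i} r))"
proof -
  have "step_hat p r \<xi> = (LINT x|lborel. (\<Sum>i<length p. complex_of_real (step_coeff p i * indicator {0..step_time p i} r) *
      (wave_character \<xi> x * complex_of_real (indicator (step_set p i) x))))"
    unfolding step_hat_def fourier_def step_fun_def step_sum_list indicator_times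
    by (simp add: sum_distrib_left mult_ac)
  also have "\<dots> = (\<Sum>i<length p. complex_of_real (step_coeff p i * indicator {0..step_time p i} r) * indicator_hat (step_set p i) \<xi>)"
    unfolding fourier_def integral_mult_right_zero[symmetric]
    by (intro Bochner_Integration.integral_sum integrable_mult_right integrable_indicator_exp stepD[OF assms]) auto
  finally show ?thesis by (simp add: mult_ac)
qed

lemma tame_step_hat:
  assumes "step p"
  shows "tame (\<lambda>r. step_hat p r \<xi>)"
  unfolding step_hat_eq[OF assms] by (intro tame_sum tame_cmult tame_indicator) auto

lemma step_hat_neg: "step p \<Longrightarrow> r < 0 \<Longrightarrow> step_hat p r \<xi> = 0"
  by (simp add: step_hat_eq)

lemma hp_time_form_step:
  assumes p: "step p" and H: "1/2 < H" "H < 1"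
  shows "hp_time_form H (step_hat p) (step_hat p) \<xi> = (\<Sum>i<length p. \<Sum>j<length p.
     complex_of_real (step_coeff p i * step_coeff p j * (R_fbm H (step_time p i) (step_time p j) / alpha_H H)) *
       (indicator_hat (step_set p i) \<xi> * cnj (indicator_hat (step_set p j) \<xi>)))"
proof -
  define a where "a = 2 * H - 1"
  have a: "0 < a" "a < 1" using H by (auto simp: a_def)
  let ?\<alpha> = "\<lambda>i. complex_of_real (step_coeff p i) * indicator_hat (step_set p i) \<xi>"
  let ?\<phi> = "\<lambda>i r. complex_of_real (indicator {0..step_time p i} r)"
  have t: "tame (\<lambda>r. ?\<alpha> i * ?\<phi> i r)" for i by (intro tame_cmult tame_indicator)
  have "hp_time_form H (step_hat p) (step_hat p) \<xi> = riesz_form a (\<lambda>r. step_hat p r \<xi>) (\<lambda>r. step_hat p r \<xi>)"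
    unfolding a_def by (intro hp_time_form_eq_riesz_form step_hat_neg[OF p])
  also have "\<dots> = (\<Sum>i<length p. \<Sum>j<length p. riesz_form a (\<lambda>r. ?\<alpha> i * ?\<phi> i r) (\<lambda>r. ?\<alpha> j * ?\<phi> j r))"
    unfolding step_hat_eq[OF p]
    by (subst riesz_form_sum_left[OF a(1) finite_lessThan t tame_sum[OF finite_lessThan t]])
       (intro sum.cong refl riesz_form_sum_right[OF a(1) finite_lessThan t t])
  also have "\<dots> = (\<Sum>i<length p. \<Sum>j<length p.
     complex_of_real (step_coeff p i * step_coeff p j * (R_fbm H (step_time p i) (step_time p j) / alpha_H H)) *
       (indicator_hat (step_set p i) \<xi> * cnj (indicator_hat (step_set p j) \<xi>)))"
  proof (intro sum.cong refl)
    fix i j assume ij: "i \<in> {..<length p}" "j \<in> {..<length p}"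
    let ?t = "step_time p i" and ?s = "step_time p j"
    have "riesz_form a (?\<phi> i) (?\<phi> j) = complex_of_real ((?t powr (a + 1) + ?s powr (a + 1) - \<bar>?t - ?s\<bar> powr (a + 1)) / (a * (a + 1)))"
      using ij stepD[OF p] by (intro riesz_form_indicators a) auto
    also have "(?t powr (a + 1) + ?s powr (a + 1) - \<bar>?t - ?s\<bar> powr (a + 1)) / (a * (a + 1)) = R_fbm H ?t ?s / alpha_H H"
    proof -
      have e: "a + 1 = 2 * H" by (simp add: a_def)
      have "a * (a + 1) = 2 * alpha_H H" by (simp add: a_def alpha_H_def)
      then show ?thesis unfolding R_fbm_def e by simp
    qed
    finally show "riesz_form a (\<lambda>r. ?\<alpha> i * ?\<phi> i r) (\<lambda>r. ?\<alpha> j * ?\<phi> j r) =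
       complex_of_real (step_coeff p i * step_coeff p j * (R_fbm H ?t ?s / alpha_H H)) *
       (indicator_hat (step_set p i) \<xi> * cnj (indicator_hat (step_set p j) \<xi>))"
      unfolding riesz_form_cmult_left riesz_form_cmult_right by simp
  qed
  finally show ?thesis .
qed

lemma centered_gaussian_square_integrable:
  assumes "prob_space P" "centered_gaussian P X"
  shows "integrable P (\<lambda>\<omega>. (X \<omega>)\<^sup>2)" "X \<in> borel_measurable P"
proof -
  interpret prob_space P by fact
  show [measurable]: "X \<in> borel_measurable P" using assms(2) by (simp add: centered_gaussian_def)
  from assms(2) consider "AE \<omega> in P. X \<omega> = 0"
    | \<sigma> where "0 < \<sigma>" "distributed P lborel X (\<lambda>x. ennreal (normal_density 0 \<sigma> x))"
    unfolding centered_gaussian_def by blast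
  then show "integrable P (\<lambda>\<omega>. (X \<omega>)\<^sup>2)"
  proof cases
    case 1
    have "integrable P (\<lambda>\<omega>. (X \<omega>)\<^sup>2) \<longleftrightarrow> integrable P (\<lambda>\<omega>. 0 :: real)"
      by (rule integrable_cong_AE) (use 1 in auto)
    then show ?thesis by simp
  next
    case 2
    have "integrable lborel (\<lambda>x. normal_density 0 \<sigma> x * x\<^sup>2)"
      using integrable_normal_moment[OF 2(1), of 0 2] by simp
    then show ?thesis
      using distributed_integrable[OF 2(2), of "\<lambda>x. x\<^sup>2"] by simp
  qed
qed

lemma integrable_mult_of_squares:
  fixes X Y :: "'w \<Rightarrow> real"
  assumes [measurable]: "X \<in> borel_measurable P" "Y \<in> borel_measurable P"
    and "integrable P (\<lambda>\<omega>. (X \<omega>)\<^sup>2)" "integrable P (\<lambda>\<omega>. (Y \<omega>)\<^sup>2)"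
  shows "integrable P (\<lambda>\<omega>. X \<omega> * Y \<omega>)"
proof (rule Bochner_Integration.integrable_bound)
  show "integrable P (\<lambda>\<omega>. (X \<omega>)\<^sup>2 + (Y \<omega>)\<^sup>2)" using assms by simp
  show "AE \<omega> in P. norm (X \<omega> * Y \<omega>) \<le> norm ((X \<omega>)\<^sup>2 + (Y \<omega>)\<^sup>2)"
  proof (rule AE_I2)
    fix \<omega>
    have "2 * \<bar>X \<omega>\<bar> * \<bar>Y \<omega>\<bar> \<le> (X \<omega>)\<^sup>2 + (Y \<omega>)\<^sup>2"
      using sum_squares_bound[of "\<bar>X \<omega>\<bar>" "\<bar>Y \<omega>\<bar>"] by simp
    moreover have "0 \<le> \<bar>X \<omega>\<bar> * \<bar>Y \<omega>\<bar>" by simp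
    ultimately have "\<bar>X \<omega>\<bar> * \<bar>Y \<omega>\<bar> \<le> (X \<omega>)\<^sup>2 + (Y \<omega>)\<^sup>2" by linarith
    then show "norm (X \<omega> * Y \<omega>) \<le> norm ((X \<omega>)\<^sup>2 + (Y \<omega>)\<^sup>2)"
      by (simp add: abs_mult)
  qed
qed measurable

lemma noise_square_integrable:
  assumes P: "prob_space P" and W: "fractional_colored_noise P H f W" and tA: "0 \<le> t" "bounded_borel A"
  shows "integrable P (\<lambda>\<omega>. (W t A \<omega>)\<^sup>2)" "W t A \<in> borel_measurable P"
proof -
  have fam: "centered_gaussian_family P {(t, A). 0 \<le> t \<and> bounded_borel A} (\<lambda>(t, A). W t A)"
    using W by (simp add: fractional_colored_noise_def)
  have "centered_gaussian P (\<lambda>\<omega>. \<Sum>j\<in>{(t, A)}. (\<lambda>_. 1) j * (case j of (t, A) \<Rightarrow> W t A) \<omega>)"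
    using fam[unfolded centered_gaussian_family_def, rule_format, of "{(t, A)}" "\<lambda>_. 1"] tA by simp
  then have "centered_gaussian P (W t A)" by simp
  from centered_gaussian_square_integrable[OF P this]
  show "integrable P (\<lambda>\<omega>. (W t A \<omega>)\<^sup>2)" "W t A \<in> borel_measurable P" .
qed

lemma step_noise_measurable:
  assumes P: "prob_space P" and W: "fractional_colored_noise P H f W" and p: "step p"
  shows "step_noise W p \<in> borel_measurable P"
proof -
  have [measurable]: "W (step_time p i) (step_set p i) \<in> borel_measurable P" if "i < length p" for i
    using noise_square_integrable(2)[OF P W stepD[OF p that]] .
  have "(\<lambda>\<omega>. \<Sum>i<length p. step_coeff p i * W (step_time p i) (step_set p i) \<omega>) \<in> borel_measurable P"
    by (intro borel_measurable_sum borel_measurable_times) auto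
  then show ?thesis unfolding step_noise_def[abs_def] step_sum_list .
qed

text \<open>Expanding both sides into double sums over the triples, the time factors agree by
  \<open>covariance_time_integral\<close> and the space factors by \<open>riesz_kernel_parseval\<close>.\<close>

lemma step_isometry:
  fixes f :: "'a::euclidean_space \<Rightarrow> real"
  assumes P: "prob_space P" and W: "fractional_colored_noise P H f W" and f: "riesz_kernel \<beta> f"
    and \<beta>: "0 < \<beta>" "\<beta> < real DIM('a)" and H: "1/2 < H" "H < 1" and p: "step p"
  shows "integrable (spectral_measure \<beta>) (hp_time_form H (step_hat p) (step_hat p))"
    and "integrable P (\<lambda>\<omega>. (step_noise W p \<omega>)\<^sup>2)"
    and "complex_of_real (LINT \<omega>|P. (step_noise W p \<omega>)\<^sup>2) = hp_inner H \<beta> (step_hat p) (step_hat p)"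
proof -
  let ?n = "length p"
  let ?c = "step_coeff p" and ?t = "step_time p" and ?A = "step_set p"
  let ?W = "\<lambda>i. W (?t i) (?A i)"
  let ?F = "\<lambda>i j. LINT x:?A i|lborel. LINT y:?A j|lborel. f (x - y)"
  have alpha: "alpha_H H > 0" using H by (simp add: alpha_H_def)
  note sD = stepD[OF p]
  have hat_int: "integrable (spectral_measure \<beta>) (\<lambda>\<xi>. indicator_hat (?A i) \<xi> * cnj (indicator_hat (?A j) \<xi>))"
    if "i < ?n" "j < ?n" for i j
    by (rule riesz_kernel_parseval(1)[OF f \<beta> sD(2)[OF that(1)] sD(2)[OF that(2)]])
  let ?s = "\<lambda>\<xi>. \<Sum>i<?n. \<Sum>j<?n. complex_of_real (?c i * ?c j * (R_fbm H (?t i) (?t j) / alpha_H H)) *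
       (indicator_hat (?A i) \<xi> * cnj (indicator_hat (?A j) \<xi>))"
  have hp: "hp_time_form H (step_hat p) (step_hat p) = ?s"
    by (rule ext) (rule hp_time_form_step[OF p H])
  show "integrable (spectral_measure \<beta>) (hp_time_form H (step_hat p) (step_hat p))"
    unfolding hp by (intro Bochner_Integration.integrable_sum integrable_mult_right hat_int) auto
  have Wint: "integrable P (\<lambda>\<omega>. ?W i \<omega> * ?W j \<omega>)" if "i < ?n" "j < ?n" for i j
    using noise_square_integrable[OF P W sD[OF that(1)]] noise_square_integrable[OF P W sD[OF that(2)]]
    by (intro integrable_mult_of_squares)
  have sq: "(step_noise W p \<omega>)\<^sup>2 = (\<Sum>i<?n. \<Sum>j<?n. (?c i * ?c j) * (?W i \<omega> * ?W j \<omega>))" for \<omega>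
    unfolding step_noise_def step_sum_list power2_eq_square sum_product by (simp only: mult_ac)
  show "integrable P (\<lambda>\<omega>. (step_noise W p \<omega>)\<^sup>2)"
    unfolding sq by (intro Bochner_Integration.integrable_sum integrable_mult_right Wint) auto
  have cov: "(LINT \<omega>|P. ?W i \<omega> * ?W j \<omega>) = R_fbm H (?t i) (?t j) * ?F i j" if "i < ?n" "j < ?n" for i j
    using W sD[OF that(1)] sD[OF that(2)] unfolding fractional_colored_noise_def by blast
  have "(LINT \<omega>|P. (step_noise W p \<omega>)\<^sup>2) = (\<Sum>i<?n. \<Sum>j<?n. (?c i * ?c j) * (LINT \<omega>|P. ?W i \<omega> * ?W j \<omega>))"
    unfolding sq by (subst Bochner_Integration.integral_sum)
      (auto intro!: sum.cong Bochner_Integration.integrable_sum integrable_mult_right Wint simp: Bochner_Integration.integral_sum Wint)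
  also have "\<dots> = (\<Sum>i<?n. \<Sum>j<?n. (?c i * ?c j) * (R_fbm H (?t i) (?t j) * ?F i j))"
    by (intro sum.cong refl) (simp add: cov)
  finally have V: "(LINT \<omega>|P. (step_noise W p \<omega>)\<^sup>2) = \<dots>" .
  have "(LINT \<xi>|spectral_measure \<beta>. hp_time_form H (step_hat p) (step_hat p) \<xi>) =
     (\<Sum>i<?n. \<Sum>j<?n. complex_of_real (?c i * ?c j * (R_fbm H (?t i) (?t j) / alpha_H H)) *
        (LINT \<xi>|spectral_measure \<beta>. indicator_hat (?A i) \<xi> * cnj (indicator_hat (?A j) \<xi>)))"
    unfolding hp by (subst Bochner_Integration.integral_sum)
      (auto intro!: sum.cong Bochner_Integration.integrable_sum integrable_mult_right hat_int simp: Bochner_Integration.integral_sum hat_int)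
  also have "\<dots> = (\<Sum>i<?n. \<Sum>j<?n. complex_of_real (?c i * ?c j * (R_fbm H (?t i) (?t j) / alpha_H H)) * complex_of_real (?F i j))"
    using riesz_kernel_parseval(2)[OF f \<beta> sD(2) sD(2)] by (intro sum.cong refl) auto
  also have "\<dots> = complex_of_real ((\<Sum>i<?n. \<Sum>j<?n. (?c i * ?c j) * (R_fbm H (?t i) (?t j) * ?F i j)) / alpha_H H)"
    unfolding sum_divide_distrib by (simp add: mult.assoc)
  finally show "complex_of_real (LINT \<omega>|P. (step_noise W p \<omega>)\<^sup>2) = hp_inner H \<beta> (step_hat p) (step_hat p)"
    unfolding hp_inner_def V[symmetric] using alpha by simp
qed

text \<open>The span of the indicators is represented by lists, so the difference of two elements is again
  a list and the isometry applies to it.\<close>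

definition step_minus :: "'a step \<Rightarrow> 'a step \<Rightarrow> 'a step" where
  "step_minus p q = p @ map (\<lambda>(c, t, A). (- c, t, A)) q"

lemma step_step_minus: "step p \<Longrightarrow> step q \<Longrightarrow> step (step_minus p q)"
  by (auto simp: step_def step_minus_def)

lemma step_noise_minus: "step_noise W (step_minus p q) \<omega> = step_noise W p \<omega> - step_noise W q \<omega>"
proof -
  have "(\<Sum>x\<leftarrow>map (\<lambda>(c, t, A). (- c, t, A)) q. case x of (c, t, A) \<Rightarrow> c * W t A \<omega>) = - (\<Sum>(c, t, A)\<leftarrow>q. c * W t A \<omega>)"
    by (induction q) auto
  then show ?thesis by (simp add: step_noise_def step_minus_def)
qed

lemma step_hat_sum_list:
  assumes "step q"
  shows "step_hat q r \<xi> = (\<Sum>(c, t, A)\<leftarrow>q. (complex_of_real c * indicator_hat A \<xi>) * complex_of_real (indicator {0..t} r))"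
  unfolding step_sum_list by (rule step_hat_eq[OF assms])

lemma step_hat_minus:
  assumes "step p" "step q"
  shows "step_hat (step_minus p q) r \<xi> = step_hat p r \<xi> - step_hat q r \<xi>"
proof -
  have "(\<Sum>x\<leftarrow>map (\<lambda>(c, t, A). (- c, t, A)) q. case x of (c, t, A) \<Rightarrow> (complex_of_real c * indicator_hat A \<xi>) * complex_of_real (indicator {0..t} r))
     = - (\<Sum>(c, t, A)\<leftarrow>q. (complex_of_real c * indicator_hat A \<xi>) * complex_of_real (indicator {0..t} r))"
    by (induction q) auto
  then show ?thesis
    unfolding step_hat_sum_list[OF assms(1)] step_hat_sum_list[OF assms(2)] step_hat_sum_list[OF step_step_minus[OF assms]]
    by (simp add: step_minus_def)
qed

section \<open>Increments of the solution\<close>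

text \<open>Replacing \<open>\<phi> - \<phi>'\<close> by \<open>\<psi> - \<psi>'\<close> changes the energy by at most a factor and the energies of the
  errors. Its counterpart for random variables is \<open>square_perturb\<close>.\<close>

lemma riesz_energy_perturb:
  assumes a: "0 < a" "a < 1" and t: "tame \<phi>" "tame \<phi>'" "tame \<psi>" "tame \<psi>'"
  shows "riesz_energy a (\<lambda>r. \<phi> r - \<phi>' r) \<le> 2 * riesz_energy a (\<lambda>r. \<psi> r - \<psi>' r)
    + 4 * riesz_energy a (\<lambda>r. \<psi> r - \<phi> r) + 4 * riesz_energy a (\<lambda>r. \<psi>' r - \<phi>' r)"
proof -
  have m: "riesz_energy a (\<lambda>r. - \<eta> r) = riesz_energy a \<eta>" for \<eta>
    using riesz_energy_cmult[of a "-1" \<eta>] by simp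
  define A where "A = (\<lambda>r. \<psi> r - \<phi> r)"
  define B where "B = (\<lambda>r. \<psi>' r - \<phi>' r)"
  have tAB: "tame A" "tame B" unfolding A_def B_def by (intro tame_diff t)+
  have eq: "(\<lambda>r. \<phi> r - \<phi>' r) = (\<lambda>r. (\<psi> r - \<psi>' r) + (- A r + B r))"
    by (auto simp: A_def B_def)
  have tnA: "tame (\<lambda>r. - A r)" using tame_cmult[OF tAB(1), of "-1"] by simp
  have "riesz_energy a (\<lambda>r. \<phi> r - \<phi>' r) \<le> 2 * riesz_energy a (\<lambda>r. \<psi> r - \<psi>' r) + 2 * riesz_energy a (\<lambda>r. - A r + B r)"
    unfolding eq by (rule riesz_energy_add_le[OF a tame_diff[OF t(3,4)] tame_add[OF tnA tAB(2)]])
  moreover have "riesz_energy a (\<lambda>r. - A r + B r) \<le> 2 * riesz_energy a A + 2 * riesz_energy a B"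
    using riesz_energy_add_le[OF a tnA tAB(2)] by (simp add: m)
  ultimately show ?thesis unfolding A_def B_def by linarith
qed

lemma square_perturb: "(x - y)\<^sup>2 \<le> 2 * (z - w)\<^sup>2 + 4 * (z - x)\<^sup>2 + 4 * (w - y)\<^sup>2" for x y z w :: real
proof -
  have "2 * (z - w)\<^sup>2 + 4 * (z - x)\<^sup>2 + 4 * (w - y)\<^sup>2 - (x - y)\<^sup>2 =
    ((z - w) + ((z - x) - (w - y)))\<^sup>2 + 2 * ((z - x) + (w - y))\<^sup>2"
    by (simp add: power2_eq_square algebra_simps)
  also have "\<dots> \<ge> 0" by simp
  finally show ?thesis by simp
qed

lemma wave_integrand_hat_factor:
  "wave_integrand_hat t x r \<xi> = (wave_character \<xi> x * complex_of_real (1 / norm \<xi>)) *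
     complex_of_real (indicator {0..t} r * sin ((t - r) * norm \<xi>))"
  unfolding wave_integrand_hat_def wave_kernel_hat_def by (simp add: indicator_def)

lemma tame_wave_integrand_hat: "tame (\<lambda>r. wave_integrand_hat t x r \<xi>)"
  unfolding wave_integrand_hat_factor by (intro tame_cmult tame_of_real[where B=1]) auto

lemma wave_integrand_hat_neg: "r < 0 \<Longrightarrow> wave_integrand_hat t x r \<xi> = 0"
  by (simp add: wave_integrand_hat_def)

lemma riesz_energy_wave_integrand_diff:
  "riesz_energy a (\<lambda>r. wave_integrand_hat t x r \<xi> - wave_integrand_hat s x r \<xi>) = wave_spectral_density a s t (norm \<xi>)"
proof -
  have eq: "(\<lambda>r. wave_integrand_hat t x r \<xi> - wave_integrand_hat s x r \<xi>) =
    (\<lambda>r. (wave_character \<xi> x * complex_of_real (1 / norm \<xi>)) * complex_of_real (wave_diff s t (norm \<xi>) r))"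
    unfolding wave_integrand_hat_factor wave_diff_def of_real_diff right_diff_distrib[symmetric] ..
  show ?thesis
    unfolding eq riesz_energy_cmult
    by (simp add: wave_spectral_density_def norm_mult power_mult_distrib power_divide norm_divide)
qed

text \<open>Approximate the wave kernels for \<open>t\<close> and \<open>s\<close> by step functions \<open>p n\<close> and \<open>q n\<close>. The isometry
  equates the second moment of the noise of \<open>p n - q n\<close> with its energy. The former differs from \<open>V\<close>
  and the latter from \<open>N\<close> by a factor \<open>2\<close> and errors that tend to \<open>0\<close>.\<close>

lemma mild_solution_increment_comparable:
  fixes f :: "'a::euclidean_space \<Rightarrow> real" and x :: 'a
  assumes P: "prob_space P" and W: "fractional_colored_noise P H f W" and f: "riesz_kernel \<beta> f"
    and \<beta>: "0 < \<beta>" "\<beta> < real DIM('a)" and H: "1/2 < H" "H < 1"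
    and u: "mild_solution P H \<beta> W u" and st: "0 \<le> s" "0 \<le> t"
    and int: "integrable (spectral_measure \<beta>) (\<lambda>\<xi>::'a. wave_spectral_density (2 * H - 1) s t (norm \<xi>))"
  defines "N \<equiv> alpha_H H * (LINT \<xi>|(spectral_measure \<beta> :: 'a measure). wave_spectral_density (2 * H - 1) s t (norm \<xi>))"
    and "V \<equiv> (LINT \<omega>|P. (u t x \<omega> - u s x \<omega>)\<^sup>2)"
  shows "V \<le> 4 * N" and "N \<le> 4 * V"
proof -
  define a where "a = 2 * H - 1"
  have a: "0 < a" "a < 1" using H by (auto simp: a_def)
  have alpha: "alpha_H H > 0" using H by (simp add: alpha_H_def)
  let ?\<mu> = "spectral_measure \<beta> :: 'a measure"
  let ?g = "\<lambda>\<tau>. wave_integrand_hat \<tau> x"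
  have approx: "\<exists>p. (\<forall>n. step (p n)) \<and> (\<forall>n. integrable ?\<mu> (\<lambda>\<xi>. riesz_energy a (\<lambda>r. step_hat (p n) r \<xi> - ?g \<tau> r \<xi>))) \<and>
     (\<lambda>n. LINT \<xi>|?\<mu>. riesz_energy a (\<lambda>r. step_hat (p n) r \<xi> - ?g \<tau> r \<xi>)) \<longlonglongrightarrow> 0 \<and>
     (\<lambda>n. LINT \<omega>|P. (step_noise W (p n) \<omega> - u \<tau> x \<omega>)\<^sup>2) \<longlonglongrightarrow> 0 \<and>
     u \<tau> x \<in> borel_measurable P \<and> integrable P (\<lambda>\<omega>. (u \<tau> x \<omega>)\<^sup>2)" if "0 \<le> \<tau>" for \<tau>
  proof -
    have "wiener_integral P H \<beta> W (?g \<tau>) (u \<tau> x)" using u that by (simp add: mild_solution_def)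
    then obtain p where p: "\<And>n. step (p n)" "hp_tendsto H \<beta> (\<lambda>n. step_hat (p n)) (?g \<tau>)"
      "(\<lambda>n. LINT \<omega>|P. (step_noise W (p n) \<omega> - u \<tau> x \<omega>)\<^sup>2) \<longlonglongrightarrow> 0"
      "u \<tau> x \<in> borel_measurable P" "integrable P (\<lambda>\<omega>. (u \<tau> x \<omega>)\<^sup>2)"
      unfolding wiener_integral_def by blast
    define \<Delta> where "\<Delta> n r \<xi> = step_hat (p n) r \<xi> - ?g \<tau> r \<xi>" for n r \<xi>
    have form: "hp_time_form H (\<Delta> n) (\<Delta> n) \<xi> = complex_of_real (riesz_energy a (\<lambda>r. \<Delta> n r \<xi>))" for n \<xi>
    proof -
      have "hp_time_form H (\<Delta> n) (\<Delta> n) \<xi> = riesz_form a (\<lambda>r. \<Delta> n r \<xi>) (\<lambda>r. \<Delta> n r \<xi>)"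
        unfolding a_def by (intro hp_time_form_eq_riesz_form) (auto simp: \<Delta>_def step_hat_neg[OF p(1)] wave_integrand_hat_neg)
      also have "\<dots> = complex_of_real (riesz_energy a (\<lambda>r. \<Delta> n r \<xi>))"
        unfolding \<Delta>_def by (intro riesz_form_self a tame_diff tame_step_hat p tame_wave_integrand_hat)
      finally show ?thesis .
    qed
    have hp: "\<And>n. integrable ?\<mu> (hp_time_form H (\<Delta> n) (\<Delta> n))" "(\<lambda>n. hp_inner H \<beta> (\<Delta> n) (\<Delta> n)) \<longlonglongrightarrow> 0"
      using p(2) unfolding hp_tendsto_def Let_def \<Delta>_def by auto
    have i: "integrable ?\<mu> (\<lambda>\<xi>. riesz_energy a (\<lambda>r. \<Delta> n r \<xi>))" for n
      using hp(1)[of n] integrable_Re[OF hp(1)[of n]] by (simp add: form)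
    have "hp_inner H \<beta> (\<Delta> n) (\<Delta> n) = complex_of_real (alpha_H H * (LINT \<xi>|?\<mu>. riesz_energy a (\<lambda>r. \<Delta> n r \<xi>)))" for n
      unfolding hp_inner_def form integral_complex_of_real by simp
    with hp(2) have "(\<lambda>n. complex_of_real (alpha_H H * (LINT \<xi>|?\<mu>. riesz_energy a (\<lambda>r. \<Delta> n r \<xi>)))) \<longlonglongrightarrow> complex_of_real 0"
      by simp
    then have "(\<lambda>n. alpha_H H * (LINT \<xi>|?\<mu>. riesz_energy a (\<lambda>r. \<Delta> n r \<xi>))) \<longlonglongrightarrow> 0"
      by (simp only: tendsto_of_real_iff)
    from tendsto_mult_left[OF this, of "1 / alpha_H H"]
    have "(\<lambda>n. LINT \<xi>|?\<mu>. riesz_energy a (\<lambda>r. \<Delta> n r \<xi>)) \<longlonglongrightarrow> 0" using alpha by simp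
    then show ?thesis using p i unfolding \<Delta>_def by blast
  qed
  obtain p where p: "\<And>n. step (p n)" "\<And>n. integrable ?\<mu> (\<lambda>\<xi>. riesz_energy a (\<lambda>r. step_hat (p n) r \<xi> - ?g t r \<xi>))"
     "(\<lambda>n. LINT \<xi>|?\<mu>. riesz_energy a (\<lambda>r. step_hat (p n) r \<xi> - ?g t r \<xi>)) \<longlonglongrightarrow> 0"
     "(\<lambda>n. LINT \<omega>|P. (step_noise W (p n) \<omega> - u t x \<omega>)\<^sup>2) \<longlonglongrightarrow> 0"
     "u t x \<in> borel_measurable P" "integrable P (\<lambda>\<omega>. (u t x \<omega>)\<^sup>2)"
    using approx[OF st(2)] by blast
  obtain q where q: "\<And>n. step (q n)" "\<And>n. integrable ?\<mu> (\<lambda>\<xi>. riesz_energy a (\<lambda>r. step_hat (q n) r \<xi> - ?g s r \<xi>))"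
     "(\<lambda>n. LINT \<xi>|?\<mu>. riesz_energy a (\<lambda>r. step_hat (q n) r \<xi> - ?g s r \<xi>)) \<longlonglongrightarrow> 0"
     "(\<lambda>n. LINT \<omega>|P. (step_noise W (q n) \<omega> - u s x \<omega>)\<^sup>2) \<longlonglongrightarrow> 0"
     "u s x \<in> borel_measurable P" "integrable P (\<lambda>\<omega>. (u s x \<omega>)\<^sup>2)"
    using approx[OF st(1)] by blast
  define d where "d n = step_minus (p n) (q n)" for n
  have d: "step (d n)" for n unfolding d_def by (rule step_step_minus[OF p(1) q(1)])
  define E where "E n \<xi> = riesz_energy a (\<lambda>r. step_hat (d n) r \<xi>)" for n \<xi>
  define Ep where "Ep n \<xi> = riesz_energy a (\<lambda>r. step_hat (p n) r \<xi> - ?g t r \<xi>)" for n \<xi>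
  define Eq where "Eq n \<xi> = riesz_energy a (\<lambda>r. step_hat (q n) r \<xi> - ?g s r \<xi>)" for n \<xi>
  define G where "G \<xi> = wave_spectral_density a s t (norm \<xi>)" for \<xi> :: 'a
  have E_form: "hp_time_form H (step_hat (d n)) (step_hat (d n)) \<xi> = complex_of_real (E n \<xi>)" for n \<xi>
  proof -
    have "hp_time_form H (step_hat (d n)) (step_hat (d n)) \<xi> = riesz_form a (\<lambda>r. step_hat (d n) r \<xi>) (\<lambda>r. step_hat (d n) r \<xi>)"
      unfolding a_def by (intro hp_time_form_eq_riesz_form step_hat_neg[OF d])
    then show ?thesis unfolding E_def by (simp add: riesz_form_self[OF a tame_step_hat[OF d]])
  qed
  have E_int: "integrable ?\<mu> (E n)" for n
    using integrable_Re[OF step_isometry(1)[OF P W f \<beta> H d]] by (simp add: E_form)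
  have Vn: "(LINT \<omega>|P. (step_noise W (p n) \<omega> - step_noise W (q n) \<omega>)\<^sup>2) = alpha_H H * (LINT \<xi>|?\<mu>. E n \<xi>)" for n
  proof -
    have "complex_of_real (LINT \<omega>|P. (step_noise W (d n) \<omega>)\<^sup>2) = complex_of_real (alpha_H H * (LINT \<xi>|?\<mu>. E n \<xi>))"
      unfolding step_isometry(3)[OF P W f \<beta> H d] hp_inner_def E_form integral_complex_of_real by simp
    then show ?thesis unfolding of_real_eq_iff d_def step_noise_minus .
  qed
  have tp: "tame (\<lambda>r. step_hat (p n) r \<xi>)" and tq: "tame (\<lambda>r. step_hat (q n) r \<xi>)" for n \<xi>
    using p(1) q(1) by (auto intro: tame_step_hat)
  have E_eq: "E n \<xi> = riesz_energy a (\<lambda>r. step_hat (p n) r \<xi> - step_hat (q n) r \<xi>)" for n \<xi>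
    unfolding E_def d_def step_hat_minus[OF p(1) q(1)] ..
  have G_eq: "G \<xi> = riesz_energy a (\<lambda>r. ?g t r \<xi> - ?g s r \<xi>)" for \<xi>
    unfolding G_def riesz_energy_wave_integrand_diff ..
  have neg: "riesz_energy a (\<lambda>r. \<phi> r - \<psi> r) = riesz_energy a (\<lambda>r. \<psi> r - \<phi> r)" for \<phi> \<psi>
    using riesz_energy_cmult[of a "-1" "\<lambda>r. \<psi> r - \<phi> r"] by simp
  have G_le: "G \<xi> \<le> 2 * E n \<xi> + 4 * Ep n \<xi> + 4 * Eq n \<xi>" for n \<xi>
    unfolding G_eq E_eq Ep_def Eq_def
    by (intro riesz_energy_perturb a tp tq tame_wave_integrand_hat)
  have E_le: "E n \<xi> \<le> 2 * G \<xi> + 4 * Ep n \<xi> + 4 * Eq n \<xi>" for n \<xi>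
    unfolding G_eq E_eq Ep_def Eq_def neg[of "\<lambda>r. step_hat (p n) r \<xi>" "\<lambda>r. ?g t r \<xi>"] neg[of "\<lambda>r. step_hat (q n) r \<xi>" "\<lambda>r. ?g s r \<xi>"]
    by (intro riesz_energy_perturb a tp tq tame_wave_integrand_hat)
  have G_int: "integrable ?\<mu> G" using int unfolding G_def a_def .
  define \<delta> where "\<delta> n = 4 * (LINT \<xi>|?\<mu>. Ep n \<xi>) + 4 * (LINT \<xi>|?\<mu>. Eq n \<xi>)" for n
  have Ei: "integrable ?\<mu> (Ep n)" "integrable ?\<mu> (Eq n)" for n using p(2) q(2) unfolding Ep_def Eq_def by auto
  have \<delta>: "\<delta> \<longlonglongrightarrow> 0"
    unfolding \<delta>_def using tendsto_add[OF tendsto_mult_left[OF p(3), of 4] tendsto_mult_left[OF q(3), of 4]]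
    by (simp add: Ep_def[abs_def] Eq_def[abs_def])
  have split3: "(LINT \<xi>|?\<mu>. 2 * F \<xi> + 4 * Ep n \<xi> + 4 * Eq n \<xi>) = 2 * (LINT \<xi>|?\<mu>. F \<xi>) + \<delta> n" if "integrable ?\<mu> F" for F n
    using that Ei[of n] by (simp add: \<delta>_def)
  have G_le': "(LINT \<xi>|?\<mu>. G \<xi>) \<le> 2 * (LINT \<xi>|?\<mu>. E n \<xi>) + \<delta> n" for n
    unfolding split3[OF E_int, symmetric] using G_le G_int E_int Ei by (intro integral_mono) auto
  have E_le': "(LINT \<xi>|?\<mu>. E n \<xi>) \<le> 2 * (LINT \<xi>|?\<mu>. G \<xi>) + \<delta> n" for n
    unfolding split3[OF G_int, symmetric] using E_le G_int E_int Ei by (intro integral_mono) auto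
  define X where "X = u t x"
  define Y where "Y = u s x"
  define S where "S n = step_noise W (p n)" for n
  define S' where "S' n = step_noise W (q n)" for n
  have [measurable]: "X \<in> borel_measurable P" "Y \<in> borel_measurable P" "S n \<in> borel_measurable P" "S' n \<in> borel_measurable P" for n
    using p q step_noise_measurable[OF P W] by (auto simp: X_def Y_def S_def S'_def)
  have sqi: "integrable P (\<lambda>\<omega>. (X \<omega>)\<^sup>2)" "integrable P (\<lambda>\<omega>. (Y \<omega>)\<^sup>2)" "integrable P (\<lambda>\<omega>. (S n \<omega>)\<^sup>2)" "integrable P (\<lambda>\<omega>. (S' n \<omega>)\<^sup>2)" for n
    using p q step_isometry(2)[OF P W f \<beta> H] by (auto simp: X_def Y_def S_def S'_def)
  have diff_int: "integrable P (\<lambda>\<omega>. (F \<omega> - F' \<omega>)\<^sup>2)"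
    if "integrable P (\<lambda>\<omega>. (F \<omega>)\<^sup>2)" "integrable P (\<lambda>\<omega>. (F' \<omega>)\<^sup>2)" "F \<in> borel_measurable P" "F' \<in> borel_measurable P" for F F' :: "_ \<Rightarrow> real"
    unfolding power2_diff using that integrable_mult_of_squares[OF that(3,4,1,2)] by (simp add: mult.assoc)
  define \<eta> where "\<eta> n = 4 * (LINT \<omega>|P. (S n \<omega> - X \<omega>)\<^sup>2) + 4 * (LINT \<omega>|P. (S' n \<omega> - Y \<omega>)\<^sup>2)" for n
  have \<eta>: "\<eta> \<longlonglongrightarrow> 0"
    unfolding \<eta>_def using tendsto_add[OF tendsto_mult_left[OF p(4), of 4] tendsto_mult_left[OF q(4), of 4]]
    by (simp add: S_def S'_def X_def Y_def)
  have i: "integrable P (\<lambda>\<omega>. (X \<omega> - Y \<omega>)\<^sup>2)" "integrable P (\<lambda>\<omega>. (S n \<omega> - S' n \<omega>)\<^sup>2)"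
     "integrable P (\<lambda>\<omega>. (S n \<omega> - X \<omega>)\<^sup>2)" "integrable P (\<lambda>\<omega>. (S' n \<omega> - Y \<omega>)\<^sup>2)" for n
    by (rule diff_int; (rule sqi | measurable))+
  have V_le: "V \<le> 2 * (alpha_H H * (LINT \<xi>|?\<mu>. E n \<xi>)) + \<eta> n" for n
  proof -
    have "V \<le> (LINT \<omega>|P. 2 * (S n \<omega> - S' n \<omega>)\<^sup>2 + 4 * (S n \<omega> - X \<omega>)\<^sup>2 + 4 * (S' n \<omega> - Y \<omega>)\<^sup>2)"
      unfolding V_def X_def[symmetric] Y_def[symmetric] using i square_perturb by (intro integral_mono) auto
    also have "\<dots> = 2 * (LINT \<omega>|P. (S n \<omega> - S' n \<omega>)\<^sup>2) + \<eta> n"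
      using i(1) i(2-4)[of n] by (simp add: \<eta>_def)
    finally show ?thesis using Vn[of n] by (simp add: S_def S'_def)
  qed
  have V_ge: "alpha_H H * (LINT \<xi>|?\<mu>. E n \<xi>) \<le> 2 * V + \<eta> n" for n
  proof -
    have "(LINT \<omega>|P. (S n \<omega> - S' n \<omega>)\<^sup>2) \<le> (LINT \<omega>|P. 2 * (X \<omega> - Y \<omega>)\<^sup>2 + 4 * (S n \<omega> - X \<omega>)\<^sup>2 + 4 * (S' n \<omega> - Y \<omega>)\<^sup>2)"
    proof (rule integral_mono)
      show "(S n \<omega> - S' n \<omega>)\<^sup>2 \<le> 2 * (X \<omega> - Y \<omega>)\<^sup>2 + 4 * (S n \<omega> - X \<omega>)\<^sup>2 + 4 * (S' n \<omega> - Y \<omega>)\<^sup>2" for \<omega>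
        using square_perturb[of "S n \<omega>" "S' n \<omega>" "X \<omega>" "Y \<omega>"]
        by (simp add: power2_commute[of "X \<omega>"] power2_commute[of "Y \<omega>" "S' n \<omega>"])
    qed (use i(1) i(2-4)[of n] in auto)
    also have "\<dots> = 2 * (LINT \<omega>|P. (X \<omega> - Y \<omega>)\<^sup>2) + \<eta> n"
      using i(1) i(2-4)[of n] by (simp add: \<eta>_def)
    finally show ?thesis using Vn[of n] by (simp add: S_def S'_def X_def Y_def V_def)
  qed
  have N: "N = alpha_H H * (LINT \<xi>|?\<mu>. G \<xi>)" by (simp add: N_def G_def a_def)
  show "V \<le> 4 * N"
  proof (rule LIMSEQ_le_const)
    have "(\<lambda>n. 4 * N + (2 * (alpha_H H * \<delta> n) + \<eta> n)) \<longlonglongrightarrow> 4 * N + (2 * (alpha_H H * 0) + 0)"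
      by (intro tendsto_intros \<delta> \<eta>)
    then show "(\<lambda>n. 4 * N + (2 * (alpha_H H * \<delta> n) + \<eta> n)) \<longlonglongrightarrow> 4 * N" by simp
    have "V \<le> 4 * N + (2 * (alpha_H H * \<delta> n) + \<eta> n)" for n
    proof -
      have "alpha_H H * (LINT \<xi>|?\<mu>. E n \<xi>) \<le> alpha_H H * (2 * (LINT \<xi>|?\<mu>. G \<xi>) + \<delta> n)"
        using alpha E_le' by (intro mult_left_mono) auto
      also have "\<dots> = 2 * N + alpha_H H * \<delta> n" by (simp add: N algebra_simps)
      finally show ?thesis using V_le[of n] by linarith
    qed
    then show "\<exists>m. \<forall>n\<ge>m. V \<le> 4 * N + (2 * (alpha_H H * \<delta> n) + \<eta> n)" by blast
  qed
  show "N \<le> 4 * V"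
  proof (rule LIMSEQ_le_const)
    have "(\<lambda>n. 4 * V + (alpha_H H * \<delta> n + 2 * \<eta> n)) \<longlonglongrightarrow> 4 * V + (alpha_H H * 0 + 2 * 0)"
      by (intro tendsto_intros \<delta> \<eta>)
    then show "(\<lambda>n. 4 * V + (alpha_H H * \<delta> n + 2 * \<eta> n)) \<longlonglongrightarrow> 4 * V" by simp
    have "N \<le> 4 * V + (alpha_H H * \<delta> n + 2 * \<eta> n)" for n
    proof -
      have "N \<le> alpha_H H * (2 * (LINT \<xi>|?\<mu>. E n \<xi>) + \<delta> n)"
        unfolding N using alpha G_le' by (intro mult_left_mono) auto
      also have "\<dots> = 2 * (alpha_H H * (LINT \<xi>|?\<mu>. E n \<xi>)) + alpha_H H * \<delta> n" by (simp add: algebra_simps)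
      finally show ?thesis using V_ge[of n] by linarith
    qed
    then show "\<exists>m. \<forall>n\<ge>m. N \<le> 4 * V + (alpha_H H * \<delta> n + 2 * \<eta> n)" by blast
  qed
qed

lemma wave_spectral_integral_bounds:
  fixes a \<beta> t0 T :: real
  assumes a: "0 < a" "a < 1" and \<beta>: "a < \<beta>" "\<beta> < a + 2" and t0: "0 < t0" "t0 < T"
  obtains c C where "0 < c" "0 < C" "\<And>s t. t0 \<le> s \<Longrightarrow> s < t \<Longrightarrow> t \<le> T \<Longrightarrow>
    integrable (spectral_measure \<beta>) (\<lambda>\<xi>::'a::euclidean_space. wave_spectral_density a s t (norm \<xi>)) \<and>
    c * (t - s) powr (a + 2 - \<beta>) \<le> (LINT \<xi>|(spectral_measure \<beta> :: 'a measure). wave_spectral_density a s t (norm \<xi>)) \<and>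
    (LINT \<xi>|(spectral_measure \<beta> :: 'a measure). wave_spectral_density a s t (norm \<xi>)) \<le> C * (t - s) powr (a + 2 - \<beta>)"
proof -
  have T: "0 < T" using t0 by simp
  obtain C where C: "0 < C" "\<And>s t. 0 \<le> s \<Longrightarrow> s < t \<Longrightarrow> t \<le> T \<Longrightarrow>
    (\<integral>\<^sup>+k. ennreal (k powr (\<beta> - 1)) * ennreal (wave_spectral_density a s t k) * indicator {0..} k \<partial>lborel)
      \<le> ennreal (C * (t - s) powr (a + 2 - \<beta>))"
    using wave_spectral_integral_le[OF a \<beta> T] by blast
  obtain c where c: "0 < c" "\<And>s t. t0 \<le> s \<Longrightarrow> s < t \<Longrightarrow> t \<le> T \<Longrightarrow>
    ennreal (c * (t - s) powr (a + 2 - \<beta>)) \<le>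
    (\<integral>\<^sup>+k. ennreal (k powr (\<beta> - 1)) * ennreal (wave_spectral_density a s t k) * indicator {0..} k \<partial>lborel)"
    using wave_spectral_integral_ge[OF a \<beta> t0] by blast
  define D where "D = real DIM('a) * unit_ball_vol (real DIM('a))"
  have D: "D > 0" by (simp add: D_def)
  let ?\<mu> = "spectral_measure \<beta> :: 'a measure"
  show ?thesis
  proof
    show "0 < D * c" "0 < D * C" using D c C by simp_all
    fix s t assume st: "t0 \<le> s" "s < t" "t \<le> T"
    let ?h = "(t - s) powr (a + 2 - \<beta>)"
    let ?I = "\<integral>\<^sup>+\<xi>. ennreal (wave_spectral_density a s t (norm \<xi>)) \<partial>?\<mu>"
    have I: "?I = ennreal D * (\<integral>\<^sup>+k. ennreal (k powr (\<beta> - 1)) * ennreal (wave_spectral_density a s t k) * indicator {0..} k \<partial>lborel)"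
      unfolding D_def by (rule nn_integral_spectral_radial[where F="\<lambda>k. ennreal (wave_spectral_density a s t k)"]) measurable
    have up: "?I \<le> ennreal (D * C * ?h)"
    proof -
      have "?I \<le> ennreal D * ennreal (C * ?h)"
        unfolding I using st t0 by (intro mult_left_mono C(2)) auto
      also have "\<dots> = ennreal (D * C * ?h)" using D C by (simp add: ennreal_mult[symmetric] mult.assoc)
      finally show ?thesis .
    qed
    have low: "ennreal (D * c * ?h) \<le> ?I"
    proof -
      have "ennreal (D * c * ?h) = ennreal D * ennreal (c * ?h)" using D c by (simp add: ennreal_mult[symmetric] mult.assoc)
      also have "\<dots> \<le> ?I" unfolding I using st by (intro mult_left_mono c(2)) auto
      finally show ?thesis .
    qed
    have nn: "0 \<le> wave_spectral_density a s t k" for k by (rule wave_spectral_density_nonneg[OF a])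
    have int: "integrable ?\<mu> (\<lambda>\<xi>. wave_spectral_density a s t (norm \<xi>))"
    proof (rule integrableI_bounded)
      show "(\<integral>\<^sup>+\<xi>. ennreal (norm (wave_spectral_density a s t (norm \<xi>))) \<partial>?\<mu>) < \<infinity>"
        using up nn by (auto intro: order_le_less_trans)
    qed measurable
    have "?I = ennreal (LINT \<xi>|?\<mu>. wave_spectral_density a s t (norm \<xi>))"
      using int nn by (intro nn_integral_eq_integral) auto
    moreover have "0 \<le> (LINT \<xi>|?\<mu>. wave_spectral_density a s t (norm \<xi>))"
      using nn by (intro integral_nonneg_AE) auto
    ultimately show "integrable ?\<mu> (\<lambda>\<xi>. wave_spectral_density a s t (norm \<xi>)) \<and>
      D * c * ?h \<le> (LINT \<xi>|?\<mu>. wave_spectral_density a s t (norm \<xi>)) \<and>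
      (LINT \<xi>|?\<mu>. wave_spectral_density a s t (norm \<xi>)) \<le> D * C * ?h"
      using up low int D C by (auto simp: ennreal_le_iff2)
  qed
qed

theorem proposition1:
  fixes P :: "'w measure"
    and H T \<beta> t0 M :: real
    and f :: "'a::euclidean_space \<Rightarrow> real"
    and W :: "real \<Rightarrow> 'a set \<Rightarrow> 'w \<Rightarrow> real"
    and u :: "real \<Rightarrow> 'a \<Rightarrow> 'w \<Rightarrow> real"
    and x :: 'a
  assumes "prob_space P"
    and "1/2 < H" and "H < 1"
    and "0 < T"
    and "2 * H - 1 < \<beta>" and "\<beta> < min (real DIM('a)) (2 * H + 1)"
    and "riesz_kernel \<beta> f"
    and "fractional_colored_noise P H f W"
    and "mild_solution P H \<beta> W u"
    and "0 < t0" and "t0 < T" and "0 < M"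
    and "x \<in> cbox (- (M *\<^sub>R One)) (M *\<^sub>R One)"
  shows "\<exists>c1>0. \<exists>c2>0. \<forall>s\<in>{t0..T}. \<forall>t\<in>{t0..T}.
           c1 * \<bar>t - s\<bar> powr (2 * H + 1 - \<beta>) \<le> (LINT \<omega>|P. \<bar>u t x \<omega> - u s x \<omega>\<bar>\<^sup>2) \<and>
           (LINT \<omega>|P. \<bar>u t x \<omega> - u s x \<omega>\<bar>\<^sup>2) \<le> c2 * \<bar>t - s\<bar> powr (2 * H + 1 - \<beta>)"
proof -
  define a where "a = 2 * H - 1"
  have a: "0 < a" "a < 1" and \<beta>: "a < \<beta>" "\<beta> < a + 2" and \<beta>': "0 < \<beta>" "\<beta> < real DIM('a)"
    using assms(2,3,5,6) by (auto simp: a_def)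
  have exponent: "2 * H + 1 - \<beta> = a + 2 - \<beta>" by (simp add: a_def)
  have alpha: "alpha_H H > 0" using assms(2) by (simp add: alpha_H_def)
  obtain c C where c: "0 < c" "0 < C" "\<And>s t. t0 \<le> s \<Longrightarrow> s < t \<Longrightarrow> t \<le> T \<Longrightarrow>
    integrable (spectral_measure \<beta>) (\<lambda>\<xi>::'a. wave_spectral_density a s t (norm \<xi>)) \<and>
    c * (t - s) powr (a + 2 - \<beta>) \<le> (LINT \<xi>|(spectral_measure \<beta> :: 'a measure). wave_spectral_density a s t (norm \<xi>)) \<and>
    (LINT \<xi>|(spectral_measure \<beta> :: 'a measure). wave_spectral_density a s t (norm \<xi>)) \<le> C * (t - s) powr (a + 2 - \<beta>)"
    using wave_spectral_integral_bounds[OF a \<beta> assms(10,11), where 'a='a] by blast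
  define c1 where "c1 = alpha_H H * c / 4"
  define c2 where "c2 = 4 * (alpha_H H * C)"
  have c12: "c1 > 0" "c2 > 0" using alpha c by (simp_all add: c1_def c2_def)
  have main: "c1 * (t - s) powr (a + 2 - \<beta>) \<le> (LINT \<omega>|P. (u t x \<omega> - u s x \<omega>)\<^sup>2) \<and>
     (LINT \<omega>|P. (u t x \<omega> - u s x \<omega>)\<^sup>2) \<le> c2 * (t - s) powr (a + 2 - \<beta>)"
    if st: "t0 \<le> s" "s < t" "t \<le> T" for s t
  proof -
    let ?h = "(t - s) powr (a + 2 - \<beta>)"
    let ?V = "LINT \<omega>|P. (u t x \<omega> - u s x \<omega>)\<^sup>2"
    let ?I = "LINT \<xi>|(spectral_measure \<beta> :: 'a measure). wave_spectral_density a s t (norm \<xi>)"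
    note b = c(3)[OF st]
    have int: "integrable (spectral_measure \<beta>) (\<lambda>\<xi>::'a. wave_spectral_density (2 * H - 1) s t (norm \<xi>))"
      using b by (simp add: a_def)
    have st0: "0 \<le> s" "0 \<le> t" using st assms(10) by simp_all
    have comp: "?V \<le> 4 * (alpha_H H * ?I)" "alpha_H H * ?I \<le> 4 * ?V"
      using mild_solution_increment_comparable[OF assms(1,8,7) \<beta>' assms(2,3,9) st0 int, of x]
      by (simp_all add: a_def)
    have "alpha_H H * (c * ?h) \<le> alpha_H H * ?I" "alpha_H H * ?I \<le> alpha_H H * (C * ?h)"
      using b alpha by (auto intro!: mult_left_mono)
    with comp show ?thesis by (auto simp: c1_def c2_def algebra_simps)
  qed
  have "\<forall>s\<in>{t0..T}. \<forall>t\<in>{t0..T}.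
      c1 * \<bar>t - s\<bar> powr (2 * H + 1 - \<beta>) \<le> (LINT \<omega>|P. \<bar>u t x \<omega> - u s x \<omega>\<bar>\<^sup>2) \<and>
      (LINT \<omega>|P. \<bar>u t x \<omega> - u s x \<omega>\<bar>\<^sup>2) \<le> c2 * \<bar>t - s\<bar> powr (2 * H + 1 - \<beta>)"
  proof (intro ballI)
    fix s t assume st: "s \<in> {t0..T}" "t \<in> {t0..T}"
    let ?V = "LINT \<omega>|P. \<bar>u t x \<omega> - u s x \<omega>\<bar>\<^sup>2"
    show "c1 * \<bar>t - s\<bar> powr (2 * H + 1 - \<beta>) \<le> ?V \<and> ?V \<le> c2 * \<bar>t - s\<bar> powr (2 * H + 1 - \<beta>)"
    proof (cases s t rule: linorder_cases)
      case less
      then show ?thesis using main[of s t, folded exponent] st by simp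
    next
      case equal
      then show ?thesis by simp
    next
      case greater
      have "?V = (LINT \<omega>|P. (u s x \<omega> - u t x \<omega>)\<^sup>2)" by (simp add: power2_commute)
      then show ?thesis using main[of t s, folded exponent] st greater by (simp add: abs_minus_commute)
    qed
  qed
  with c12 show ?thesis by blast
qed

end
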